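(* Let $N\ge 3$ and let $\mathcal{L}=\sum_{j=1}^m X_j^2$ be a homogeneous Hörmander operator on $\mathbb{R}^N$ (as defined in the context), with associated dilations $\{\delta_\lambda\}_{\lambda>0}$. If $F\subseteq\mathbb{R}^N$ contains a non-degenerate $\delta_\lambda$-cone, then there exists $p>1$ such that $F$ is $p_{\mathcal{L}}$-unbounded.
   Context: Homogeneous Hörmander operator: $X_1,\dots,X_m$ are smooth vector fields on $\mathbb{R}^N$, $N\ge3$, linearly independent (in the real vector space of smooth vector fields on $\mathbb{R}^N$), such that: (I) each $X_j$ is $\delta_\lambda$-homogeneous of degree $1$, i.e. $X_j(\varphi\circ\delta_\lambda)=\lambda\,(X_j\varphi)\circ\delta_\lambda$ for all $\varphi\in C^\infty(\mathbb{R}^N)$ and $\lambda>0$, where $\delta_\lambda(x)=(\lambda^{\sigma_1}x_1,\dots,\lambda^{\sigma_N}x_N)$ and $1=\sigma_1\le\dots\le\sigma_N$ are positive integers; (II) (Hörmander rank condition) $\dim\{X(x):X\in\mathrm{Lie}\{X_1,\dots,X_m\}\}=N$ for every $x\in\mathbb{R}^N$. Then $\mathcal{L}:=\sum_{j=1}^mX_j^2$. Fundamental solution: $\Gamma$ denotes the global fundamental solution of $\mathcal{L}$, i.e. the (known to exist) function $\Gamma:\{(x,y)\in\mathbb{R}^N\times\mathbb{R}^N:x\neq y\}\to(0,\infty)$ which is $C^\infty$, symmetric, has $\Gamma(x;\cdot)\in L^1_{\mathrm{loc}}(\mathbb{R}^N)$, satisfies $\int_{\mathbb{R}^N}\Gamma(x;y)\mathcal{L}\varphi(y)\,dy=-\varphi(x)$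 for all $\varphi\in C_0^\infty(\mathbb{R}^N)$ and $x\in\mathbb{R}^N$, $\lim_{y\to x}\Gamma(x;y)=\infty$, $\lim_{\|y\|\to\infty}\Gamma(x;y)=0$, and $\Gamma(\delta_\lambda(x);\delta_\lambda(y))=\lambda^{2-Q}\Gamma(x;y)$ with $Q=\sum_{j=1}^N\sigma_j$. Set $\gamma(x,y)=1/\Gamma(x;y)$ for $x\ne y$, $\gamma(x,x)=0$, and $\Omega(x,r)=\{y:\gamma(x,y)<r\}$ ($\Gamma$-ball), $r>0$. $p_{\mathcal{L}}$-boundedness: for $p\in(1,\infty)$, $F\subseteq\mathbb{R}^N$ is $p_{\mathcal{L}}$-bounded if there is a countable family $\{\Omega(x_n,r_n)\}_{n\in J}$ of $\Gamma$-balls such that $F\subseteq\bigcup_{n\in J}\Omega(x_n,r_n)$ and $\sum_{n\in J}\big(r_n/\gamma(0,x_n)\big)^p<\infty$ (a term with $x_n=0$ counts as $+\infty$). $F$ is $p_{\mathcal{L}}$-unbounded if it is not $p_{\mathcal{L}}$-bounded. Non-degenerate $\delta_\lambda$-cone: a set $C\subseteq\mathbb{R}^N$ with $\mathrm{int}(C)\ne\varnothing$ for which there is $\lambda_0>0$ such that $\delta_\lambda(C)\subseteq C$ for every $\lambda\ge\lambda_0$. *)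

theory Defs
  imports "HOL-Analysis.Analysis"
begin

section \<open>Smooth functions\<close>

text \<open>
  On an open subset of a finite-dimensional space, \<^term>\<open>k\<close>-fold continuous differentiability is
  equivalent to existence and continuity of all iterated directional derivatives up to
  order \<^term>\<open>k\<close>. The predicates below are only used for open \<^term>\<open>S\<close>.
\<close>

primrec Ck_on :: "nat \<Rightarrow> 'a::euclidean_space set \<Rightarrow> ('a \<Rightarrow> 'b::real_normed_vector) \<Rightarrow> bool" where
  "Ck_on 0 S f \<longleftrightarrow> continuous_on S f"
| "Ck_on (Suc k) S f \<longleftrightarrow>
     (\<forall>x\<in>S. f differentiable (at x)) \<and> (\<forall>v. Ck_on k S (\<lambda>x. frechet_derivative f (at x) v))"

definition smooth_on :: "'a::euclidean_space set \<Rightarrow> ('a \<Rightarrow> 'b::real_normed_vector) \<Rightarrow> bool" where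
  "smooth_on S f \<longleftrightarrow> (\<forall>k. Ck_on k S f)"

definition test_function :: "('a::euclidean_space \<Rightarrow> real) \<Rightarrow> bool" where
  "test_function \<phi> \<longleftrightarrow> smooth_on UNIV \<phi> \<and> compact (closure {x. \<phi> x \<noteq> 0})"

section \<open>Vector fields\<close>

text \<open>
  A vector field \<open>\<Sum>\<^sub>i a\<^sub>i \<partial>\<^sub>i\<close> is represented by its coefficient map \<open>x \<mapsto> (a\<^sub>1(x), \<dots>, a\<^sub>N(x))\<close>;
  \<open>vf_apply V \<phi>\<close> is its action on functions.
\<close>

definition vf_apply :: "(real ^ 'n \<Rightarrow> real ^ 'n) \<Rightarrow> (real ^ 'n \<Rightarrow> real) \<Rightarrow> real ^ 'n \<Rightarrow> real" where
  "vf_apply V \<phi> = (\<lambda>x. frechet_derivative \<phi> (at x) (V x))"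

text \<open>Coefficient map of the commutator \<open>V W - W V\<close> (for smooth \<open>V\<close>, \<open>W\<close>).\<close>

definition vf_bracket ::
  "(real ^ 'n \<Rightarrow> real ^ 'n) \<Rightarrow> (real ^ 'n \<Rightarrow> real ^ 'n) \<Rightarrow> real ^ 'n \<Rightarrow> real ^ 'n" where
  "vf_bracket V W =
     (\<lambda>x. frechet_derivative W (at x) (V x) - frechet_derivative V (at x) (W x))"

inductive_set lie_generated :: "(real ^ 'n \<Rightarrow> real ^ 'n) set \<Rightarrow> (real ^ 'n \<Rightarrow> real ^ 'n) set"
  for G :: "(real ^ 'n \<Rightarrow> real ^ 'n) set" where
  base: "V \<in> G \<Longrightarrow> V \<in> lie_generated G"
| zero: "(\<lambda>x. 0) \<in> lie_generated G"
| add: "V \<in> lie_generated G \<Longrightarrow> W \<in> lie_generated G \<Longrightarrow> (\<lambda>x. V x + W x) \<in> lie_generated G"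
| scale: "V \<in> lie_generated G \<Longrightarrow> (\<lambda>x. c *\<^sub>R V x) \<in> lie_generated G"
| bracket: "V \<in> lie_generated G \<Longrightarrow> W \<in> lie_generated G \<Longrightarrow> vf_bracket V W \<in> lie_generated G"

section \<open>Homogeneous Hoermander operators\<close>

definition dil :: "('n::finite \<Rightarrow> nat) \<Rightarrow> real \<Rightarrow> real ^ 'n \<Rightarrow> real ^ 'n" where
  "dil \<sigma> l x = (\<chi> i. l ^ \<sigma> i * x $ i)"

definition homogeneous_degree_1 :: "('n::finite \<Rightarrow> nat) \<Rightarrow> (real ^ 'n \<Rightarrow> real ^ 'n) \<Rightarrow> bool" where
  "homogeneous_degree_1 \<sigma> V \<longleftrightarrow>
     (\<forall>\<phi> l x. smooth_on UNIV \<phi> \<longrightarrow> l > 0 \<longrightarrow>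
        vf_apply V (\<phi> \<circ> dil \<sigma> l) x = l * vf_apply V \<phi> (dil \<sigma> l x))"

text \<open>
  The linear order on the index type plays the role of the numbering \<open>1, \<dots>, N\<close> of the
  coordinates, so the first two conjuncts say \<open>1 = \<sigma>\<^sub>1 \<le> \<dots> \<le> \<sigma>\<^sub>N\<close>.
  Linear independence is over the reals, as functions and not pointwise.
\<close>

definition homogeneous_hoermander ::
  "('n::{finite,linorder} \<Rightarrow> nat) \<Rightarrow> nat \<Rightarrow>
     (nat \<Rightarrow> real ^ 'n::{finite,linorder} \<Rightarrow> real ^ 'n::{finite,linorder}) \<Rightarrow> bool" where
  "homogeneous_hoermander \<sigma> m X \<longleftrightarrow>
     mono \<sigma> \<and> \<sigma> (Min UNIV) = 1 \<and>
     (\<forall>j\<in>{1..m}. smooth_on UNIV (X j)) \<and>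
     (\<forall>c :: nat \<Rightarrow> real. (\<forall>x. (\<Sum>j=1..m. c j *\<^sub>R X j x) = 0) \<longrightarrow> (\<forall>j\<in>{1..m}. c j = 0)) \<and>
     (\<forall>j\<in>{1..m}. homogeneous_degree_1 \<sigma> (X j)) \<and>
     (\<forall>x. dim {V x | V. V \<in> lie_generated (X ` {1..m})} = CARD('n))"

definition sum_of_squares_op ::
  "nat \<Rightarrow> (nat \<Rightarrow> real ^ 'n \<Rightarrow> real ^ 'n) \<Rightarrow> (real ^ 'n \<Rightarrow> real) \<Rightarrow> real ^ 'n \<Rightarrow> real" where
  "sum_of_squares_op m X \<phi> x = (\<Sum>j=1..m. vf_apply (X j) (vf_apply (X j) \<phi>) x)"

section \<open>Global fundamental solution\<close>

text \<open>
  \<open>\<Gamma>\<close> is only meaningful off the diagonal: apart from integrals, which do not see a single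
  point, no condition depends on the values \<open>\<Gamma> x x\<close>.
\<close>

definition fundamental_solution ::
  "('n::finite \<Rightarrow> nat) \<Rightarrow> nat \<Rightarrow> (nat \<Rightarrow> real ^ 'n \<Rightarrow> real ^ 'n) \<Rightarrow>
     (real ^ 'n \<Rightarrow> real ^ 'n \<Rightarrow> real) \<Rightarrow> bool" where
  "fundamental_solution \<sigma> m X \<Gamma> \<longleftrightarrow>
     (\<forall>x y. x \<noteq> y \<longrightarrow> \<Gamma> x y > 0) \<and>
     smooth_on {(x, y). x \<noteq> y} (\<lambda>(x, y). \<Gamma> x y) \<and>
     (\<forall>x y. x \<noteq> y \<longrightarrow> \<Gamma> x y = \<Gamma> y x) \<and>
     (\<forall>x K. compact K \<longrightarrow> set_integrable lborel K (\<Gamma> x)) \<and>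
     (\<forall>\<phi> x. test_function \<phi> \<longrightarrow>
        (LINT y|lborel. \<Gamma> x y * sum_of_squares_op m X \<phi> y) = - \<phi> x) \<and>
     (\<forall>x. filterlim (\<Gamma> x) at_top (at x)) \<and>
     (\<forall>x. (\<Gamma> x \<longlongrightarrow> 0) at_infinity) \<and>
     (\<forall>x y l. x \<noteq> y \<longrightarrow> l > 0 \<longrightarrow>
        \<Gamma> (dil \<sigma> l x) (dil \<sigma> l y) = l powr (2 - real (\<Sum>i\<in>UNIV. \<sigma> i)) * \<Gamma> x y)"

definition gamma_recip :: "('a \<Rightarrow> 'a \<Rightarrow> real) \<Rightarrow> 'a \<Rightarrow> 'a \<Rightarrow> real" where
  "gamma_recip \<Gamma> x y = (if x = y then 0 else 1 / \<Gamma> x y)"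

definition gamma_ball :: "('a \<Rightarrow> 'a \<Rightarrow> real) \<Rightarrow> 'a \<Rightarrow> real \<Rightarrow> 'a set" where
  "gamma_ball \<Gamma> x r = {y. gamma_recip \<Gamma> x y < r}"

section \<open>Boundedness and cones\<close>

text \<open>
  Countable index sets are taken, without loss of generality, as subsets of \<^typ>\<open>nat\<close>.
  The condition \<open>c n \<noteq> 0\<close> encodes the convention that a ball centred at the origin
  contributes \<open>+\<infinity>\<close> to the series (division by zero would give \<open>0\<close>).
\<close>

definition p_bounded ::
  "('a::real_normed_vector \<Rightarrow> 'a \<Rightarrow> real) \<Rightarrow> real \<Rightarrow> 'a set \<Rightarrow> bool" where
  "p_bounded \<Gamma> p F \<longleftrightarrow>
     (\<exists>(J :: nat set) c r.
        (\<forall>n\<in>J. r n > 0 \<and> c n \<noteq> 0) \<and>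
        F \<subseteq> (\<Union>n\<in>J. gamma_ball \<Gamma> (c n) (r n)) \<and>
        (\<lambda>n. (r n / gamma_recip \<Gamma> 0 (c n)) powr p) summable_on J)"

definition nondegenerate_cone :: "('n::finite \<Rightarrow> nat) \<Rightarrow> (real ^ 'n) set \<Rightarrow> bool" where
  "nondegenerate_cone \<sigma> C \<longleftrightarrow>
     interior C \<noteq> {} \<and> (\<exists>l0>0. \<forall>l\<ge>l0. dil \<sigma> l ` C \<subseteq> C)"

end

theory Submission
  imports Defs
begin

text \<open>
  The exponent is \<open>p = 1 + 2/Q\<close>, and the proof is a Nash-type argument. Testing \<open>L \<Gamma>(c, \<cdot>) = 0\<close> against a
  function of \<open>\<Gamma>(c, \<cdot>)\<close> shows that the truncation \<open>u\<close> of \<open>\<Gamma>(c, \<cdot>)\<close> at height \<open>t\<close> has horizontal energy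
  \<open>O(t)\<close>, uniformly for \<open>c\<close> in a compact set; hence moving along a horizontal path of length \<open>\<rho>\<close> changes
  \<open>u\<close> by \<open>O(\<rho>\<^sup>2 t)\<close> in squared \<open>L\<^sup>2\<close> norm. By homogeneity all coefficients are triangular with respect to the
  weights, so group commutators of the flows, run for time at most \<open>\<rho>\<close>, produce measure-preserving maps that
  sweep out a box of volume \<open>\<rho>\<^sup>Q\<close> from every starting point. If \<open>\<rho>\<^sup>Q\<close> exceeds twice the measure of
  \<open>{\<Gamma>(c, \<cdot>) > t/8}\<close>, most of these displacements leave that set, which bounds the measure of
  \<open>{\<Gamma>(c, \<cdot>) > t}\<close> by \<open>O(\<rho>\<^sup>2 / t)\<close>. A first displacement of fixed length leaving a ball gives the measure
  bound \<open>O(1/t)\<close>; choosing \<open>\<rho>\<close> accordingly improves it to \<open>O(t powr (- p))\<close>.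

  Since \<open>\<Gamma>\<close>-balls scale with the dilations, a small ball inside the cone, blown up far enough to avoid
  finitely many \<open>\<Gamma>\<close>-balls of the covering, would be covered by balls whose rescaled total measure is
  smaller than its own.
\<close>

section \<open>Calculus of iterated directional derivatives\<close>


text \<open>There is no group of translations here, so estimates are uniform in the pole only on
  compact sets, and dilations must supply the rest. What makes this work is the quantity
  \<open>r * \<Gamma> 0 c\<close>: it is the term \<open>r / gamma_recip \<Gamma> 0 c\<close> of the
  series, and it does not change when a \<Gamma>-ball is dilated, so every ball of the covering can
  be compared with one fixed ball of the cone. A bound of order \<open>t powr (- p)\<close> on
  superlevel sets, taken at \<open>t = 1 / r\<close>, turns p-th powers of these terms into
  measures. Any exponent above 1 will do, so one Nash step beyond the order \<open>1 / t\<close> is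
  enough; iterating the step would send p to 1 + 2p/Q and approach Q/(Q - 2).

  Smoothness at the origin makes homogeneous functions rigid. Flows are therefore finite exponential
  series, and commutators have exact leading terms for all times, without any smallness. A
  displacement of size s in a coordinate of weight k costs a path length of order
  \<open>root k s\<close>, which is why the box swept out with length \<rho> has sides
  \<open>\<rho> ^ \<sigma> i\<close>.\<close>

lemma frechet_derivative_eqI: "(f has_derivative f') (at x) \<Longrightarrow> frechet_derivative f (at x) v = f' v"
  using frechet_derivative_at by metis

lemma Ck_on_SucD: "Ck_on (Suc k) S f \<Longrightarrow> Ck_on k S f"
proof (induction k arbitrary: f)
  case 0
  then show ?case
    by (auto intro!: continuous_at_imp_continuous_on differentiable_imp_continuous_within)
next
  case (Suc k)
  then show ?case by (metis Ck_on.simps(2))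
qed

lemma Ck_on_cong:
  assumes "open S" "Ck_on k S f" "\<And>x. x \<in> S \<Longrightarrow> f x = g x"
  shows "Ck_on k S g"
  using assms(2,3)
proof (induction k arbitrary: f g)
  case 0
  then show ?case using continuous_on_cong by (metis Ck_on.simps(1))
next
  case (Suc k)
  have d: "(g has_derivative frechet_derivative f (at x)) (at x)" if "x \<in> S" for x
  proof (rule has_derivative_transform_within_open[OF _ \<open>open S\<close> that])
    show "(f has_derivative frechet_derivative f (at x)) (at x)"
      using Suc.prems(1) that frechet_derivative_works by auto
  qed (use Suc.prems in auto)
  have "Ck_on k S (\<lambda>x. frechet_derivative g (at x) v)" for v
  proof (rule Suc.IH)
    show "Ck_on k S (\<lambda>x. frechet_derivative f (at x) v)" using Suc.prems by auto
  qed (use d frechet_derivative_eqI in metis)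
  then show ?case using d by (auto simp: differentiable_def)
qed

text \<open>\<open>Ck_on\<close> is phrased with \<open>frechet_derivative\<close>; this rule
  accepts any explicitly known derivative, so that the closure properties become inductions over the
  differentiation rules.\<close>

lemma Ck_on_SucI:
  assumes "open S" "\<And>x. x \<in> S \<Longrightarrow> (f has_derivative f' x) (at x)"
    "\<And>v. Ck_on k S (\<lambda>x. f' x v)"
  shows "Ck_on (Suc k) S f"
proof -
  have "Ck_on k S (\<lambda>x. frechet_derivative f (at x) v)" for v
    by (rule Ck_on_cong[OF assms(1) assms(3)[of v]]) (use assms(2) frechet_derivative_eqI in metis)
  then show ?thesis using assms(2) by (auto simp: differentiable_def)
qed

lemma Ck_on_has_derivative:
  "Ck_on (Suc k) S f \<Longrightarrow> x \<in> S \<Longrightarrow> (f has_derivative frechet_derivative f (at x)) (at x)"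
  using frechet_derivative_works by auto

lemma Ck_on_const [simp]: "Ck_on k S (\<lambda>x. c)"
  by (induction k arbitrary: c) auto

lemma Ck_on_bounded_linear_compose:
  assumes "open S" "bounded_linear L" "Ck_on k S f"
  shows "Ck_on k S (\<lambda>x. L (f x))"
  using assms(3)
proof (induction k arbitrary: f)
  case 0
  then show ?case using assms(2) by (simp add: bounded_linear.continuous_on)
next
  case (Suc k)
  show ?case
    by (rule Ck_on_SucI[OF assms(1) bounded_linear.has_derivative[OF assms(2) Ck_on_has_derivative[OF Suc.prems]]])
       (use Suc in auto)
qed

lemma Ck_on_bounded_linear:
  assumes "open S" "bounded_linear L" shows "Ck_on k S L"
proof (cases k)
  case 0
  then show ?thesis using assms by (simp add: linear_continuous_on)
next
  case (Suc j)
  have "Ck_on (Suc j) S L"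
    by (rule Ck_on_SucI[OF assms(1) bounded_linear_imp_has_derivative[OF assms(2)]]) auto
  then show ?thesis using Suc by simp
qed

lemma Ck_on_add:
  assumes "open S" "Ck_on k S f" "Ck_on k S g"
  shows "Ck_on k S (\<lambda>x. f x + g x)"
  using assms(2,3)
proof (induction k arbitrary: f g)
  case 0
  then show ?case by (simp add: continuous_on_add)
next
  case (Suc k)
  show ?case
    by (rule Ck_on_SucI[OF assms(1)
          has_derivative_add[OF Ck_on_has_derivative[OF Suc.prems(1)] Ck_on_has_derivative[OF Suc.prems(2)]]])
       (use Suc in auto)
qed

lemma Ck_on_mult:
  fixes f g :: "'a::euclidean_space \<Rightarrow> real"
  assumes "open S" "Ck_on k S f" "Ck_on k S g"
  shows "Ck_on k S (\<lambda>x. f x * g x)"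
  using assms(2,3)
proof (induction k arbitrary: f g)
  case 0
  then show ?case by (simp add: continuous_on_mult)
next
  case (Suc k)
  show ?case
    by (rule Ck_on_SucI[OF assms(1)
          has_derivative_mult[OF Ck_on_has_derivative[OF Suc.prems(1)] Ck_on_has_derivative[OF Suc.prems(2)]]])
       (use Suc Ck_on_SucD[OF Suc.prems(1)] Ck_on_SucD[OF Suc.prems(2)] in \<open>auto intro!: Ck_on_add[OF assms(1)]\<close>)
qed

lemma Ck_on_sum:
  assumes "open S" "finite I" "\<And>i. i \<in> I \<Longrightarrow> Ck_on k S (f i)"
  shows "Ck_on k S (\<lambda>x. \<Sum>i\<in>I. f i x)"
  using assms(2,3) by (induction I rule: finite_induct) (auto intro: Ck_on_add[OF assms(1)])

lemma Ck_on_section: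
  fixes f :: "'a::euclidean_space \<times> 'b::euclidean_space \<Rightarrow> 'c::real_normed_vector"
  assumes "Ck_on k S f" "open S" "open T" "\<And>y. y \<in> T \<Longrightarrow> (c, y) \<in> S"
  shows "Ck_on k T (\<lambda>y. f (c, y))"
  using assms(1)
proof (induction k arbitrary: f)
  case 0
  then have "continuous_on S f" by simp
  then have "continuous_on T (f \<circ> (\<lambda>y. (c, y)))"
    by (intro continuous_on_compose continuous_intros) (auto intro: continuous_on_subset simp: assms(4) image_subset_iff)
  then show ?case by (simp add: o_def)
next
  case (Suc k)
  have d: "((\<lambda>y. f (c, y)) has_derivative (\<lambda>v. frechet_derivative f (at (c, y)) (0, v))) (at y)"
    if "y \<in> T" for y
  proof -
    have "((\<lambda>y. (c, y)) has_derivative (\<lambda>v. (0, v))) (at y)"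
      by (auto intro!: derivative_eq_intros)
    from diff_chain_at[OF this Ck_on_has_derivative[OF Suc.prems assms(4)[OF that]]]
    show ?thesis by (simp add: o_def)
  qed
  show ?case
    by (rule Ck_on_SucI[OF assms(3) d]) (use Suc in auto)
qed

lemma smooth_onD: "smooth_on S f \<Longrightarrow> Ck_on k S f" by (simp add: smooth_on_def)

lemma smooth_on_const [simp]: "smooth_on S (\<lambda>x. c)"
  and smooth_on_add: "open S \<Longrightarrow> smooth_on S f \<Longrightarrow> smooth_on S f2 \<Longrightarrow> smooth_on S (\<lambda>x. f x + f2 x)"
  and smooth_on_mult: "open S \<Longrightarrow> smooth_on S g \<Longrightarrow> smooth_on S h \<Longrightarrow> smooth_on S (\<lambda>x. g x * h x :: real)"
  and smooth_on_sum: "open S \<Longrightarrow> finite I \<Longrightarrow> (\<And>i. i \<in> I \<Longrightarrow> smooth_on S (F i)) \<Longrightarrow> smooth_on S (\<lambda>x. \<Sum>i\<in>I. F i x)"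
  and smooth_on_linear_compose: "open S \<Longrightarrow> bounded_linear L \<Longrightarrow> smooth_on S f \<Longrightarrow> smooth_on S (\<lambda>x. L (f x))"
  and smooth_on_linear: "open S \<Longrightarrow> bounded_linear M \<Longrightarrow> smooth_on S M"
  by (auto simp: smooth_on_def Ck_on_add Ck_on_mult Ck_on_sum Ck_on_bounded_linear_compose Ck_on_bounded_linear)

lemma smooth_on_continuous: "smooth_on S f \<Longrightarrow> continuous_on S f"
  using smooth_onD[of S f 0] by simp

lemma smooth_on_has_derivative:
  "smooth_on S f \<Longrightarrow> x \<in> S \<Longrightarrow> (f has_derivative frechet_derivative f (at x)) (at x)"
  using Ck_on_has_derivative smooth_onD by blast

lemma smooth_on_frechet: "smooth_on S f \<Longrightarrow> smooth_on S (\<lambda>x. frechet_derivative f (at x) v)"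
  unfolding smooth_on_def by (metis Ck_on.simps(2))

section \<open>The flat exponential and smooth bumps of compact support\<close>

definition flat_exp :: "nat \<Rightarrow> real \<Rightarrow> real" where
  "flat_exp n s = (if s > 0 then exp (- (1 / s)) / s ^ n else 0)"

lemma flat_exp_tendsto_0: "(flat_exp n \<longlongrightarrow> 0) (at 0)"
proof -
  have "((\<lambda>x. x ^ n / exp x) \<longlongrightarrow> 0) (at_top :: real filter)"
    by (rule tendsto_power_div_exp_0)
  then have "((\<lambda>s. (inverse s) ^ n / exp (inverse s)) \<longlongrightarrow> 0) (at_right (0::real))"
    by (rule filterlim_compose) (rule filterlim_inverse_at_top_right)
  then have "(flat_exp n \<longlongrightarrow> 0) (at_right 0)"
    by (rule Lim_transform_eventually)
       (auto simp: flat_exp_def eventually_at_filter exp_minus field_simps)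
  moreover have "(flat_exp n \<longlongrightarrow> 0) (at_left 0)"
    by (rule tendsto_eventually) (auto simp: flat_exp_def eventually_at_filter)
  ultimately show ?thesis by (simp add: filterlim_split_at)
qed

text \<open>The powers of \<open>s\<close> in the denominator are carried along so that the family
  is closed under differentiation; smoothness then follows by induction with \<open>n\<close>
  arbitrary.\<close>

lemma flat_exp_has_derivative:
  "(flat_exp n has_real_derivative (flat_exp (n + 2) s - real n * flat_exp (Suc n) s)) (at s)"
proof -
  consider "s > 0" | "s < 0" | "s = 0" by linarith
  then show ?thesis
  proof cases
    case 1
    have "((\<lambda>s. exp (- (1 / s)) / s ^ n) has_real_derivative
        (flat_exp (n + 2) s - real n * flat_exp (Suc n) s)) (at s)"
      using 1
      by (auto intro!: derivative_eq_intros simp: flat_exp_def)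
         (cases n; auto simp: field_simps power2_eq_square)
    then show ?thesis
      by (rule has_field_derivative_transform_within_open[where S="{0<..}"])
         (use 1 in \<open>auto simp: flat_exp_def\<close>)
  next
    case 2
    have "((\<lambda>s. 0) has_real_derivative (flat_exp (n + 2) s - real n * flat_exp (Suc n) s)) (at s)"
      using 2 by (auto intro!: derivative_eq_intros simp: flat_exp_def)
    then show ?thesis
      by (rule has_field_derivative_transform_within_open[where S="{..<0}"])
         (use 2 in \<open>auto simp: flat_exp_def\<close>)
  next
    case 3
    \<comment> \<open>The difference quotient at 0 is itself a member of the family, namely
      \<open>flat_exp (Suc n)\<close>.\<close>
    have "((\<lambda>h. (flat_exp n (0 + h) - flat_exp n 0) / h) \<longlongrightarrow> 0) (at 0)"
      by (rule Lim_transform_eventually[OF flat_exp_tendsto_0[of "Suc n"]])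
         (auto simp: flat_exp_def eventually_at_filter)
    then show ?thesis using 3 by (simp add: DERIV_def flat_exp_def)
  qed
qed

lemma Ck_on_flat_exp_compose:
  fixes q :: "'a::euclidean_space \<Rightarrow> real"
  assumes "smooth_on UNIV q"
  shows "Ck_on k UNIV (\<lambda>x. flat_exp n (q x))"
proof (induction k arbitrary: n)
  case 0
  have "continuous_on UNIV (flat_exp n)"
    using flat_exp_has_derivative DERIV_isCont continuous_at_imp_continuous_on by blast
  then have "continuous_on UNIV (flat_exp n \<circ> q)"
    by (intro continuous_on_compose smooth_on_continuous[OF assms])
       (auto intro: continuous_on_subset)
  then show ?case by (simp add: o_def)
next
  case (Suc k)
  have "((\<lambda>x. flat_exp n (q x)) has_derivative
     (\<lambda>v. (flat_exp (n + 2) (q x) + (- real n) * flat_exp (Suc n) (q x)) * frechet_derivative q (at x) v)) (at x)" for x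
    using diff_chain_at[OF smooth_on_has_derivative[OF assms UNIV_I, of x]
        has_field_derivative_imp_has_derivative[OF flat_exp_has_derivative[of n "q x"]]]
    by (simp add: o_def)
  then show ?case
    by (rule Ck_on_SucI[OF open_UNIV])
       (rule Ck_on_mult[OF open_UNIV Ck_on_add[OF open_UNIV Suc Ck_on_mult[OF open_UNIV Ck_on_const Suc]]
           smooth_onD[OF smooth_on_frechet[OF assms]]])
qed

text \<open>An inner product replaces the norm because the argument of \<open>flat_exp\<close> is
  then a polynomial.\<close>

definition bump :: "'a::euclidean_space \<Rightarrow> real \<Rightarrow> 'a \<Rightarrow> real" where
  "bump z r y = flat_exp 0 (r\<^sup>2 - (y - z) \<bullet> (y - z))"

lemma bump_pos_iff: "r > 0 \<Longrightarrow> bump z r y > 0 \<longleftrightarrow> dist y z < r"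
  and bump_eq_0: "r > 0 \<Longrightarrow> dist y z \<ge> r \<Longrightarrow> bump z r y = 0"
proof -
  have *: "r\<^sup>2 - (y - z) \<bullet> (y - z) > 0 \<longleftrightarrow> dist y z < r" if "r > 0"
    using that by (simp add: dot_square_norm dist_norm) (smt (verit) norm_ge_zero power_mono power2_le_imp_le)
  show "r > 0 \<Longrightarrow> bump z r y > 0 \<longleftrightarrow> dist y z < r"
    using * by (auto simp: bump_def flat_exp_def)
  show "r > 0 \<Longrightarrow> dist y z \<ge> r \<Longrightarrow> bump z r y = 0"
    using * by (auto simp: bump_def flat_exp_def)
qed

lemma smooth_on_inner: "open S \<Longrightarrow> smooth_on S (\<lambda>x::'a::euclidean_space. x \<bullet> b)"
  by (rule smooth_on_linear) (auto intro: bounded_linear_inner_left)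

lemma smooth_bump: "smooth_on UNIV (bump (z::'a::euclidean_space) r)"
proof -
  have "(y - z) \<bullet> (y - z) = (\<Sum>b\<in>Basis. (y \<bullet> b + - (z \<bullet> b)) * (y \<bullet> b + - (z \<bullet> b)))" for y
    by (subst euclidean_inner) (simp add: inner_diff_left)
  then have "(\<lambda>y. r\<^sup>2 - (y - z) \<bullet> (y - z)) =
    (\<lambda>y. r\<^sup>2 + (-1) * (\<Sum>b\<in>Basis. (y \<bullet> b + - (z \<bullet> b)) * (y \<bullet> b + - (z \<bullet> b))))"
    by (simp add: fun_eq_iff)
  moreover have "smooth_on UNIV \<dots>"
    by (intro smooth_on_add smooth_on_mult smooth_on_sum smooth_on_inner smooth_on_const) auto
  ultimately have "smooth_on UNIV (\<lambda>y. r\<^sup>2 - (y - z) \<bullet> (y - z))" by simp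
  then show ?thesis unfolding bump_def[abs_def] smooth_on_def
    using Ck_on_flat_exp_compose smooth_on_def by blast
qed

lemma bump_test_function:
  assumes "r > 0" shows "test_function (bump z r)"
proof -
  have "{x. bump z r x \<noteq> 0} \<subseteq> cball z r"
    using bump_eq_0[OF assms] by (force simp: dist_commute)
  then have "bounded {x. bump z r x \<noteq> 0}" using bounded_subset bounded_cball by blast
  then show ?thesis
    by (simp add: test_function_def smooth_bump compact_closure)
qed

section \<open>Functions and vector fields homogeneous under dilations\<close>


definition partial :: "'n::finite \<Rightarrow> (real ^ 'n \<Rightarrow> real) \<Rightarrow> real ^ 'n \<Rightarrow> real" where
  "partial i f x = frechet_derivative f (at x) (axis i 1)"

lemma frechet_derivative_sum_partial:
  assumes "f differentiable (at x)"
  shows "frechet_derivative f (at x) v = (\<Sum>i\<in>UNIV. v $ i * partial i f x)"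
proof -
  interpret linear "frechet_derivative f (at x)" by (rule linear_frechet_derivative[OF assms])
  have "v = (\<Sum>i\<in>UNIV. v $ i *\<^sub>R axis i 1)"
    by (simp add: vec_eq_iff axis_def if_distrib cong: if_cong)
  then have "frechet_derivative f (at x) v = frechet_derivative f (at x) (\<Sum>i\<in>UNIV. v $ i *\<^sub>R axis i 1)"
    by simp
  then show ?thesis by (simp add: sum scale partial_def)
qed

lemma vf_apply_sum_partial:
  "f differentiable (at x) \<Longrightarrow> vf_apply V f x = (\<Sum>i\<in>UNIV. V x $ i * partial i f x)"
  by (simp add: vf_apply_def frechet_derivative_sum_partial)

lemma smooth_on_differentiable: "smooth_on S f \<Longrightarrow> x \<in> S \<Longrightarrow> f differentiable (at x)"
  using smooth_onD[of S f 1] by simp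

lemma smooth_on_partial: "smooth_on S f \<Longrightarrow> smooth_on S (partial i f)"
  unfolding partial_def[abs_def] by (rule smooth_on_frechet)

lemma smooth_on_cong: "open S \<Longrightarrow> smooth_on S f \<Longrightarrow> (\<And>x. x \<in> S \<Longrightarrow> f x = g x) \<Longrightarrow> smooth_on S g"
  unfolding smooth_on_def using Ck_on_cong by metis

lemma Ck_on_subset: "Ck_on k S f \<Longrightarrow> T \<subseteq> S \<Longrightarrow> Ck_on k T f"
  by (induction k arbitrary: f) (auto intro: continuous_on_subset)

lemma smooth_on_subset: "smooth_on S f \<Longrightarrow> T \<subseteq> S \<Longrightarrow> smooth_on T f"
  unfolding smooth_on_def using Ck_on_subset by blast

lemma smooth_on_nth: "open S \<Longrightarrow> smooth_on S V \<Longrightarrow> smooth_on S (\<lambda>x. V x $ i)"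
  using smooth_on_linear_compose[of S "\<lambda>v. v $ i" V] bounded_linear_vec_nth by blast

lemma smooth_on_vf_apply:
  assumes "open S" "smooth_on S V" "smooth_on S f"
  shows "smooth_on S (vf_apply V f)"
  by (rule smooth_on_cong[OF assms(1), of "\<lambda>x. \<Sum>i\<in>UNIV. V x $ i * partial i f x"])
     (use assms in \<open>auto intro!: smooth_on_sum smooth_on_mult smooth_on_nth smooth_on_partial
        simp: vf_apply_sum_partial smooth_on_differentiable\<close>)

lemma smooth_on_coord: "open S \<Longrightarrow> smooth_on S (\<lambda>x::real^'n. x $ i)"
  by (rule smooth_on_linear) (auto intro: bounded_linear_vec_nth)

lemma vf_apply_coord [simp]: "vf_apply V (\<lambda>x. x $ i) x = V x $ i"
  unfolding vf_apply_def
  by (rule frechet_derivative_eqI) (rule bounded_linear_imp_has_derivative[OF bounded_linear_vec_nth])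

lemma vf_apply_const [simp]: "vf_apply V (\<lambda>x. c) x = 0"
  by (simp add: vf_apply_def)

lemma vf_apply_add:
  assumes "f differentiable (at x)" "g differentiable (at x)"
  shows "vf_apply V (\<lambda>x. f x + g x) x = vf_apply V f x + vf_apply V g x"
  unfolding vf_apply_def
  by (rule frechet_derivative_eqI) (intro has_derivative_add assms[unfolded frechet_derivative_works])

lemma vf_apply_diff:
  assumes "f differentiable (at x)" "g differentiable (at x)"
  shows "vf_apply V (\<lambda>x. f x - g x) x = vf_apply V f x - vf_apply V g x"
  unfolding vf_apply_def
  by (rule frechet_derivative_eqI) (intro has_derivative_diff assms[unfolded frechet_derivative_works])

lemma vf_apply_mult:
  assumes "f differentiable (at x)" "g differentiable (at x)"
  shows "vf_apply V (\<lambda>x. f x * g x) x = f x * vf_apply V g x + vf_apply V f x * g x"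
  unfolding vf_apply_def
  by (rule frechet_derivative_eqI) (intro has_derivative_mult assms[unfolded frechet_derivative_works])

lemma vf_apply_cmult:
  assumes "f differentiable (at x)"
  shows "vf_apply V (\<lambda>x. c * f x) x = c * vf_apply V f x"
  using vf_apply_mult[of "\<lambda>_. c" x f V] assms by (simp add: vf_apply_def)

lemma vf_apply_sum:
  assumes "finite I" "\<And>i. i \<in> I \<Longrightarrow> (f i) differentiable (at x)"
  shows "vf_apply V (\<lambda>x. \<Sum>i\<in>I. f i x) x = (\<Sum>i\<in>I. vf_apply V (f i) x)"
  using assms
proof (induction I rule: finite_induct)
  case (insert i I)
  then have "(\<lambda>x. \<Sum>i\<in>I. f i x) differentiable (at x)"
    by (intro differentiable_sum) auto
  then show ?case using insert by (simp add: vf_apply_add)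
qed simp

section \<open>Weighted homogeneous functions and fields: rigidity and brackets\<close>

locale weights =
  fixes \<sigma> :: "'n::finite \<Rightarrow> nat"
  assumes weight_pos: "\<sigma> i > 0"
begin

text \<open>Degrees are integers because differentiation may push them below 0. Smoothness up to the
  origin is part of the notion: it is the source of all the rigidity below.\<close>

definition hom_fun :: "int \<Rightarrow> (real ^ 'n \<Rightarrow> real) \<Rightarrow> bool" where
  "hom_fun d f \<longleftrightarrow> smooth_on UNIV f \<and> (\<forall>l>0. \<forall>y. f (dil \<sigma> l y) = l powi d * f y)"

text \<open>Weight \<open>k\<close> means that the field lowers degrees by \<open>k\<close>; the
  coefficient of the i-th partial derivative must then have degree
  \<open>\<sigma> i - k\<close>.\<close>

definition hom_vf :: "nat \<Rightarrow> (real ^ 'n \<Rightarrow> real ^ 'n) \<Rightarrow> bool" where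
  "hom_vf k V \<longleftrightarrow> smooth_on UNIV V \<and> (\<forall>i. hom_fun (int (\<sigma> i) - int k) (\<lambda>x. V x $ i))"

lemma hom_fun_smooth: "hom_fun d f \<Longrightarrow> smooth_on UNIV f"
  and hom_fun_dil: "hom_fun d f \<Longrightarrow> l > 0 \<Longrightarrow> f (dil \<sigma> l y) = l powi d * f y"
  by (auto simp: hom_fun_def)

lemma hom_fun_differentiable: "hom_fun d f \<Longrightarrow> f differentiable (at x)"
  using hom_fun_smooth smooth_on_differentiable by blast

lemma hom_fun_zero: "hom_fun d (\<lambda>x. 0)"
  by (simp add: hom_fun_def)

lemma hom_fun_const: "hom_fun 0 (\<lambda>x. c)"
  by (simp add: hom_fun_def)

lemma hom_fun_coord: "hom_fun (int (\<sigma> i)) (\<lambda>x. x $ i)"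
  by (simp add: hom_fun_def smooth_on_coord dil_def)

lemma hom_fun_add: "hom_fun d f \<Longrightarrow> hom_fun d g \<Longrightarrow> hom_fun d (\<lambda>x. f x + g x)"
  by (auto simp: hom_fun_def smooth_on_add algebra_simps)

lemma hom_fun_mult: "hom_fun d f \<Longrightarrow> hom_fun e g \<Longrightarrow> hom_fun (d + e) (\<lambda>x. f x * g x)"
  by (auto simp: hom_fun_def smooth_on_mult power_int_add)

lemma hom_fun_cmult: "hom_fun d f \<Longrightarrow> hom_fun d (\<lambda>x. c * f x)"
  using hom_fun_mult[OF hom_fun_const] by force

lemma hom_fun_sum: "finite I \<Longrightarrow> (\<And>i. i \<in> I \<Longrightarrow> hom_fun d (f i)) \<Longrightarrow> hom_fun d (\<lambda>x. \<Sum>i\<in>I. f i x)"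
  by (induction I rule: finite_induct) (auto intro: hom_fun_zero hom_fun_add)

lemma dil_axis: "dil \<sigma> l (axis i 1) = l ^ \<sigma> i *\<^sub>R axis i 1"
  by (simp add: dil_def vec_eq_iff axis_def)

lemma linear_dil: "linear (dil \<sigma> l)"
  by (rule linearI) (auto simp: dil_def vec_eq_iff algebra_simps)

lemma bounded_linear_dil: "bounded_linear (dil \<sigma> l)"
  using linear_dil linear_conv_bounded_linear by blast

lemma hom_fun_partial:
  assumes "hom_fun d f" shows "hom_fun (d - int (\<sigma> i)) (partial i f)"
proof -
  have "partial i f (dil \<sigma> l y) = l powi (d - int (\<sigma> i)) * partial i f y" if l: "l > 0" for l y
  proof -
    have "((\<lambda>y. f (dil \<sigma> l y)) has_derivative (\<lambda>v. frechet_derivative f (at (dil \<sigma> l y)) (dil \<sigma> l v))) (at y)"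
      using diff_chain_at[OF bounded_linear_imp_has_derivative[OF bounded_linear_dil[of l]]
          hom_fun_differentiable[OF assms, unfolded frechet_derivative_works]]
      by (simp add: o_def)
    moreover have "((\<lambda>y. f (dil \<sigma> l y)) has_derivative (\<lambda>v. l powi d * frechet_derivative f (at y) v)) (at y)"
      unfolding hom_fun_dil[OF assms l]
      by (intro has_derivative_mult_right hom_fun_differentiable[OF assms, unfolded frechet_derivative_works])
    ultimately have "frechet_derivative f (at (dil \<sigma> l y)) (dil \<sigma> l (axis i 1)) = l powi d * partial i f y"
      using has_derivative_unique unfolding partial_def by metis
    then have "l ^ \<sigma> i * partial i f (dil \<sigma> l y) = l powi d * partial i f y"
      using linear_frechet_derivative[OF hom_fun_differentiable[OF assms], of "dil \<sigma> l y"]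
      by (simp add: dil_axis linear_cmul partial_def)
    then show ?thesis using l by (simp add: power_int_diff field_simps)
  qed
  then show ?thesis using smooth_on_partial[OF hom_fun_smooth[OF assms]] by (auto simp: hom_fun_def)
qed

lemma hom_fun_vf_apply:
  assumes "hom_vf k V" "hom_fun d f" shows "hom_fun (d - int k) (vf_apply V f)"
proof -
  have "vf_apply V f = (\<lambda>x. \<Sum>i\<in>UNIV. V x $ i * partial i f x)"
    using vf_apply_sum_partial hom_fun_differentiable[OF assms(2)] by blast
  moreover have "hom_fun (d - int k) (\<lambda>x. V x $ i * partial i f x)" for i
    using hom_fun_mult[OF _ hom_fun_partial[OF assms(2)], of "int (\<sigma> i) - int k" "\<lambda>x. V x $ i" i] assms(1)
    by (simp add: hom_vf_def)
  ultimately show ?thesis by (simp add: hom_fun_sum)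
qed

lemma dil_tendsto_0: "((\<lambda>l. dil \<sigma> l y) \<longlongrightarrow> 0) (at_right 0)"
proof (rule vec_tendstoI)
  fix i
  have "((\<lambda>l::real. l ^ \<sigma> i * y $ i) \<longlongrightarrow> 0 ^ \<sigma> i * y $ i) (at_right 0)"
    by (intro tendsto_intros)
  then show "((\<lambda>l. dil \<sigma> l y $ i) \<longlongrightarrow> 0 $ i) (at_right 0)"
    using weight_pos[of i] by (simp add: dil_def zero_power)
qed

lemma hom_fun_tendsto: 
  assumes "hom_fun d f" shows "((\<lambda>l. f (dil \<sigma> l y)) \<longlongrightarrow> f 0) (at_right 0)"
proof -
  have "isCont f 0" using smooth_on_continuous[OF hom_fun_smooth[OF assms]] continuous_on_eq_continuous_at by blast
  then show ?thesis using dil_tendsto_0 isCont_tendsto_compose by blast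
qed

text \<open>Dilating towards the origin, \<open>f y\<close> equals a positive power of
  \<open>l\<close> times \<open>f (dil \<sigma> l y)\<close>, and the second factor converges to
  \<open>f 0\<close>. This vanishing is what terminates all expansions.\<close>

lemma hom_fun_neg:
  assumes "hom_fun d f" "d < 0" shows "f y = 0"
proof -
  obtain e where e: "d = - int (Suc e)" using \<open>d < 0\<close> by (metis negD)
  have "((\<lambda>l. l ^ Suc e * f (dil \<sigma> l y)) \<longlongrightarrow> 0 ^ Suc e * f 0) (at_right 0)"
    by (intro tendsto_intros hom_fun_tendsto[OF assms(1)])
  moreover have "\<forall>\<^sub>F l in at_right 0. l ^ Suc e * f (dil \<sigma> l y) = f y"
  proof -
    have "l ^ Suc e * f (dil \<sigma> l y) = f y" if "l > 0" for l
    proof -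
      have "l powi d = inverse (l ^ Suc e)" by (simp only: e power_int_minus power_int_of_nat)
      then show ?thesis using hom_fun_dil[OF assms(1) that, of y] that by (simp del: power_Suc)
    qed
    then show ?thesis by (auto simp: eventually_at_filter simp del: power_Suc)
  qed
  ultimately have "((\<lambda>l. f y) \<longlongrightarrow> 0) (at_right (0::real))"
    by (simp add: filterlim_cong[OF refl refl])
  then show ?thesis by (simp add: tendsto_const_iff)
qed

lemma hom_fun_0_const:
  assumes "hom_fun 0 f" shows "f y = f 0"
proof -
  have "((\<lambda>l. f y) \<longlongrightarrow> f 0) (at_right (0::real))"
    using hom_fun_tendsto[OF assms, of y] hom_fun_dil[OF assms]
    by (rule_tac Lim_transform_eventually) (auto simp: eventually_at_filter)
  then show ?thesis by (simp add: tendsto_const_iff)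
qed

lemma hom_fun_pos_0:
  assumes "hom_fun d f" "d > 0" shows "f 0 = 0"
proof -
  have "dil \<sigma> 2 0 = 0" by (simp add: dil_def vec_eq_iff)
  moreover have "(2::real) powi d > 1" using \<open>d > 0\<close> by (simp add: power_int_def)
  ultimately show ?thesis using hom_fun_dil[OF assms(1), of 2 0] by auto
qed

text \<open>A partial derivative in a coordinate of weight above \<open>d\<close> has negative
  degree and vanishes, so \<open>f\<close> is constant along the segment from \<open>y\<close> to
  \<open>z\<close>.\<close>

lemma hom_fun_indep:
  assumes "hom_fun d f" "\<And>i. int (\<sigma> i) \<le> d \<Longrightarrow> y $ i = z $ i"
  shows "f y = f z"
proof -
  have "((\<lambda>t. f (y + t *\<^sub>R (z - y))) has_real_derivative 0) (at t)" for t
  proof -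
    let ?p = "y + t *\<^sub>R (z - y)"
    have "((\<lambda>t. y + t *\<^sub>R (z - y)) has_derivative (\<lambda>s. s *\<^sub>R (z - y))) (at t)"
      by (auto intro!: derivative_eq_intros)
    from diff_chain_at[OF this hom_fun_differentiable[OF assms(1), unfolded frechet_derivative_works]]
    have "((\<lambda>t. f (y + t *\<^sub>R (z - y))) has_derivative (\<lambda>s. frechet_derivative f (at ?p) (s *\<^sub>R (z - y)))) (at t)"
      by (simp add: o_def)
    moreover have "(s * (z $ i - y $ i)) * partial i f ?p = 0" for s i
      using assms(2)[of i] hom_fun_neg[OF hom_fun_partial[OF assms(1)], of i ?p] by fastforce
    then have "frechet_derivative f (at ?p) (s *\<^sub>R (z - y)) = 0" for s
      unfolding frechet_derivative_sum_partial[OF hom_fun_differentiable[OF assms(1)]]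
      by (intro sum.neutral) simp
    moreover have "(*) 0 = (\<lambda>s::real. 0)" by auto
    ultimately show ?thesis by (simp add: has_field_derivative_def)
  qed
  from DERIV_isconst_all[OF allI[OF this], of 0 1] show ?thesis by simp
qed

lemma euler_identity:
  assumes "hom_fun d f"
  shows "(\<Sum>i\<in>UNIV. real (\<sigma> i) * (y $ i * partial i f y)) = of_int d * f y"
proof -
  have "((\<lambda>l. dil \<sigma> l y) has_derivative (\<lambda>s. s *\<^sub>R (\<chi> i. real (\<sigma> i) * y $ i))) (at 1)"
      unfolding dil_def
    proof (subst has_derivative_componentwise_within, safe)
      fix b :: "real ^ 'n" assume "b \<in> Basis"
      then obtain i where b: "b = axis i 1" by (auto simp: Basis_vec_def)
      have "((\<lambda>l::real. l ^ \<sigma> i * y $ i) has_derivative (\<lambda>s. s * (real (\<sigma> i) * y $ i))) (at 1)"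
        by (auto intro!: derivative_eq_intros)
      then show "((\<lambda>l. (\<chi> i. l ^ \<sigma> i * y $ i) \<bullet> b) has_derivative (\<lambda>s. s *\<^sub>R (\<chi> i. real (\<sigma> i) * y $ i) \<bullet> b)) (at 1)"
        by (simp add: b inner_axis)
    qed
  moreover have "dil \<sigma> 1 y = y" by (simp add: dil_def vec_eq_iff)
  ultimately have "((\<lambda>l. f (dil \<sigma> l y)) has_derivative
      (\<lambda>s. frechet_derivative f (at y) (s *\<^sub>R (\<chi> i. real (\<sigma> i) * y $ i)))) (at 1)"
    using diff_chain_at[of "\<lambda>l. dil \<sigma> l y" _ 1 f "frechet_derivative f (at y)"]
      hom_fun_differentiable[OF assms, unfolded frechet_derivative_works] by (simp add: o_def)
  moreover have "((\<lambda>l. f (dil \<sigma> l y)) has_derivative (\<lambda>s. (of_int d * f y) * s)) (at 1)"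
  proof -
    have "((\<lambda>l. l powi d * f y) has_real_derivative (of_int d * f y)) (at 1)"
      by (auto intro!: derivative_eq_intros)
    then have "((\<lambda>l. f (dil \<sigma> l y)) has_real_derivative (of_int d * f y)) (at 1)"
      by (rule has_field_derivative_transform_within_open[where S="{0<..}"]) (auto simp: hom_fun_dil[OF assms])
    then show ?thesis by (simp add: has_field_derivative_def)
  qed
  ultimately have "frechet_derivative f (at y) (1 *\<^sub>R (\<chi> i. real (\<sigma> i) * y $ i)) = of_int d * f y * 1"
    using has_derivative_unique by metis
  then show ?thesis
    by (simp add: frechet_derivative_sum_partial[OF hom_fun_differentiable[OF assms]] mult.assoc)
qed

text \<open>Testing the homogeneity on coordinate functions reads off the coefficients of the
  field.\<close>

lemma hom_vf_of_homogeneous_degree_1: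
  assumes "smooth_on UNIV V" "homogeneous_degree_1 \<sigma> V" shows "hom_vf 1 V"
proof -
  have "V (dil \<sigma> l x) $ i = l powi (int (\<sigma> i) - 1) * V x $ i" if l: "l > 0" for l x i
  proof -
    have "vf_apply V ((\<lambda>x. x $ i) \<circ> dil \<sigma> l) x = l * vf_apply V (\<lambda>x. x $ i) (dil \<sigma> l x)"
      using assms(2) l smooth_on_coord[OF open_UNIV, of i] by (simp add: homogeneous_degree_1_def)
    moreover have "(\<lambda>x. x $ i) \<circ> dil \<sigma> l = (\<lambda>x. l ^ \<sigma> i * x $ i)" by (auto simp: dil_def)
    moreover have "vf_apply V (\<lambda>x. l ^ \<sigma> i * x $ i) x = l ^ \<sigma> i * V x $ i"
      by (subst vf_apply_cmult) (auto intro: hom_fun_differentiable[OF hom_fun_coord])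
    ultimately show ?thesis using l by (simp add: power_int_diff field_simps)
  qed
  then show ?thesis using assms(1) by (auto simp: hom_vf_def hom_fun_def smooth_on_nth)
qed

lemma vf_bracket_nth:
  fixes V W :: "real ^ 'n \<Rightarrow> real ^ 'n"
  assumes "smooth_on UNIV V" "smooth_on UNIV W"
  shows "vf_bracket V W x $ i = vf_apply V (\<lambda>x. W x $ i) x - vf_apply W (\<lambda>x. V x $ i) x"
proof -
  have "frechet_derivative (\<lambda>x. U x $ i) (at x) v = frechet_derivative U (at x) v $ i"
    if "smooth_on UNIV U" for U :: "real ^ 'n \<Rightarrow> real ^ 'n" and v
    by (rule frechet_derivative_eqI)
       (rule bounded_linear.has_derivative[OF bounded_linear_vec_nth smooth_on_has_derivative[OF that UNIV_I]])
  then show ?thesis using assms by (simp add: vf_bracket_def vf_apply_def)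
qed

lemma smooth_on_vecI:
  fixes V :: "real ^ 'n \<Rightarrow> real ^ 'n"
  assumes "open S" "\<And>i. smooth_on S (\<lambda>x. V x $ i)" shows "smooth_on S V"
proof -
  have "V = (\<lambda>x. \<Sum>i\<in>UNIV. V x $ i *\<^sub>R axis i 1)"
    by (simp add: fun_eq_iff vec_eq_iff axis_def if_distrib cong: if_cong)
  moreover have "smooth_on S (\<lambda>x. \<Sum>i\<in>UNIV. V x $ i *\<^sub>R (axis i 1 :: real ^ 'n))"
    using smooth_on_linear_compose[OF assms(1) bounded_linear_scaleR_left assms(2)]
    by (intro smooth_on_sum[OF assms(1)]) auto
  ultimately show ?thesis by simp
qed

lemma hom_vf_bracket:
  assumes "hom_vf k V" "hom_vf l W" shows "hom_vf (k + l) (vf_bracket V W)"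
proof -
  have s: "smooth_on UNIV V" "smooth_on UNIV W" using assms by (auto simp: hom_vf_def)
  have "hom_fun (int (\<sigma> i) - int (k + l)) (\<lambda>x. vf_bracket V W x $ i)" for i
  proof -
    have "hom_fun (int (\<sigma> i) - int l - int k) (vf_apply V (\<lambda>x. W x $ i))"
      "hom_fun (int (\<sigma> i) - int k - int l) (vf_apply W (\<lambda>x. V x $ i))"
      using assms by (auto intro!: hom_fun_vf_apply simp: hom_vf_def)
    then have "hom_fun (int (\<sigma> i) - int (k + l)) (\<lambda>x. vf_apply V (\<lambda>x. W x $ i) x + (-1) * vf_apply W (\<lambda>x. V x $ i) x)"
      by (intro hom_fun_add hom_fun_cmult) (auto simp: algebra_simps)
    then show ?thesis by (simp add: vf_bracket_nth[OF s])
  qed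
  then show ?thesis
    by (auto simp: hom_vf_def intro!: smooth_on_vecI intro: hom_fun_smooth)
qed

definition commutator where
  "commutator V W f x = vf_apply V (vf_apply W f) x - vf_apply W (vf_apply V f) x"

lemma vf_apply_fun_mult:
  assumes "smooth_on UNIV f" "smooth_on UNIV g"
  shows "vf_apply V (\<lambda>x. f x * g x) = (\<lambda>x. f x * vf_apply V g x + vf_apply V f x * g x)"
  using assms by (auto simp: fun_eq_iff vf_apply_mult smooth_on_differentiable)

text \<open>The products of one first derivative of \<open>f\<close> with one of \<open>g\<close>
  are symmetric in \<open>V\<close> and \<open>W\<close> and cancel, so the commutator is a
  derivation.\<close>

lemma commutator_mult:
  assumes "smooth_on UNIV V" "smooth_on UNIV W" "smooth_on UNIV f" "smooth_on UNIV g"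
  shows "commutator V W (\<lambda>x. f x * g x) x = f x * commutator V W g x + commutator V W f x * g x"
proof -
  have *: "vf_apply V (\<lambda>x. f x * vf_apply W g x + vf_apply W f x * g x) x =
      f x * vf_apply V (vf_apply W g) x + vf_apply V f x * vf_apply W g x
      + (vf_apply W f x * vf_apply V g x + vf_apply V (vf_apply W f) x * g x)"
    if "smooth_on UNIV V" "smooth_on UNIV W" for V W
  proof -
    have s: "smooth_on UNIV (vf_apply W f)" "smooth_on UNIV (vf_apply W g)"
      using that assms(3,4) by (auto intro: smooth_on_vf_apply)
    note d = smooth_on_differentiable[OF _ UNIV_I, of _ x]
    show ?thesis
      using assms(3,4) s
      by (simp add: vf_apply_add[OF d[OF smooth_on_mult] d[OF smooth_on_mult]] vf_apply_mult d)
  qed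
  show ?thesis
    using *[OF assms(1,2)] *[OF assms(2,1)]
    by (simp add: commutator_def vf_apply_fun_mult[OF assms(3,4)] algebra_simps)
qed

text \<open>
  By Euler's identity a homogeneous function is built from coordinates and homogeneous functions of
  lower degree; this replaces the symmetry of second derivatives.
\<close>

lemma vf_apply_bracket:
  assumes V: "smooth_on UNIV V" and W: "smooth_on UNIV W" and f: "hom_fun d f"
  shows "vf_apply (vf_bracket V W) f x = commutator V W f x"
proof (cases "d < 0")
  case True
  then have "f = (\<lambda>x. 0)" using hom_fun_neg[OF f] by auto
  moreover have "vf_apply U (\<lambda>x. 0) = (\<lambda>x. 0)" for U :: "real ^ 'n \<Rightarrow> real ^ 'n" by auto
  ultimately show ?thesis by (simp add: commutator_def)
next
  case False
  then obtain n where "d = int n" by (metis nonneg_int_cases not_less)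
  with f have "hom_fun (int n) f" by simp
  then show ?thesis
  proof (induction n arbitrary: f rule: less_induct)
    case (less n)
    note f = less.prems
    show ?case
    proof (cases "n = 0")
      case True
      then have "f = (\<lambda>x. f 0)" using hom_fun_0_const f by auto
      then obtain c where "f = (\<lambda>x. c)" by blast
      moreover have "vf_apply U (\<lambda>x. a) = (\<lambda>x. 0)" for U :: "real ^ 'n \<Rightarrow> real ^ 'n" and a by auto
      ultimately show ?thesis by (simp add: commutator_def)
    next
      case False
      define g where "g i = partial i f" for i
      have g: "hom_fun (int n - int (\<sigma> i)) (g i)" for i unfolding g_def by (rule hom_fun_partial[OF f])
      have gs: "smooth_on UNIV (g i)" for i using hom_fun_smooth[OF g] .
      have cs: "smooth_on UNIV (\<lambda>x::real^'n. x $ i)" for i by (simp add: smooth_on_coord)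
      have IH: "vf_apply (vf_bracket V W) (g i) x = commutator V W (g i) x" for i
      proof (cases "n < \<sigma> i")
        case True
        then have "g i = (\<lambda>x. 0)" using hom_fun_neg[OF g] by auto
        moreover have "vf_apply U (\<lambda>x. 0) = (\<lambda>x. 0)" for U :: "real ^ 'n \<Rightarrow> real ^ 'n" by auto
        ultimately show ?thesis by (simp add: commutator_def)
      next
        case False
        then show ?thesis using less.IH[of "n - \<sigma> i" "g i"] g[of i] weight_pos[of i] by (simp add: of_nat_diff)
      qed
      \<comment> \<open>Euler's identity divided by the degree writes \<open>f\<close> as a
        combination of products of a coordinate with a partial derivative of smaller degree. Both
        factors satisfy the claim, and both sides of it are derivations.\<close>
      define c where "c i = real (\<sigma> i) / real n" for i
      have fe: "f = (\<lambda>x. \<Sum>i\<in>UNIV. c i * (x $ i * g i x))"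
      proof
        fix x
        have "(\<Sum>i\<in>UNIV. c i * (x $ i * g i x)) = (\<Sum>i\<in>UNIV. real (\<sigma> i) * (x $ i * g i x)) / real n"
          by (simp add: c_def sum_divide_distrib)
        then show "f x = (\<Sum>i\<in>UNIV. c i * (x $ i * g i x))"
          using euler_identity[OF f, of x] False by (simp add: g_def)
      qed
      have d: "(\<lambda>x. c i * (x $ i * g i x)) differentiable (at x)"
        "(\<lambda>x. x $ i * g i x) differentiable (at x)" for i x
        by (auto intro!: smooth_on_differentiable[of UNIV] smooth_on_mult gs cs)
      have lin: "vf_apply U f = (\<lambda>x. \<Sum>i\<in>UNIV. c i * vf_apply U (\<lambda>x. x $ i * g i x) x)" for U
        by (subst fe) (auto simp: fun_eq_iff vf_apply_sum[OF _ d(1)] vf_apply_cmult[OF d(2)])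
      have d2: "vf_apply U (\<lambda>x. x $ i * g i x) differentiable (at x)"
        "(\<lambda>x. c i * vf_apply U (\<lambda>x. x $ i * g i x) x) differentiable (at x)"
        if "smooth_on UNIV U" for U i x
        using that by (auto intro!: smooth_on_differentiable[of UNIV] smooth_on_mult smooth_on_vf_apply gs cs)
      have "commutator V W f x = (\<Sum>i\<in>UNIV. c i * commutator V W (\<lambda>x. x $ i * g i x) x)"
        unfolding commutator_def lin
        by (simp add: vf_apply_sum[OF _ d2(2)[OF V]] vf_apply_sum[OF _ d2(2)[OF W]] vf_apply_cmult[OF d2(1)[OF V]]
            vf_apply_cmult[OF d2(1)[OF W]] sum_subtractf right_diff_distrib)
      also have "\<dots> = (\<Sum>i\<in>UNIV. c i * vf_apply (vf_bracket V W) (\<lambda>x. x $ i * g i x) x)"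
      proof (rule sum.cong[OF refl])
        fix i
        have "vf_apply U (\<lambda>x. x $ i) = (\<lambda>x. U x $ i)" for U :: "real ^ 'n \<Rightarrow> real ^ 'n" by auto
        then have "commutator V W (\<lambda>x. x $ i) x = vf_bracket V W x $ i"
          by (simp add: commutator_def vf_bracket_nth[OF V W])
        then show "c i * commutator V W (\<lambda>x. x $ i * g i x) x = c i * vf_apply (vf_bracket V W) (\<lambda>x. x $ i * g i x) x"
          using commutator_mult[OF V W cs gs, of i i x] vf_apply_fun_mult[OF cs gs, of "vf_bracket V W" i i] IH[of i]
          by simp
      qed
      also have "\<dots> = vf_apply (vf_bracket V W) f x" by (simp add: lin)
      finally show ?thesis ..
    qed
  qed
qed

end

section \<open>Weighted filtration and flows\<close>


context weights
begin

text \<open>These are the weighted polynomials of degree strictly below \<open>n\<close>. The strict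
  bound makes \<open>filt n\<close> trivial for \<open>n \<le> 0\<close> and puts the coordinate
  \<open>x $ i\<close> into \<open>filt (\<sigma> i + 1)\<close>.\<close>

inductive filt :: "int \<Rightarrow> (real ^ 'n \<Rightarrow> real) \<Rightarrow> bool" where
  filt_zero: "filt n (\<lambda>x. 0)"
| filt_step: "hom_fun e f \<Longrightarrow> e < n \<Longrightarrow> filt n g \<Longrightarrow> filt n (\<lambda>x. f x + g x)"

lemma hom_fun_filt: "hom_fun e f \<Longrightarrow> e < n \<Longrightarrow> filt n f"
  using filt_step[OF _ _ filt_zero] by fastforce

lemma filt_add: "filt n f \<Longrightarrow> filt n g \<Longrightarrow> filt n (\<lambda>x. f x + g x)"
proof (induction rule: filt.induct)
  case (filt_step e f n h)
  from filt.filt_step[OF filt_step(1,2) filt_step.IH[OF filt_step.prems]]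
  show ?case by (simp add: add.assoc)
qed simp

lemma filt_cmult: "filt n f \<Longrightarrow> filt n (\<lambda>x. c * f x)"
proof (induction rule: filt.induct)
  case (filt_step e f n h)
  from filt.filt_step[OF hom_fun_cmult[OF filt_step(1), of c] filt_step(2) filt_step.IH]
  show ?case by (simp add: distrib_left)
qed (simp add: filt_zero)

lemma filt_diff: "filt n f \<Longrightarrow> filt n g \<Longrightarrow> filt n (\<lambda>x. f x - g x)"
  using filt_add[OF _ filt_cmult[of n g "-1"], of f] by simp

lemma filt_sum: "finite I \<Longrightarrow> (\<And>i. i \<in> I \<Longrightarrow> filt n (f i)) \<Longrightarrow> filt n (\<lambda>x. \<Sum>i\<in>I. f i x)"
  by (induction I rule: finite_induct) (auto intro: filt_zero filt_add)

lemma filt_mono: "filt n f \<Longrightarrow> n \<le> k \<Longrightarrow> filt k f"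
  by (induction rule: filt.induct) (auto intro: filt.intros)

lemma filt_smooth: "filt n f \<Longrightarrow> smooth_on UNIV f"
  by (induction rule: filt.induct) (auto intro: smooth_on_add hom_fun_smooth)

lemma filt_indep:
  assumes "filt n f" "\<And>i. int (\<sigma> i) < n \<Longrightarrow> y $ i = z $ i" shows "f y = f z"
  using assms
proof (induction rule: filt.induct)
  case (filt_step e f n g)
  have "f y = f z" using filt_step.hyps(2) filt_step.prems by (intro hom_fun_indep[OF filt_step(1)]) auto
  moreover have "g y = g z" using filt_step by simp
  ultimately show ?case by simp
qed simp

lemma filt_nonpos: "filt n f \<Longrightarrow> n \<le> 0 \<Longrightarrow> f y = 0"
  by (induction rule: filt.induct) (auto simp: hom_fun_neg)

lemma filt_vf_apply:
  assumes "hom_vf k V" "filt n f" shows "filt (n - int k) (vf_apply V f)"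
  using assms(2)
proof (induction rule: filt.induct)
  case (filt_zero n)
  have "vf_apply V (\<lambda>x. 0) = (\<lambda>x. 0)" by auto
  then show ?case by (simp add: filt.filt_zero)
next
  case (filt_step e f n g)
  have "vf_apply V (\<lambda>x. f x + g x) = (\<lambda>x. vf_apply V f x + vf_apply V g x)"
    using vf_apply_add[OF hom_fun_differentiable[OF filt_step(1)] smooth_on_differentiable[OF filt_smooth[OF filt_step(3)] UNIV_I]]
    by (simp add: fun_eq_iff)
  then show ?case using filt_step by (auto intro!: filt_add hom_fun_filt[OF hom_fun_vf_apply[OF assms(1)]])
qed

lemma vf_apply_bracket_filt:
  assumes V: "hom_vf k V" and W: "hom_vf l W" and f: "filt n f"
  shows "vf_apply (vf_bracket V W) f x = vf_apply V (vf_apply W f) x - vf_apply W (vf_apply V f) x"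
  using f
proof (induction rule: filt.induct)
  case (filt_zero n)
  have "vf_apply U (\<lambda>x. 0) = (\<lambda>x. 0)" for U :: "real ^ 'n \<Rightarrow> real ^ 'n" by auto
  then show ?case by simp
next
  case (filt_step e f n g)
  have s: "smooth_on UNIV f" "smooth_on UNIV g" using filt_step by (auto intro: hom_fun_smooth filt_smooth)
  have sV: "smooth_on UNIV V" "smooth_on UNIV W" using V W by (auto simp: hom_vf_def)
  have "vf_apply U (\<lambda>x. f x + g x) = (\<lambda>x. vf_apply U f x + vf_apply U g x)" for U
    using s by (auto simp: fun_eq_iff intro!: vf_apply_add smooth_on_differentiable[of UNIV])
  then show ?case
    using filt_step.IH vf_apply_bracket[OF sV filt_step(1), of x] s sV
    by (simp add: commutator_def vf_apply_add[OF smooth_on_differentiable[of UNIV] smooth_on_differentiable[of UNIV]]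
       smooth_on_vf_apply)
qed

text \<open>This is the exponential series of \<open>t X\<close> applied to the coordinates. For a
  field of weight 1 stopping at \<open>\<sigma> i\<close> loses nothing, since each application of
  \<open>X\<close> lowers the degree \<open>\<sigma> i\<close> by one and negative degrees
  vanish.\<close>

definition flow :: "(real ^ 'n \<Rightarrow> real ^ 'n) \<Rightarrow> real \<Rightarrow> real ^ 'n \<Rightarrow> real ^ 'n" where
  "flow X t y = (\<chi> i. \<Sum>k\<le>\<sigma> i. t ^ k / fact k * (vf_apply X ^^ k) (\<lambda>x. x $ i) y)"

lemma hom_fun_iterate: "hom_vf 1 X \<Longrightarrow> hom_fun d f \<Longrightarrow> hom_fun (d - int k) ((vf_apply X ^^ k) f)"
proof (induction k)
  case (Suc k)
  then show ?case using hom_fun_vf_apply[of 1 X "d - int k" "(vf_apply X ^^ k) f"] by (simp add: algebra_simps)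
qed simp

lemma flow_0 [simp]: "flow X 0 y = y"
proof -
  have "(\<Sum>k\<le>\<sigma> i. 0 ^ k / fact k * (vf_apply X ^^ k) (\<lambda>x. x $ i) y) = y $ i" for i
    by (subst sum.remove[of _ 0]) (auto intro!: sum.neutral)
  then show ?thesis by (simp add: flow_def vec_eq_iff)
qed

lemma exp_series_derivative:
  fixes n :: nat and a :: "nat \<Rightarrow> real" and t :: real
  shows "((\<lambda>t. \<Sum>k\<le>Suc n. t ^ k / fact k * a k) has_real_derivative (\<Sum>k\<le>n. t ^ k / fact k * a (Suc k))) (at t)"
proof -
  have 1: "((\<lambda>t. t ^ k / fact k * a k) has_real_derivative (real k * t ^ (k - 1) / fact k * a k)) (at t)" for k
    by (auto intro!: derivative_eq_intros)
  have "((\<lambda>t. \<Sum>k\<le>Suc n. t ^ k / fact k * a k) has_real_derivative (\<Sum>k\<le>Suc n. real k * t ^ (k - 1) / fact k * a k)) (at t)"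
    by (intro DERIV_sum 1)
  also have "(\<Sum>k\<le>Suc n. real k * t ^ (k - 1) / fact k * a k) = (\<Sum>k\<le>n. t ^ k / fact k * a (Suc k))"
  proof -
    have "real (Suc k) * t ^ k / fact (Suc k) = t ^ k / fact k" for k
      by (simp add: field_simps del: of_nat_Suc)
    then show ?thesis by (subst sum.atMost_Suc_shift) (simp del: of_nat_Suc fact_Suc)
  qed
  finally show ?thesis .
qed

lemma has_derivative_vecI:
  fixes g :: "real \<Rightarrow> real ^ 'm::finite"
  assumes "\<And>i. ((\<lambda>t. g t $ i) has_real_derivative v $ i) (at t)"
  shows "(g has_derivative (\<lambda>s. s *\<^sub>R v)) (at t)"
proof (subst has_derivative_componentwise_within, safe)
  fix b :: "real ^ 'm" assume "b \<in> Basis"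
  then obtain i where b: "b = axis i 1" by (auto simp: Basis_vec_def)
  have "((\<lambda>t. g t $ i) has_derivative (\<lambda>s. s * v $ i)) (at t)"
    using assms[of i] by (simp add: has_field_derivative_def mult.commute[of "v $ i"] mult_commute_abs)
  then show "((\<lambda>t. g t \<bullet> b) has_derivative (\<lambda>s. s *\<^sub>R v \<bullet> b)) (at t)"
    by (simp add: b inner_axis)
qed

text \<open>Both sides have the derivative \<open>vf_apply X f (flow X t y)\<close> in
  \<open>t\<close> and agree at 0. The induction on the degree breaks a circle: that the velocity of
  \<open>flow\<close> is \<open>X\<close> is itself an instance of the formula, for the coefficients
  of \<open>X\<close>, whose degree is smaller.\<close>

lemma flow_pullback:
  assumes X: "hom_vf 1 X"
  shows "hom_fun (int d) f \<Longrightarrow> f (flow X t y) = (\<Sum>k\<le>d. t ^ k / fact k * (vf_apply X ^^ k) f y)"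
proof (induction d arbitrary: f t rule: less_induct)
  case (less d)
  show ?case
  proof (cases d)
    case 0
    then have "f (flow X t y) = f 0" "f y = f 0" using less.prems hom_fun_0_const by force+
    then show ?thesis using 0 by simp
  next
    case (Suc n)
    define v where "v t = (\<chi> i. \<Sum>k\<le>\<sigma> i - 1. t ^ k / fact k * (vf_apply X ^^ k) (\<lambda>x. X x $ i) y)" for t
    have cX: "vf_apply X (\<lambda>x. x $ i) = (\<lambda>x. X x $ i)" for i by auto
    have v: "((\<lambda>t. flow X t y) has_derivative (\<lambda>s. s *\<^sub>R v t)) (at t)" for t
    proof (rule has_derivative_vecI)
      fix i
      have "Suc (\<sigma> i - 1) = \<sigma> i" using weight_pos[of i] by simp
      then show "((\<lambda>t. flow X t y $ i) has_real_derivative v t $ i) (at t)"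
        using exp_series_derivative[where n="\<sigma> i - 1" and a="\<lambda>k. (vf_apply X ^^ k) (\<lambda>x. x $ i) y" and t=t]
        by (simp add: flow_def v_def funpow_Suc_right cX del: funpow.simps sum.atMost_Suc)
    qed
    \<comment> \<open>The remaining coordinates need not be controlled: the corresponding partial
      derivatives of \<open>f\<close> have negative degree and vanish.\<close>
    have vX: "v t $ i = X (flow X t y) $ i" if "\<sigma> i \<le> d" for t i
    proof -
      have "hom_fun (int (\<sigma> i - 1)) (\<lambda>x. X x $ i)"
        using X weight_pos[of i] by (simp add: hom_vf_def of_nat_diff)
      moreover have "\<sigma> i - 1 < d" using that weight_pos[of i] by simp
      ultimately show ?thesis using less.IH by (simp add: v_def)
    qed
    have Xf: "hom_fun (int n) (vf_apply X f)"
      using hom_fun_vf_apply[OF X less.prems] Suc by simp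
    have fd: "f differentiable (at x)" for x by (rule hom_fun_differentiable[OF less.prems])
    have "((\<lambda>t. f (flow X t y)) has_real_derivative vf_apply X f (flow X t y)) (at t)" for t
    proof -
      have "((\<lambda>t. f (flow X t y)) has_derivative (\<lambda>s. frechet_derivative f (at (flow X t y)) (s *\<^sub>R v t))) (at t)"
        using diff_chain_at[OF v fd[unfolded frechet_derivative_works]] by (simp add: o_def)
      moreover have "frechet_derivative f (at (flow X t y)) (s *\<^sub>R v t) = vf_apply X f (flow X t y) * s" for s
      proof -
        have "v t $ i * partial i f (flow X t y) = X (flow X t y) $ i * partial i f (flow X t y)" for i
          using vX[of i t] hom_fun_neg[OF hom_fun_partial[OF less.prems], of i]
          by (cases "\<sigma> i \<le> d") auto
        then have "(\<Sum>i\<in>UNIV. s * (v t $ i * partial i f (flow X t y))) =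
            (\<Sum>i\<in>UNIV. s * (X (flow X t y) $ i * partial i f (flow X t y)))"
          by presburger
        then show ?thesis
          by (simp add: frechet_derivative_sum_partial[OF fd] vf_apply_sum_partial[OF fd] sum_distrib_left ac_simps)
      qed
      ultimately show ?thesis by (simp add: has_field_derivative_def)
    qed
    moreover have "((\<lambda>t. \<Sum>k\<le>d. t ^ k / fact k * (vf_apply X ^^ k) f y) has_real_derivative vf_apply X f (flow X t y)) (at t)" for t
      using exp_series_derivative[where n=n and a="\<lambda>k. (vf_apply X ^^ k) f y" and t=t] less.IH[OF _ Xf, of t] Suc
      by (simp add: funpow_Suc_right del: funpow.simps sum.atMost_Suc)
    ultimately have "((\<lambda>t. f (flow X t y) - (\<Sum>k\<le>d. t ^ k / fact k * (vf_apply X ^^ k) f y)) has_real_derivative 0) (at t)" for t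
      using DERIV_diff by fastforce
    from DERIV_isconst_all[OF allI[OF this], of t 0]
    have "f (flow X t y) - (\<Sum>k\<le>d. t ^ k / fact k * (vf_apply X ^^ k) f y) = f y - (\<Sum>k\<le>d. 0 ^ k / fact k * (vf_apply X ^^ k) f y)"
      by simp
    also have "(\<Sum>k\<le>d. 0 ^ k / fact k * (vf_apply X ^^ k) f y) = f y"
      by (subst sum.remove[of _ 0]) (auto intro!: sum.neutral)
    finally show ?thesis by simp
  qed
qed

lemma flow_has_derivative:
  assumes X: "hom_vf 1 X"
  shows "((\<lambda>t. flow X t y) has_derivative (\<lambda>s. s *\<^sub>R X (flow X t y))) (at t)"
proof (rule has_derivative_vecI)
  fix i
  have cX: "vf_apply X (\<lambda>x. x $ i) = (\<lambda>x. X x $ i)" by auto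
  have "hom_fun (int (\<sigma> i - 1)) (\<lambda>x. X x $ i)"
    using X weight_pos[of i] by (simp add: hom_vf_def of_nat_diff)
  moreover have "Suc (\<sigma> i - 1) = \<sigma> i" using weight_pos[of i] by simp
  ultimately show "((\<lambda>t. flow X t y $ i) has_real_derivative X (flow X t y) $ i) (at t)"
    using exp_series_derivative[where n="\<sigma> i - 1" and a="\<lambda>k. (vf_apply X ^^ k) (\<lambda>x. x $ i) y" and t=t]
      flow_pullback[OF X, of "\<sigma> i - 1" "\<lambda>x. X x $ i" t y]
    by (simp add: flow_def funpow_Suc_right cX del: funpow.simps sum.atMost_Suc)
qed

lemma flow_compose_DERIV:
  assumes X: "hom_vf 1 X" and "u differentiable (at (flow X t y))"
  shows "((\<lambda>t. u (flow X t y)) has_real_derivative vf_apply X u (flow X t y)) (at t)"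
proof -
  interpret linear "frechet_derivative u (at (flow X t y))" by (rule linear_frechet_derivative[OF assms(2)])
  show ?thesis
    using diff_chain_at[OF flow_has_derivative[OF X] assms(2)[unfolded frechet_derivative_works]]
    by (simp add: o_def has_field_derivative_def vf_apply_def scale mult.commute[of _ "frechet_derivative _ _ _"] mult_commute_abs)
qed

text \<open>The i-th coordinate of the left-hand side is \<open>g t\<close>, the exponential series
  at \<open>- t\<close> of iterates evaluated along the flow. Its derivative telescopes to a term
  with \<open>\<sigma> i + 1\<close> applications of \<open>X\<close> to a coordinate of degree
  \<open>\<sigma> i\<close>, which is 0.\<close>

lemma flow_inverse:
  assumes X: "hom_vf 1 X" shows "flow X (- t) (flow X t y) = y"
proof -
  have "flow X (- t) (flow X t y) $ i = y $ i" for i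
  proof -
    define f where "f k = (vf_apply X ^^ k) (\<lambda>x. x $ i)" for k
    have hf: "hom_fun (int (\<sigma> i) - int k) (f k)" for k
      unfolding f_def by (rule hom_fun_iterate[OF X hom_fun_coord])
    define g where "g t = (\<Sum>k\<le>\<sigma> i. (- t) ^ k / fact k * f k (flow X t y))" for t
    have Sf: "f (Suc k) = vf_apply X (f k)" for k by (simp add: f_def)
    have "(g has_real_derivative 0) (at t)" for t
    proof -
      define n where "n = \<sigma> i - 1"
      have n: "\<sigma> i = Suc n" using weight_pos[of i] by (simp add: n_def)
      have "((\<lambda>t. (- t) ^ k / fact k * f k (flow X t y)) has_real_derivative
          (- (real k * (- t) ^ (k - 1) / fact k) * f k (flow X t y) + (- t) ^ k / fact k * f (Suc k) (flow X t y))) (at t)" for k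
        unfolding Sf
        by (rule DERIV_cong[OF DERIV_mult[OF _ flow_compose_DERIV[OF X hom_fun_differentiable[OF hf]]]])
           (auto intro!: derivative_eq_intros)
      then have "(g has_real_derivative (\<Sum>k\<le>\<sigma> i. - (real k * (- t) ^ (k - 1) / fact k) * f k (flow X t y)
          + (- t) ^ k / fact k * f (Suc k) (flow X t y))) (at t)"
        unfolding g_def by (intro DERIV_sum)
      also have "(\<Sum>k\<le>\<sigma> i. - (real k * (- t) ^ (k - 1) / fact k) * f k (flow X t y)
          + (- t) ^ k / fact k * f (Suc k) (flow X t y)) =
          (\<Sum>k\<le>Suc n. (- t) ^ k / fact k * f (Suc k) (flow X t y))
          - (\<Sum>k\<le>Suc n. real k * (- t) ^ (k - 1) / fact k * f k (flow X t y))"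
        by (simp add: n sum_subtractf del: sum.atMost_Suc)
      also have "(\<Sum>k\<le>Suc n. real k * (- t) ^ (k - 1) / fact k * f k (flow X t y)) =
          (\<Sum>k\<le>n. (- t) ^ k / fact k * f (Suc k) (flow X t y))"
      proof -
        have "real (Suc k) * (- t) ^ k / fact (Suc k) = (- t) ^ k / fact k" for k
          by (simp add: field_simps del: of_nat_Suc)
        then show ?thesis by (subst sum.atMost_Suc_shift) (simp del: of_nat_Suc fact_Suc)
      qed
      also have "(\<Sum>k\<le>Suc n. (- t) ^ k / fact k * f (Suc k) (flow X t y)) - \<dots> =
          (- t) ^ Suc n / fact (Suc n) * f (Suc (Suc n)) (flow X t y)" by simp
      also have "f (Suc (Suc n)) (flow X t y) = 0"
        using hom_fun_neg[OF hf, of "Suc (Suc n)"] n by simp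
      finally show ?thesis by simp
    qed
    from DERIV_isconst_all[OF allI[OF this], of t 0]
    have "g t = (\<Sum>k\<le>\<sigma> i. 0 ^ k / fact k * f k y)" by (simp add: g_def)
    also have "\<dots> = f 0 y"
      by (subst sum.remove[of _ 0]) (auto intro!: sum.neutral)
    finally show ?thesis by (simp add: g_def f_def flow_def)
  qed
  then show ?thesis by (simp add: vec_eq_iff)
qed

lemma continuous_on_flow:
  assumes X: "hom_vf 1 X" shows "continuous_on UNIV (\<lambda>(t, y). flow X t y)"
proof -
  have "continuous_on UNIV (\<lambda>p. (vf_apply X ^^ k) (\<lambda>x. x $ i) (snd p))" for k i
    by (rule continuous_on_compose2[OF smooth_on_continuous[OF hom_fun_smooth[OF hom_fun_iterate[OF X hom_fun_coord]]]])
       (auto intro: continuous_intros)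
  then show ?thesis
    unfolding flow_def case_prod_beta
    by (intro continuous_on_vec_lambda continuous_intros) auto
qed

text \<open>The k-th term of the series lowers the degree by \<open>k\<close>; after removal of the
  terms 0 and 1 everything has dropped by at least 2.\<close>

lemma flow_filt:
  assumes X: "hom_vf 1 X" and f: "filt n f"
  shows "filt (n - 2) (\<lambda>y. f (flow X t y) - f y - t * vf_apply X f y)"
  using f
proof (induction rule: filt.induct)
  case (filt_zero n)
  then show ?case by (simp add: filt.filt_zero)
next
  case (filt_step e f n g)
  have "filt (n - 2) (\<lambda>y. f (flow X t y) - f y - t * vf_apply X f y)"
  proof (cases "e \<le> 0")
    case True
    then have "f y = f 0" for y using filt_step(1) hom_fun_neg hom_fun_0_const by (metis antisym_conv2)
    then obtain c where "f = (\<lambda>y. c)" by blast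
    then show ?thesis by (simp add: filt.filt_zero)
  next
    case False
    then obtain d where d: "e = int (Suc d)" by (metis not_le zero_less_imp_eq_int gr0_implies_Suc)
    have "(\<lambda>y. f (flow X t y) - f y - t * vf_apply X f y) = (\<lambda>y. \<Sum>k\<in>{2..Suc d}. t ^ k / fact k * (vf_apply X ^^ k) f y)"
    proof
      fix y
      have "{..Suc d} = {0, 1} \<union> {2..Suc d}" by auto
      then have "(\<Sum>k\<le>Suc d. t ^ k / fact k * (vf_apply X ^^ k) f y) =
         f y + t * vf_apply X f y + (\<Sum>k\<in>{2..Suc d}. t ^ k / fact k * (vf_apply X ^^ k) f y)"
        by (simp add: sum.union_disjoint del: sum.atMost_Suc)
      then show "f (flow X t y) - f y - t * vf_apply X f y = (\<Sum>k\<in>{2..Suc d}. t ^ k / fact k * (vf_apply X ^^ k) f y)"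
        using flow_pullback[OF X, of "Suc d" f t y] filt_step(1) d by simp
    qed
    then show ?thesis
      using filt_step(1,2)
      by (simp only:) (rule filt_sum, simp, rule filt_cmult, rule hom_fun_filt[OF hom_fun_iterate[OF X]], auto)
  qed
  from filt_add[OF this filt_step.IH]
  show ?case
    using filt_step
    by (simp add: vf_apply_add[OF hom_fun_differentiable smooth_on_differentiable[OF filt_smooth UNIV_I]] algebra_simps)
qed

end

section \<open>Measure-preserving triangular maps and horizontal displacement\<close>


lemma nn_integral_lborel_translate:
  fixes g :: "'a::euclidean_space \<Rightarrow> ennreal"
  assumes [measurable]: "g \<in> borel_measurable borel"
  shows "(\<integral>\<^sup>+y. g (y + a) \<partial>lborel) = (\<integral>\<^sup>+y. g y \<partial>lborel)"
proof -
  have "(\<integral>\<^sup>+y. g y \<partial>lborel) = (\<integral>\<^sup>+y. g y \<partial>distr lborel borel ((+) a))"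
    by (simp add: lborel_distr_plus)
  also have "\<dots> = (\<integral>\<^sup>+y. g (a + y) \<partial>lborel)" by (rule nn_integral_distr) auto
  finally show ?thesis by (simp add: add.commute)
qed

text \<open>Invariance is stated through integrals of nonnegative functions, the form in which it
  enters the Fubini arguments; no inverse or Jacobian is involved.\<close>

definition mpres :: "('a::euclidean_space \<Rightarrow> 'a) \<Rightarrow> bool" where
  "mpres G \<longleftrightarrow> G \<in> borel_measurable borel \<and>
    (\<forall>g\<in>borel_measurable borel. (\<integral>\<^sup>+y. g (G y) \<partial>lborel) = (\<integral>\<^sup>+y. g y \<partial>lborel))"

lemma mpres_measurable: "mpres G \<Longrightarrow> G \<in> borel_measurable borel"
  and mpres_nn_integral: "mpres G \<Longrightarrow> g \<in> borel_measurable borel \<Longrightarrow> (\<integral>\<^sup>+y. g (G y) \<partial>lborel) = (\<integral>\<^sup>+y. g y \<partial>lborel)"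
  by (auto simp: mpres_def)

lemma mpres_compose: assumes "mpres G" "mpres H" shows "mpres (\<lambda>x. G (H x))"
proof -
  note [measurable] = assms[THEN mpres_measurable]
  show ?thesis
    unfolding mpres_def
  proof safe
    show "(\<lambda>x. G (H x)) \<in> borel_measurable borel" by measurable
    fix g :: "'a \<Rightarrow> ennreal" assume [measurable]: "g \<in> borel_measurable borel"
    have "(\<integral>\<^sup>+y. g (G (H y)) \<partial>lborel) = (\<integral>\<^sup>+y. g (G y) \<partial>lborel)"
      by (rule mpres_nn_integral[OF assms(2)]) measurable
    then show "(\<integral>\<^sup>+y. g (G (H y)) \<partial>lborel) = (\<integral>\<^sup>+y. g y \<partial>lborel)"
      using mpres_nn_integral[OF assms(1)] by simp
  qed
qed

lemma mpres_id: "mpres (\<lambda>x. x)"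
  by (simp add: mpres_def)

text \<open>
  Averaging over translations in direction \<open>e\<close> with a weight of total mass 1 reduces a shear to
  one-dimensional translations, with no smoothness assumption on \<open>F\<close>.
\<close>

lemma mpres_shear:
  fixes F :: "'a::euclidean_space \<Rightarrow> real"
  assumes F[measurable]: "F \<in> borel_measurable borel" and inv: "\<And>y r. F (y + r *\<^sub>R e) = F y"
  shows "mpres (\<lambda>y. y + F y *\<^sub>R e)"
  unfolding mpres_def
proof safe
  show "(\<lambda>y. y + F y *\<^sub>R e) \<in> borel_measurable borel" by measurable
  fix g :: "'a \<Rightarrow> ennreal" assume [measurable]: "g \<in> borel_measurable borel"
  define w :: "real \<Rightarrow> ennreal" where "w = indicator {0..1}"
  have [measurable]: "w \<in> borel_measurable borel" by (simp add: w_def)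
  have w1: "(\<integral>\<^sup>+r. w r \<partial>lborel) = 1" by (simp add: w_def)
  have inv': "F (y - r *\<^sub>R e) = F y" for y r using inv[of y "-r"] by simp
  have "(\<integral>\<^sup>+y. g (y + F y *\<^sub>R e) \<partial>lborel) = (\<integral>\<^sup>+r. w r * (\<integral>\<^sup>+y. g (y + F y *\<^sub>R e) \<partial>lborel) \<partial>lborel)"
    by (simp add: nn_integral_multc w1)
  also have "\<dots> = (\<integral>\<^sup>+r. (\<integral>\<^sup>+y. w r * g (y + (r + F y) *\<^sub>R e) \<partial>lborel) \<partial>lborel)"
  proof (rule nn_integral_cong)
    fix r
    have "(\<integral>\<^sup>+y. g (y + F y *\<^sub>R e) \<partial>lborel) = (\<integral>\<^sup>+y. g ((y + r *\<^sub>R e) + F (y + r *\<^sub>R e) *\<^sub>R e) \<partial>lborel)"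
      by (rule nn_integral_lborel_translate[symmetric, where g="\<lambda>y. g (y + F y *\<^sub>R e)"]) measurable
    also have "\<dots> = (\<integral>\<^sup>+y. g (y + (r + F y) *\<^sub>R e) \<partial>lborel)"
      by (simp add: inv algebra_simps)
    finally show "w r * (\<integral>\<^sup>+y. g (y + F y *\<^sub>R e) \<partial>lborel) = (\<integral>\<^sup>+y. w r * g (y + (r + F y) *\<^sub>R e) \<partial>lborel)"
      by (simp add: nn_integral_cmult)
  qed
  also have "\<dots> = (\<integral>\<^sup>+y. (\<integral>\<^sup>+r. w r * g (y + (r + F y) *\<^sub>R e) \<partial>lborel) \<partial>lborel)"
    by (rule lborel_pair.Fubini') measurable
  \<comment> \<open>The shift by \<open>F y\<close> is absorbed into the real variable
    \<open>r\<close>. Undoing the translation in \<open>y\<close>, which \<open>F\<close> does not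
    see, leaves the weight \<open>w (r - F y)\<close>, still of mass 1 in \<open>r\<close>.\<close>
  also have "\<dots> = (\<integral>\<^sup>+y. (\<integral>\<^sup>+r. w (r - F y) * g (y + r *\<^sub>R e) \<partial>lborel) \<partial>lborel)"
  proof (rule nn_integral_cong)
    fix y
    have "(\<integral>\<^sup>+r. w (r + F y - F y) * g (y + (r + F y) *\<^sub>R e) \<partial>lborel) = (\<integral>\<^sup>+r. w (r - F y) * g (y + r *\<^sub>R e) \<partial>lborel)"
      by (rule nn_integral_lborel_translate[where g="\<lambda>r. w (r - F y) * g (y + r *\<^sub>R e)"]) measurable
    then show "(\<integral>\<^sup>+r. w r * g (y + (r + F y) *\<^sub>R e) \<partial>lborel) = (\<integral>\<^sup>+r. w (r - F y) * g (y + r *\<^sub>R e) \<partial>lborel)"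
      by simp
  qed
  also have "\<dots> = (\<integral>\<^sup>+r. (\<integral>\<^sup>+y. w (r - F y) * g (y + r *\<^sub>R e) \<partial>lborel) \<partial>lborel)"
    by (rule lborel_pair.Fubini'[symmetric]) measurable
  also have "\<dots> = (\<integral>\<^sup>+r. (\<integral>\<^sup>+y. w (r - F y) * g y \<partial>lborel) \<partial>lborel)"
  proof (rule nn_integral_cong)
    fix r
    have "(\<integral>\<^sup>+y. w (r - F (y + r *\<^sub>R e)) * g (y + r *\<^sub>R e) \<partial>lborel) = (\<integral>\<^sup>+y. w (r - F y) * g y \<partial>lborel)"
      by (rule nn_integral_lborel_translate[where g="\<lambda>y. w (r - F y) * g y"]) measurable
    then show "(\<integral>\<^sup>+y. w (r - F y) * g (y + r *\<^sub>R e) \<partial>lborel) = (\<integral>\<^sup>+y. w (r - F y) * g y \<partial>lborel)"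
      by (simp add: inv)
  qed
  also have "\<dots> = (\<integral>\<^sup>+y. (\<integral>\<^sup>+r. w (r - F y) * g y \<partial>lborel) \<partial>lborel)"
    by (rule lborel_pair.Fubini') measurable
  also have "\<dots> = (\<integral>\<^sup>+y. g y \<partial>lborel)"
  proof (rule nn_integral_cong)
    fix y
    have "(\<integral>\<^sup>+r. w (r + - F y) \<partial>lborel) = 1"
      by (subst nn_integral_lborel_translate[where g=w]) (simp_all add: w1)
    then show "(\<integral>\<^sup>+r. w (r - F y) * g y \<partial>lborel) = g y"
      by (simp add: nn_integral_multc)
  qed
  finally show "(\<integral>\<^sup>+y. g (y + F y *\<^sub>R e) \<partial>lborel) = (\<integral>\<^sup>+y. g y \<partial>lborel)" .
qed

text \<open>The map is a product of shears along the axes. Coordinates are replaced in order of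
  decreasing weight, so that each increment can still be evaluated at the original point.\<close>

lemma mpres_triangular:
  fixes G :: "real ^ 'n \<Rightarrow> real ^ 'n" and \<sigma> :: "'n::finite \<Rightarrow> nat"
  assumes G[measurable]: "G \<in> borel_measurable borel"
    and tri: "\<And>i y z. (\<And>l. \<sigma> l < \<sigma> i \<Longrightarrow> y $ l = z $ l) \<Longrightarrow> G y $ i - y $ i = G z $ i - z $ i"
  shows "mpres G"
proof -
  define H where "H A y = (\<chi> i. if i \<in> A then G y $ i else y $ i)" for A y
  have Gn[measurable]: "(\<lambda>y. G y $ i) \<in> borel_measurable borel" for i
    by (intro measurable_compose[OF G] borel_measurable_continuous_onI continuous_intros)
  have Yn[measurable]: "(\<lambda>y::real^'n. y $ i) \<in> borel_measurable borel" for i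
    by (intro borel_measurable_continuous_onI continuous_intros)
  have "mpres (H A)" if "finite A" for A
    using that
  proof (induction A rule: finite_ranking_induct[where f="\<lambda>i. - int (\<sigma> i)"])
    case empty
    have "H {} = (\<lambda>x. x)" by (simp add: H_def fun_eq_iff vec_eq_iff)
    then show ?case by (simp add: mpres_id)
  next
    case (insert x A)
    show ?case
    proof (cases "x \<in> A")
      case True
      then show ?thesis using insert by (simp add: insert_absorb)
    next
      case False
      define F where "F z = G z $ x - z $ x" for z
      have F[measurable]: "F \<in> borel_measurable borel" unfolding F_def[abs_def] by measurable
      have "mpres (\<lambda>z. z + F z *\<^sub>R axis x 1)"
      proof (rule mpres_shear[OF F])
        fix y r
        show "F (y + r *\<^sub>R axis x 1) = F y"
          unfolding F_def by (rule tri) (auto simp: axis_def)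
      qed
      from mpres_compose[OF this insert.IH] have "mpres (\<lambda>y. H A y + F (H A y) *\<^sub>R axis x 1)" .
      \<comment> \<open>\<open>H A\<close> alters only coordinates at least as heavy as
        \<open>x\<close>, and the increment \<open>F\<close> depends on strictly lighter
        ones.\<close>
      moreover have "F (H A y) = F y" for y
        unfolding F_def by (rule tri) (use insert.hyps(2) in \<open>force simp: H_def\<close>)
      then have "(\<lambda>y. H A y + F (H A y) *\<^sub>R axis x 1) = H (insert x A)"
        using False by (auto simp: fun_eq_iff vec_eq_iff H_def axis_def F_def)
      ultimately show ?thesis by simp
    qed
  qed
  moreover have "H UNIV = G" by (simp add: H_def fun_eq_iff)
  ultimately show ?thesis by (metis finite)
qed

context weights
begin

definition triangular :: "(real ^ 'n \<Rightarrow> real ^ 'n) \<Rightarrow> bool" where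
  "triangular G \<longleftrightarrow> (\<forall>i y z. (\<forall>l. \<sigma> l < \<sigma> i \<longrightarrow> y $ l = z $ l) \<longrightarrow> G y $ i - y $ i = G z $ i - z $ i)"

lemma triangular_mpres:
  assumes "continuous_on UNIV G" "triangular G" shows "mpres G"
proof (rule mpres_triangular[where \<sigma>=\<sigma> and G=G])
  show "G \<in> borel_measurable borel" by (rule borel_measurable_continuous_onI[OF assms(1)])
  fix i and y z :: "real ^ 'n" assume "\<And>l. \<sigma> l < \<sigma> i \<Longrightarrow> y $ l = z $ l"
  then show "G y $ i - y $ i = G z $ i - z $ i" using assms(2) unfolding triangular_def by metis
qed

text \<open>The increment of the i-th coordinate lies in \<open>filt (\<sigma> i)\<close>, hence
  depends only on coordinates of weight below \<open>\<sigma> i\<close>.\<close>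

lemma flow_triangular:
  assumes X: "hom_vf 1 X" shows "triangular (flow X t)"
  unfolding triangular_def
proof safe
  fix i and y z :: "real ^ 'n" assume l: "\<forall>l. \<sigma> l < \<sigma> i \<longrightarrow> y $ l = z $ l"
  have "filt (int (\<sigma> i)) (\<lambda>y. flow X t y $ i - y $ i - t * vf_apply X (\<lambda>y. y $ i) y)"
    by (rule filt_mono[OF flow_filt[OF X hom_fun_filt[OF hom_fun_coord, of i "int (\<sigma> i) + 1"]]]) auto
  moreover have "filt (int (\<sigma> i)) (\<lambda>y. t * vf_apply X (\<lambda>y. y $ i) y)"
    by (rule filt_cmult) (rule hom_fun_filt[OF hom_fun_vf_apply[OF X hom_fun_coord]], simp)
  ultimately have "filt (int (\<sigma> i)) (\<lambda>y. flow X t y $ i - y $ i)"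
    using filt_add by fastforce
  then show "flow X t y $ i - y $ i = flow X t z $ i - z $ i"
    by (rule filt_indep) (simp add: l)
qed

lemma continuous_on_flow_time:
  assumes X: "hom_vf 1 X" shows "continuous_on UNIV (flow X t)"
  using continuous_on_compose2[OF continuous_on_flow[OF X], of UNIV "\<lambda>y. (t, y)"]
  by (simp add: continuous_on_Pair)

lemma flow_mpres: "hom_vf 1 X \<Longrightarrow> mpres (flow X t)"
  by (rule triangular_mpres[OF continuous_on_flow_time flow_triangular])

end

section \<open>Displacement in \<open>L\<^sup>2\<close> along horizontal paths\<close>

lemma integral_square_le:
  fixes w :: "real \<Rightarrow> real"
  assumes "continuous_on {0..1} w"
  shows "(integral {0..1} w)\<^sup>2 \<le> integral {0..1} (\<lambda>s. (w s)\<^sup>2)"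
proof -
  define c where "c = integral {0..1} w"
  have i: "w integrable_on {0..1}" "(\<lambda>s. (w s)\<^sup>2) integrable_on {0..1}"
    using assms by (auto intro!: integrable_continuous_real continuous_intros)
  have "0 \<le> integral {0..1} (\<lambda>s. (w s - c)\<^sup>2)"
    by (rule integral_nonneg) (use assms in \<open>auto intro!: integrable_continuous_real continuous_intros\<close>)
  also have "integral {0..1} (\<lambda>s. (w s - c)\<^sup>2) = integral {0..1} (\<lambda>s. (w s)\<^sup>2) - 2 * c * c + c\<^sup>2"
  proof (rule integral_unique)
    have "((\<lambda>s. (w s)\<^sup>2 - 2 * c * w s + c\<^sup>2) has_integral
        (integral {0..1} (\<lambda>s. (w s)\<^sup>2) - 2 * c * c + c\<^sup>2)) {0..1}"
      using has_integral_const_real[of "c\<^sup>2" 0 1]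
      by (intro has_integral_add has_integral_diff has_integral_mult_right)
         (use i in \<open>auto simp: c_def has_integral_integral\<close>)
    then show "((\<lambda>s. (w s - c)\<^sup>2) has_integral (integral {0..1} (\<lambda>s. (w s)\<^sup>2) - 2 * c * c + c\<^sup>2)) {0..1}"
      by (simp add: power2_diff algebra_simps)
  qed
  finally show ?thesis by (simp add: c_def power2_eq_square)
qed

locale flows = weights \<sigma> for \<sigma> :: "'n::finite \<Rightarrow> nat" +
  fixes m :: nat and X :: "nat \<Rightarrow> real ^ 'n \<Rightarrow> real ^ 'n"
  assumes hom_X: "j \<in> {1..m} \<Longrightarrow> hom_vf 1 (X j)"
begin

text \<open>This regularity is what the truncations of \<Gamma> have: they are built from squares of
  positive parts, so only first derivatives are continuous.\<close>

definition horizontally_C1 :: "(real ^ 'n \<Rightarrow> real) \<Rightarrow> bool" where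
  "horizontally_C1 u \<longleftrightarrow> (\<forall>x. u differentiable (at x)) \<and> (\<forall>j\<in>{1..m}. continuous_on UNIV (vf_apply (X j) u))"

definition energy_le :: "(real ^ 'n \<Rightarrow> real) \<Rightarrow> real \<Rightarrow> ennreal \<Rightarrow> bool" where
  "energy_le u R M \<longleftrightarrow> (\<forall>j\<in>{1..m}. (\<integral>\<^sup>+y. ennreal ((vf_apply (X j) u y)\<^sup>2) * indicator (cball 0 R) y \<partial>lborel) \<le> M)"

text \<open>
  \<open>ctrl \<kappa> r b g\<close>: composing with \<open>g\<close> moves \<open>u\<close> in \<open>L\<^sup>2\<close> as a path of horizontal length \<open>r\<close> does.
\<close>

definition ctrl :: "real \<Rightarrow> real \<Rightarrow> (real \<Rightarrow> real) \<Rightarrow> (real ^ 'n \<Rightarrow> real ^ 'n) \<Rightarrow> bool" where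
  "ctrl \<kappa> r b g \<longleftrightarrow> continuous_on UNIV g \<and> mpres g \<and>
     (\<forall>R. g ` cball 0 R \<subseteq> cball 0 (b R) \<and> R \<le> b R) \<and>
     (\<forall>u R M. horizontally_C1 u \<longrightarrow> energy_le u (b R) M \<longrightarrow>
        (\<integral>\<^sup>+y. ennreal ((u (g y) - u y)\<^sup>2) * indicator (cball 0 R) y \<partial>lborel) \<le> ennreal (\<kappa> * r\<^sup>2) * M)"

lemma energy_le_mono:
  assumes "energy_le u R M" "S \<le> R" shows "energy_le u S M"
  unfolding energy_le_def
proof safe
  fix j assume "j \<in> {1..m}"
  then have "(\<integral>\<^sup>+y. ennreal ((vf_apply (X j) u y)\<^sup>2) * indicator (cball 0 R) y \<partial>lborel) \<le> M"
    using assms(1) by (simp add: energy_le_def)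
  moreover have "(\<integral>\<^sup>+y. ennreal ((vf_apply (X j) u y)\<^sup>2) * indicator (cball 0 S) y \<partial>lborel)
     \<le> (\<integral>\<^sup>+y. ennreal ((vf_apply (X j) u y)\<^sup>2) * indicator (cball 0 R) y \<partial>lborel)"
    using assms(2) by (intro nn_integral_mono mult_left_mono) (auto simp: indicator_def)
  ultimately show "(\<integral>\<^sup>+y. ennreal ((vf_apply (X j) u y)\<^sup>2) * indicator (cball 0 S) y \<partial>lborel) \<le> M" by simp
qed

lemma horizontally_C1_continuous: "horizontally_C1 u \<Longrightarrow> continuous_on UNIV u"
  by (auto simp: horizontally_C1_def intro!: continuous_at_imp_continuous_on differentiable_imp_continuous_within)

text \<open>The increment splits at \<open>h y\<close>, with \<open>(a + b)^2\<close> bounded by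
  \<open>2 a^2 + 2 b^2\<close>; as \<open>h\<close> preserves measure, the first part is an integral
  of the increment of \<open>g\<close> over a larger ball. Lengths are not added: \<open>r\<close>
  stays fixed and only \<open>\<kappa>\<close> grows, which suits compositions of a bounded number
  of moves.\<close>

lemma ctrl_compose:
  assumes g: "ctrl \<kappa> r b g" and h: "ctrl \<kappa>' r b' h" and "\<kappa> \<ge> 0" "\<kappa>' \<ge> 0"
  shows "ctrl (2 * \<kappa> + 2 * \<kappa>') r (\<lambda>R. b (b' R)) (\<lambda>y. g (h y))"
  unfolding ctrl_def
proof (intro conjI allI impI)
  have cg: "continuous_on UNIV g" and ch: "continuous_on UNIV h" and mg: "mpres g" and mh: "mpres h"
    using g h by (auto simp: ctrl_def)
  show "continuous_on UNIV (\<lambda>y. g (h y))" by (rule continuous_on_compose2[OF cg ch]) auto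
  show "mpres (\<lambda>y. g (h y))" by (rule mpres_compose[OF mg mh])
  show "(\<lambda>y. g (h y)) ` cball 0 R \<subseteq> cball 0 (b (b' R))" for R
    using g h unfolding ctrl_def by (metis (no_types, lifting) image_subset_iff)
  show "R \<le> b (b' R)" for R using g h unfolding ctrl_def by (meson order_trans)
  fix u R M assume u: "horizontally_C1 u" and e: "energy_le u (b (b' R)) M"
  have [measurable]: "cball (0::real ^ 'n) S \<in> sets borel" for S by simp
  note [measurable] = mpres_measurable[OF mg] mpres_measurable[OF mh]
    borel_measurable_continuous_onI[OF horizontally_C1_continuous[OF u]]
  have e': "energy_le u (b' R) M"
    using energy_le_mono[OF e] g by (auto simp: ctrl_def)
  define w where "w z = ennreal ((u (g z) - u z)\<^sup>2) * indicator (cball 0 (b' R)) z" for z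
  have [measurable]: "w \<in> borel_measurable borel" unfolding w_def[abs_def] by measurable
  have hR: "y \<in> cball 0 R \<Longrightarrow> h y \<in> cball 0 (b' R)" for y using h unfolding ctrl_def by blast
  have "(\<integral>\<^sup>+y. ennreal ((u (g (h y)) - u y)\<^sup>2) * indicator (cball 0 R) y \<partial>lborel)
    \<le> (\<integral>\<^sup>+y. ennreal 2 * w (h y) + ennreal 2 * (ennreal ((u (h y) - u y)\<^sup>2) * indicator (cball 0 R) y) \<partial>lborel)"
  proof (rule nn_integral_mono)
    fix y
    have "(u (g (h y)) - u y)\<^sup>2 \<le> 2 * (u (g (h y)) - u (h y))\<^sup>2 + 2 * (u (h y) - u y)\<^sup>2"
      using sum_squares_bound[of "u (g (h y)) - u (h y)" "u (h y) - u y"]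
      by (simp add: power2_eq_square algebra_simps)
    then have "ennreal ((u (g (h y)) - u y)\<^sup>2) \<le> ennreal 2 * ennreal ((u (g (h y)) - u (h y))\<^sup>2) + ennreal 2 * ennreal ((u (h y) - u y)\<^sup>2)"
      by (subst (1 2) ennreal_mult[symmetric], simp_all, subst ennreal_plus[symmetric], auto intro: ennreal_leI simp del: ennreal_plus)
    then show "ennreal ((u (g (h y)) - u y)\<^sup>2) * indicator (cball 0 R) y
       \<le> ennreal 2 * w (h y) + ennreal 2 * (ennreal ((u (h y) - u y)\<^sup>2) * indicator (cball 0 R) y)"
      using hR[of y] by (auto simp: w_def indicator_def)
  qed
  also have "\<dots> = ennreal 2 * (\<integral>\<^sup>+y. w (h y) \<partial>lborel)
      + ennreal 2 * (\<integral>\<^sup>+y. ennreal ((u (h y) - u y)\<^sup>2) * indicator (cball 0 R) y \<partial>lborel)"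
    by (subst nn_integral_add) (auto simp: nn_integral_cmult)
  also have "(\<integral>\<^sup>+y. w (h y) \<partial>lborel) = (\<integral>\<^sup>+y. w y \<partial>lborel)"
    by (rule mpres_nn_integral[OF mh]) measurable
  also have "\<dots> \<le> ennreal (\<kappa> * r\<^sup>2) * M"
    using g u e unfolding ctrl_def w_def by blast
  also have "(\<integral>\<^sup>+y. ennreal ((u (h y) - u y)\<^sup>2) * indicator (cball 0 R) y \<partial>lborel) \<le> ennreal (\<kappa>' * r\<^sup>2) * M"
    using h u e' unfolding ctrl_def by blast
  also have "ennreal 2 * (ennreal (\<kappa> * r\<^sup>2) * M) + ennreal 2 * (ennreal (\<kappa>' * r\<^sup>2) * M) = ennreal ((2 * \<kappa> + 2 * \<kappa>') * r\<^sup>2) * M"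
    using assms(3,4) by (simp add: distrib_right ennreal_plus ennreal_mult mult.assoc)
  finally show "(\<integral>\<^sup>+y. ennreal ((u (g (h y)) - u y)\<^sup>2) * indicator (cball 0 R) y \<partial>lborel)
    \<le> ennreal ((2 * \<kappa> + 2 * \<kappa>') * r\<^sup>2) * M" by (simp add: add_mono mult_left_mono)
qed

lemma ctrl_mono:
  assumes "ctrl \<kappa> r b g" "\<kappa> \<le> \<kappa>'" "0 \<le> r" "r \<le> r'" "0 \<le> \<kappa>" shows "ctrl \<kappa>' r' b g"
proof -
  have "\<kappa> * r\<^sup>2 \<le> \<kappa>' * r'\<^sup>2" using assms by (intro mult_mono power_mono) auto
  then have "ennreal (\<kappa> * r\<^sup>2) * M \<le> ennreal (\<kappa>' * r'\<^sup>2) * M" for M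
    by (intro mult_right_mono ennreal_leI) auto
  then show ?thesis using assms(1) unfolding ctrl_def by (meson order_trans)
qed

text \<open>Along the flow, \<open>u (flow t y) - u y\<close> is \<open>t\<close> times the mean of
  the X-derivative of \<open>u\<close> over the times \<open>s * t\<close>. Jensen's inequality,
  Fubini and the invariance of measure under each \<open>flow (s * t)\<close> bound its square
  integral by \<open>t^2\<close> times the energy. Compactness gives one radius function
  \<open>b\<close> for all times up to \<open>T\<close>.\<close>

lemma ctrl_flow:
  assumes j: "j \<in> {1..m}"
  shows "\<exists>b. \<forall>t. \<bar>t\<bar> \<le> T \<longrightarrow> ctrl 1 \<bar>t\<bar> b (flow (X j) t)"
proof -
  note Xj = hom_X[OF j]
  have "\<exists>B\<ge>R. \<forall>t\<in>{-T..T}. flow (X j) t ` cball 0 R \<subseteq> cball 0 B" for R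
  proof -
    have "compact ((\<lambda>(t, y). flow (X j) t y) ` ({-T..T} \<times> cball 0 R))"
      by (intro compact_continuous_image continuous_on_subset[OF continuous_on_flow[OF Xj]] compact_Times) auto
    then obtain B where "\<forall>z\<in>(\<lambda>(t, y). flow (X j) t y) ` ({-T..T} \<times> cball 0 R). norm z \<le> B"
      using compact_imp_bounded bounded_iff by blast
    then show ?thesis by (intro exI[of _ "max B R"]) (auto simp: le_max_iff_disj)
  qed
  then obtain b where b: "\<And>R. R \<le> b R" "\<And>R t. t \<in> {-T..T} \<Longrightarrow> flow (X j) t ` cball 0 R \<subseteq> cball 0 (b R)" by metis
  have "ctrl 1 \<bar>t\<bar> b (flow (X j) t)" if t: "\<bar>t\<bar> \<le> T" for t
    unfolding ctrl_def
  proof (intro conjI allI impI)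
    show "continuous_on UNIV (flow (X j) t)" by (rule continuous_on_flow_time[OF Xj])
    show "mpres (flow (X j) t)" by (rule flow_mpres[OF Xj])
    show "flow (X j) t ` cball 0 R \<subseteq> cball 0 (b R)" "R \<le> b R" for R
    proof -
      have "t \<in> {-T..T}" using t by auto
      then show "flow (X j) t ` cball 0 R \<subseteq> cball 0 (b R)" "R \<le> b R" using b by blast+
    qed
    fix u R M assume u: "horizontally_C1 u" and e: "energy_le u (b R) M"
    define v where "v = vf_apply (X j) u"
    have cv: "continuous_on UNIV v" using u j by (simp add: horizontally_C1_def v_def)
    have [measurable]: "cball (0::real ^ 'n) S \<in> sets borel" for S by simp
    note [measurable] = borel_measurable_continuous_onI[OF cv]
    have cflow: "continuous_on UNIV (\<lambda>p. flow (X j) (fst p * t) (snd p))"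
    proof -
      have "continuous_on UNIV (\<lambda>p::real \<times> (real ^ 'n). (fst p * t, snd p))"
        by (intro continuous_intros)
      from continuous_on_compose2[OF continuous_on_flow[OF Xj] this] show ?thesis by simp
    qed
    have "(\<lambda>p. flow (X j) (fst p * t) (snd p)) \<in> borel_measurable borel"
      by (rule borel_measurable_continuous_onI[OF cflow])
    then have mfl: "(\<lambda>p. flow (X j) (fst p * t) (snd p)) \<in> borel_measurable (borel \<Otimes>\<^sub>M borel)"
      by (simp add: borel_prod)
    have [measurable (raw)]: "(\<lambda>x. flow (X j) (p x * t) (q x)) \<in> borel_measurable N"
      if "p \<in> borel_measurable N" "q \<in> borel_measurable N" for N :: "'z measure" and p q
      using measurable_compose[OF measurable_Pair[OF that] mfl] by simp
    have cs: "continuous_on {0..1} (\<lambda>s. v (flow (X j) (s * t) y))" for y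
    proof -
      have "continuous_on {0..1} (\<lambda>s::real. (s, y))" by (intro continuous_intros)
      from continuous_on_compose2[OF cflow this] have "continuous_on {0..1} (\<lambda>s. flow (X j) (s * t) y)" by simp
      from continuous_on_compose2[OF cv this] show ?thesis by simp
    qed
    have "ennreal ((u (flow (X j) t y) - u y)\<^sup>2) \<le> ennreal (t\<^sup>2) * (\<integral>\<^sup>+s. ennreal ((v (flow (X j) (s * t) y))\<^sup>2) * indicator {0..1} s \<partial>lborel)" for y
    proof -
      have "((\<lambda>s. u (flow (X j) (s * t) y)) has_real_derivative v (flow (X j) (s * t) y) * t) (at s)" for s
      proof -
        have "((\<lambda>s. s * t) has_real_derivative t) (at s)" by (auto intro!: derivative_eq_intros)
        from DERIV_chain2[OF flow_compose_DERIV[OF Xj] this, of u y] u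
        show ?thesis by (simp add: horizontally_C1_def v_def)
      qed
      then have "((\<lambda>s. v (flow (X j) (s * t) y) * t) has_integral (u (flow (X j) (1 * t) y) - u (flow (X j) (0 * t) y))) {0..1}"
        by (intro fundamental_theorem_of_calculus) (auto simp: has_real_derivative_iff_has_vector_derivative[symmetric] intro: DERIV_subset)
      from integral_unique[OF this]
      have "u (flow (X j) t y) - u y = integral {0..1} (\<lambda>s. v (flow (X j) (s * t) y)) * t" by simp
      then have "(u (flow (X j) t y) - u y)\<^sup>2 = t\<^sup>2 * (integral {0..1} (\<lambda>s. v (flow (X j) (s * t) y)))\<^sup>2"
        by (simp add: power_mult_distrib mult.commute)
      also have "\<dots> \<le> t\<^sup>2 * integral {0..1} (\<lambda>s. (v (flow (X j) (s * t) y))\<^sup>2)"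
        by (intro mult_left_mono integral_square_le[OF cs]) auto
      finally have "ennreal ((u (flow (X j) t y) - u y)\<^sup>2) \<le> ennreal (t\<^sup>2) * ennreal (integral {0..1} (\<lambda>s. (v (flow (X j) (s * t) y))\<^sup>2))"
        by (subst ennreal_mult[symmetric]) (auto intro!: ennreal_leI integral_nonneg integrable_continuous_real continuous_intros cs)
      also have "ennreal (integral {0..1} (\<lambda>s. (v (flow (X j) (s * t) y))\<^sup>2)) =
          (\<integral>\<^sup>+s. ennreal ((v (flow (X j) (s * t) y))\<^sup>2) * indicator {0..1} s \<partial>lborel)"
      proof (rule nn_integral_has_integral_lebesgue'[symmetric])
        show "((\<lambda>s. (v (flow (X j) (s * t) y))\<^sup>2) has_integral integral {0..1} (\<lambda>s. (v (flow (X j) (s * t) y))\<^sup>2)) {0..1}"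
          by (intro integrable_integral integrable_continuous_real continuous_intros cs)
      qed auto
      finally show ?thesis .
    qed
    then have "(\<integral>\<^sup>+y. ennreal ((u (flow (X j) t y) - u y)\<^sup>2) * indicator (cball 0 R) y \<partial>lborel)
      \<le> (\<integral>\<^sup>+y. (ennreal (t\<^sup>2) * (\<integral>\<^sup>+s. ennreal ((v (flow (X j) (s * t) y))\<^sup>2) * indicator {0..1} s \<partial>lborel)) * indicator (cball 0 R) y \<partial>lborel)"
      by (intro nn_integral_mono mult_right_mono) auto
    also have "\<dots> = ennreal (t\<^sup>2) * (\<integral>\<^sup>+y. (\<integral>\<^sup>+s. ennreal ((v (flow (X j) (s * t) y))\<^sup>2) * indicator {0..1} s * indicator (cball 0 R) y \<partial>lborel) \<partial>lborel)"
    proof -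
      define A where "A y = (\<integral>\<^sup>+s. ennreal ((v (flow (X j) (s * t) y))\<^sup>2) * indicator {0..1} s \<partial>lborel)" for y
      have [measurable]: "A \<in> borel_measurable borel" unfolding A_def[abs_def] by measurable
      have "A y * indicator (cball 0 R) y =
          (\<integral>\<^sup>+s. ennreal ((v (flow (X j) (s * t) y))\<^sup>2) * indicator {0..1} s * indicator (cball 0 R) y \<partial>lborel)" for y
        unfolding A_def by (rule nn_integral_multc[symmetric]) measurable
      moreover have "(\<integral>\<^sup>+y. ennreal (t\<^sup>2) * A y * indicator (cball 0 R) y \<partial>lborel) =
          ennreal (t\<^sup>2) * (\<integral>\<^sup>+y. A y * indicator (cball 0 R) y \<partial>lborel)"
        unfolding mult.assoc by (rule nn_integral_cmult) measurable
      ultimately show ?thesis by (simp add: A_def)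
    qed
    also have "(\<integral>\<^sup>+y. (\<integral>\<^sup>+s. ennreal ((v (flow (X j) (s * t) y))\<^sup>2) * indicator {0..1} s * indicator (cball 0 R) y \<partial>lborel) \<partial>lborel)
      = (\<integral>\<^sup>+s. (\<integral>\<^sup>+y. ennreal ((v (flow (X j) (s * t) y))\<^sup>2) * indicator {0..1} s * indicator (cball 0 R) y \<partial>lborel) \<partial>lborel)"
      by (rule lborel_pair.Fubini'[symmetric]) measurable
    also have "\<dots> \<le> (\<integral>\<^sup>+s. M * indicator {0..1::real} s \<partial>lborel)"
    proof (rule nn_integral_mono)
      fix s :: real
      show "(\<integral>\<^sup>+y. ennreal ((v (flow (X j) (s * t) y))\<^sup>2) * indicator {0..1} s * indicator (cball 0 R) y \<partial>lborel) \<le> M * indicator {0..1} s"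
      proof (cases "s \<in> {0..1}")
        case True
        then have "\<bar>s * t\<bar> \<le> \<bar>t\<bar>" by (auto simp: abs_mult intro: mult_left_le_one_le)
        then have st: "s * t \<in> {-T..T}" using t by auto
        have "(\<integral>\<^sup>+y. ennreal ((v (flow (X j) (s * t) y))\<^sup>2) * indicator (cball 0 R) y \<partial>lborel)
          \<le> (\<integral>\<^sup>+y. ennreal ((v (flow (X j) (s * t) y))\<^sup>2) * indicator (cball 0 (b R)) (flow (X j) (s * t) y) \<partial>lborel)"
          using b(2)[OF st, of R] by (intro nn_integral_mono) (auto simp: indicator_def image_subset_iff)
        also have "\<dots> = (\<integral>\<^sup>+y. ennreal ((v y)\<^sup>2) * indicator (cball 0 (b R)) y \<partial>lborel)"
          by (rule mpres_nn_integral[OF flow_mpres[OF Xj], where g="\<lambda>y. ennreal ((v y)\<^sup>2) * indicator (cball 0 (b R)) y"]) measurable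
        also have "\<dots> \<le> M" using e j by (simp add: energy_le_def v_def)
        finally show ?thesis using True by simp
      qed simp
    qed
    also have "\<dots> = M" by (simp add: nn_integral_cmult)
    finally show "(\<integral>\<^sup>+y. ennreal ((u (flow (X j) t y) - u y)\<^sup>2) * indicator (cball 0 R) y \<partial>lborel) \<le> ennreal (1 * \<bar>t\<bar>\<^sup>2) * M"
      by (simp add: mult_left_mono)
  qed
  then show ?thesis by blast
qed

end

section \<open>Moving along all coordinates by commutators\<close>


context weights
begin

lemma triangular_compose:
  assumes "triangular G" "triangular H" shows "triangular (\<lambda>y. G (H y))"
  unfolding triangular_def
proof (intro allI impI)
  fix i and y z :: "real ^ 'n" assume *: "\<forall>l. \<sigma> l < \<sigma> i \<longrightarrow> y $ l = z $ l"
  have "H y $ l = H z $ l" if "\<sigma> l < \<sigma> i" for l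
  proof -
    have "\<forall>k. \<sigma> k < \<sigma> l \<longrightarrow> y $ k = z $ k" using * that by simp
    then have "H y $ l - y $ l = H z $ l - z $ l" using assms(2) unfolding triangular_def by blast
    then show ?thesis using * that by simp
  qed
  then have "G (H y) $ i - H y $ i = G (H z) $ i - H z $ i" using assms(1) unfolding triangular_def by blast
  moreover have "H y $ i - y $ i = H z $ i - z $ i" using assms(2) * unfolding triangular_def by blast
  ultimately show "G (H y) $ i - y $ i = G (H z) $ i - z $ i" by linarith
qed

lemma triangular_id: "triangular (\<lambda>y. y)"
  by (simp add: triangular_def)

text \<open>Composition with \<open>A\<close> acts on weighted polynomials as \<open>1 + c Z\<close> up to terms lowering the degree more.\<close>

definition leading :: "nat \<Rightarrow> (real ^ 'n \<Rightarrow> real ^ 'n) \<Rightarrow> real \<Rightarrow> (real ^ 'n \<Rightarrow> real ^ 'n) \<Rightarrow> bool" where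
  "leading k Z c A \<longleftrightarrow> (\<forall>n f. filt n f \<longrightarrow> filt (n - int k - 1) (\<lambda>y. f (A y) - f y - c * vf_apply Z f y))"

lemma leadingD:
  "leading k Z c A \<Longrightarrow> filt n f \<Longrightarrow> filt (n - int k - 1) (\<lambda>y. f (A y) - f y - c * vf_apply Z f y)"
  by (simp add: leading_def)

lemma leading_diff:
  assumes "leading k Z c A" "hom_vf k Z" "filt n f"
  shows "filt (n - int k) (\<lambda>y. f (A y) - f y)"
proof -
  have "filt (n - int k) (\<lambda>y. f (A y) - f y - c * vf_apply Z f y)"
    by (rule filt_mono[of "n - int k - 1"]) (use assms in \<open>auto simp: leading_def\<close>)
  from filt_add[OF this filt_cmult[OF filt_vf_apply[OF assms(2,3)], of c]] show ?thesis by simp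
qed

lemma leading_filt:
  assumes "leading k Z c A" "hom_vf k Z" "filt n f"
  shows "filt n (\<lambda>y. f (A y))"
proof -
  have "filt n (\<lambda>y. f (A y) - f y)" by (rule filt_mono[OF leading_diff[OF assms]]) simp
  from filt_add[OF this assms(3)] show ?thesis by simp
qed

lemma vf_apply_filt_diff_cmult:
  assumes "filt n f" "filt n' g"
  shows "vf_apply V (\<lambda>y. f y - c * g y) x = vf_apply V f x - c * vf_apply V g x"
proof -
  note d = smooth_on_differentiable[OF filt_smooth UNIV_I]
  show ?thesis using vf_apply_diff[OF d[OF assms(1)] d[OF filt_cmult[OF assms(2)]]] vf_apply_cmult[OF d[OF assms(2)]] by simp
qed

lemma filt_vf_apply_diff:
  assumes V: "hom_vf k V" and fg: "filt e (\<lambda>y. f y - c * g y)" and "filt n f" "filt n' g" "e - int k \<le> N"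
  shows "filt N (\<lambda>y. vf_apply V f y - c * vf_apply V g y)"
proof -
  have "vf_apply V (\<lambda>y. f y - c * g y) = (\<lambda>y. vf_apply V f y - c * vf_apply V g y)"
    using vf_apply_filt_diff_cmult[OF assms(3,4)] by blast
  with filt_vf_apply[OF V fg] have "filt (e - int k) (\<lambda>y. vf_apply V f y - c * vf_apply V g y)" by simp
  then show ?thesis by (rule filt_mono) (rule assms(5))
qed

text \<open>The second difference is the first difference along \<open>A\<close> of
  \<open>q = f \<circ> B - f\<close>. Since \<open>q\<close> is \<open>d W f\<close> up to lower
  degree, the result is \<open>c d Z (W f)\<close> up to lower degree.\<close>

lemma leading_twice:
  assumes A: "leading k Z c A" "hom_vf k Z" and B: "leading l W d B" "hom_vf l W" and f: "filt n f"
  shows "filt (n - int k - int l - 1)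
    (\<lambda>y. (f (B (A y)) - f (A y)) - (f (B y) - f y) - c * d * vf_apply Z (vf_apply W f) y)"
proof -
  define q where "q y = f (B y) - f y" for y
  have q: "filt (n - int l) q" unfolding q_def[abs_def] by (rule leading_diff[OF B f])
  have 1: "filt (n - int k - int l - 1) (\<lambda>y. q (A y) - q y - c * vf_apply Z q y)"
  proof -
    have "filt (n - int l - int k - 1) (\<lambda>y. q (A y) - q y - c * vf_apply Z q y)"
      using A(1) q unfolding leading_def by blast
    then show ?thesis by (rule filt_mono) simp
  qed
  have "filt (n - int l - 1) (\<lambda>y. q y - d * vf_apply W f y)"
    using B(1) f by (simp add: q_def leading_def)
  from filt_vf_apply_diff[OF A(2) this q filt_vf_apply[OF B(2) f], of "n - int k - int l - 1"]
  have "filt (n - int k - int l - 1) (\<lambda>y. vf_apply Z q y - d * vf_apply Z (vf_apply W f) y)"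
    by simp
  from filt_add[OF 1 filt_cmult[OF this, of c]] show ?thesis
    by (simp add: q_def algebra_simps)
qed

text \<open>Subtracting the second differences taken in the two orders cancels all terms with a
  single map and leaves \<open>f' (B (A y)) - f' (A (B y))\<close>, whose leading part is
  \<open>c d\<close> times the bracket applied to \<open>f'\<close>.\<close>

lemma leading_commutator:
  assumes A: "leading k Z c A" "hom_vf k Z" "k > 0" and B: "leading l W d B" "hom_vf l W" "l > 0"
    and A': "leading k Z c' A'" and B': "leading l W d' B'"
    and inv: "\<And>y. A' (A y) = y" "\<And>y. B' (B y) = y"
  shows "leading (k + l) (vf_bracket Z W) (c * d) (\<lambda>y. B' (A' (B (A y))))"
  unfolding leading_def
proof (intro allI impI)
  fix n f assume f: "filt n f"
  \<comment> \<open>With this choice \<open>f' (A (B y))\<close> collapses to \<open>f y\<close>,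
    while \<open>f' (B (A y))\<close> is \<open>f\<close> after the group commutator. Since
    \<open>f' - f\<close> has lower degree, \<open>f'\<close> may be replaced by \<open>f\<close>
    under the bracket.\<close>
  define f' where "f' y = f (B' (A' y))" for y
  let ?n = "n - int k - int l - 1"
  let ?U = "vf_bracket Z W"
  have fB: "filt n (\<lambda>y. f (B' y))" by (rule leading_filt[OF B' B(2) f])
  have f': "filt n f'" unfolding f'_def[abs_def] by (rule leading_filt[OF A' A(2) fB])
  have "filt (n - 1) (\<lambda>y. f (B' (A' y)) - f (B' y))"
    by (rule filt_mono[OF leading_diff[OF A' A(2) fB]]) (use A(3) in simp)
  moreover have "filt (n - 1) (\<lambda>y. f (B' y) - f y)"
    by (rule filt_mono[OF leading_diff[OF B' B(2) f]]) (use B(3) in simp)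
  ultimately have ff: "filt (n - 1) (\<lambda>y. f' y - 1 * f y)"
    using filt_add unfolding f'_def by fastforce
  have U: "hom_vf (k + l) ?U" by (rule hom_vf_bracket[OF A(2) B(2)])
  have 0: "filt ?n (\<lambda>y. vf_apply ?U f' y - vf_apply ?U f y)"
    using filt_vf_apply_diff[OF U ff f' f, of ?n] by simp
  have 1: "filt ?n (\<lambda>y. (f' (B (A y)) - f' (A y)) - (f' (B y) - f' y) - c * d * vf_apply Z (vf_apply W f') y)"
    by (rule leading_twice[OF A(1,2) B(1,2) f'])
  have 2: "filt ?n (\<lambda>y. (f' (A (B y)) - f' (B y)) - (f' (A y) - f' y) - d * c * vf_apply W (vf_apply Z f') y)"
    using leading_twice[OF B(1,2) A(1,2) f'] by (simp add: algebra_simps)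
  have e: "f' (A (B y)) = f y" for y by (simp add: f'_def inv)
  have "filt ?n (\<lambda>y. f (B' (A' (B (A y)))) - f y - c * d * vf_apply ?U f y)"
    using filt_add[OF filt_diff[OF 1 2] filt_cmult[OF 0, of "c * d"]]
      vf_apply_bracket_filt[OF A(2) B(2) f']
    by (simp add: e f'_def[of "B _"] algebra_simps)
  then show "filt (n - int (k + l) - 1) (\<lambda>y. f (B' (A' (B (A y)))) - f y - c * d * vf_apply ?U f y)"
    by (simp add: algebra_simps)
qed

lemma leading_swap:
  assumes "leading k (vf_bracket W Z) c A" "hom_vf l Z" "hom_vf l' W"
  shows "leading k (vf_bracket Z W) (- c) A"
  unfolding leading_def
proof (intro allI impI)
  fix n f assume f: "filt n f"
  have "vf_apply (vf_bracket Z W) f y = - vf_apply (vf_bracket W Z) f y" for y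
    using vf_apply_bracket_filt[OF assms(2,3) f] vf_apply_bracket_filt[OF assms(3,2) f] by simp
  then show "filt (n - int k - 1) (\<lambda>y. f (A y) - f y - - c * vf_apply (vf_bracket Z W) f y)"
    using assms(1) f unfolding leading_def by simp
qed

lemma leading_flow: "hom_vf 1 X \<Longrightarrow> leading 1 X t (flow X t)"
  using flow_filt by (simp add: leading_def)

end

section \<open>Iterated brackets, their group commutators and moves within one layer\<close>

context flows
begin

inductive brackets :: "nat \<Rightarrow> (real ^ 'n \<Rightarrow> real ^ 'n) \<Rightarrow> bool" where
  brackets_base: "j \<in> {1..m} \<Longrightarrow> brackets 1 (X j)"
| brackets_step: "brackets k Z \<Longrightarrow> brackets l W \<Longrightarrow> brackets (k + l) (vf_bracket Z W)"

lemma brackets_hom: "brackets k Z \<Longrightarrow> hom_vf k Z"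
  by (induction rule: brackets.induct) (rule hom_X, assumption, rule hom_vf_bracket)

lemma brackets_pos: "brackets k Z \<Longrightarrow> k > 0"
  by (induction rule: brackets.induct) auto

lemma brackets_1: "brackets k Z \<Longrightarrow> k = 1 \<Longrightarrow> \<exists>j\<in>{1..m}. Z = X j"
proof (induction rule: brackets.induct)
  case (brackets_step k Z l W)
  then show ?case using brackets_pos[of k Z] brackets_pos[of l W] by linarith
qed auto

text \<open>The length parameter is \<open>\<rho>\<close> itself: the number of flows composed is
  absorbed into a constant \<open>\<kappa>\<close> common to all \<open>\<rho>\<close> in
  \<open>S\<close>.\<close>

definition cfam :: "real set \<Rightarrow> (real \<Rightarrow> real ^ 'n \<Rightarrow> real ^ 'n) \<Rightarrow> bool" where
  "cfam S g \<longleftrightarrow> continuous_on UNIV (\<lambda>(\<rho>, y). g \<rho> y) \<and> (\<forall>\<rho>. triangular (g \<rho>)) \<and>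
     (\<exists>\<kappa>\<ge>0. \<exists>b. \<forall>\<rho>\<in>S. ctrl \<kappa> \<rho> b (g \<rho>))"

lemma cfam_compose:
  assumes g: "cfam S g" and h: "cfam S h" shows "cfam S (\<lambda>\<rho> y. g \<rho> (h \<rho> y))"
proof -
  obtain \<kappa> b \<kappa>' b' where k: "\<kappa> \<ge> 0" "\<forall>\<rho>\<in>S. ctrl \<kappa> \<rho> b (g \<rho>)" "\<kappa>' \<ge> 0" "\<forall>\<rho>\<in>S. ctrl \<kappa>' \<rho> b' (h \<rho>)"
    using assms unfolding cfam_def by blast
  have "\<forall>\<rho>\<in>S. ctrl (2 * \<kappa> + 2 * \<kappa>') \<rho> (\<lambda>R. b (b' R)) (\<lambda>y. g \<rho> (h \<rho> y))"
    using k ctrl_compose by blast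
  moreover have "0 \<le> 2 * \<kappa> + 2 * \<kappa>'" using k by simp
  moreover have "continuous_on UNIV (\<lambda>p. (\<lambda>(\<rho>, y). g \<rho> y) (fst p, (\<lambda>(\<rho>, y). h \<rho> y) p))"
  proof -
    have cg: "continuous_on UNIV (\<lambda>(\<rho>, y). g \<rho> y)" and ch: "continuous_on UNIV (\<lambda>(\<rho>, y). h \<rho> y)"
      using g h by (simp_all add: cfam_def)
    show ?thesis
      by (rule continuous_on_compose2[OF cg]) (auto intro!: continuous_on_Pair continuous_intros ch)
  qed
  ultimately show ?thesis
    using assms unfolding cfam_def by (auto simp: case_prod_beta intro: triangular_compose)
qed

lemma cfam_flow:
  assumes "j \<in> {1..m}" "s = 1 \<or> s = -1"
  shows "cfam {0..T} (\<lambda>\<rho>. flow (X j) (s * \<rho>))"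
proof -
  obtain b where b: "\<forall>t. \<bar>t\<bar> \<le> T \<longrightarrow> ctrl 1 \<bar>t\<bar> b (flow (X j) t)"
    using ctrl_flow[OF assms(1)] by blast
  have "\<forall>\<rho>\<in>{0..T}. ctrl 1 \<rho> b (flow (X j) (s * \<rho>))"
  proof
    fix \<rho> assume "\<rho> \<in> {0..T}"
    then show "ctrl 1 \<rho> b (flow (X j) (s * \<rho>))" using b[rule_format, of "s * \<rho>"] assms(2) by auto
  qed
  moreover have "continuous_on UNIV (\<lambda>p. (\<lambda>(t, y). flow (X j) t y) (s * fst p, snd p))"
    by (rule continuous_on_compose2[OF continuous_on_flow[OF hom_X[OF assms(1)]]])
       (auto intro!: continuous_intros)
  ultimately show ?thesis
    using flow_triangular[OF hom_X[OF assms(1)]] unfolding cfam_def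
    by (auto simp: case_prod_beta intro!: exI[of _ "1::real"])
qed

text \<open>The group commutator of the moves for \<open>Z\<close> and \<open>W\<close> moves along
  their bracket by \<open>\<rho> ^ (k + l)\<close>. Replacing \<open>\<rho>\<close> by its negative
  would not give the opposite direction when the exponent is even; the inverse map \<open>h\<close>
  does, and it is again a commutator, with the roles of \<open>Z\<close> and \<open>W\<close>
  exchanged.\<close>

lemma bracket_moves:
  assumes "brackets k Z"
  shows "\<exists>g h. cfam {0..T} g \<and> cfam {0..T} h \<and> (\<forall>\<rho> y. g \<rho> (h \<rho> y) = y \<and> h \<rho> (g \<rho> y) = y) \<and>
     (\<forall>\<rho>. leading k Z (\<rho> ^ k) (g \<rho>) \<and> leading k Z (- (\<rho> ^ k)) (h \<rho>))"
  using assms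
proof (induction rule: brackets.induct)
  case (brackets_base j)
  note Xj = hom_X[OF brackets_base]
  show ?case
  proof (intro exI conjI allI)
    show "cfam {0..T} (\<lambda>\<rho>. flow (X j) (1 * \<rho>))" "cfam {0..T} (\<lambda>\<rho>. flow (X j) (-1 * \<rho>))"
      by (rule cfam_flow[OF brackets_base]; simp)+
    show "flow (X j) (1 * \<rho>) (flow (X j) (-1 * \<rho>) y) = y" "flow (X j) (-1 * \<rho>) (flow (X j) (1 * \<rho>) y) = y" for \<rho> y
      using flow_inverse[OF Xj, of \<rho>] flow_inverse[OF Xj, of "-\<rho>"] by simp_all
    show "leading 1 (X j) (\<rho> ^ 1) (flow (X j) (1 * \<rho>))" "leading 1 (X j) (- (\<rho> ^ 1)) (flow (X j) (-1 * \<rho>))" for \<rho>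
      using leading_flow[OF Xj, of \<rho>] leading_flow[OF Xj, of "-\<rho>"] by simp_all
  qed
next
  case (brackets_step k Z l W)
  obtain g1 h1 where 1: "cfam {0..T} g1" "cfam {0..T} h1" "\<And>\<rho> y. g1 \<rho> (h1 \<rho> y) = y" "\<And>\<rho> y. h1 \<rho> (g1 \<rho> y) = y"
     "\<And>\<rho>. leading k Z (\<rho> ^ k) (g1 \<rho>)" "\<And>\<rho>. leading k Z (- (\<rho> ^ k)) (h1 \<rho>)"
    using brackets_step.IH(1) by blast
  obtain g2 h2 where 2: "cfam {0..T} g2" "cfam {0..T} h2" "\<And>\<rho> y. g2 \<rho> (h2 \<rho> y) = y" "\<And>\<rho> y. h2 \<rho> (g2 \<rho> y) = y"
     "\<And>\<rho>. leading l W (\<rho> ^ l) (g2 \<rho>)" "\<And>\<rho>. leading l W (- (\<rho> ^ l)) (h2 \<rho>)"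
    using brackets_step.IH(2) by blast
  have hZ: "hom_vf k Z" "k > 0" and hW: "hom_vf l W" "l > 0"
    using brackets_step.hyps brackets_hom brackets_pos by auto
  show ?case
  proof (intro exI conjI allI)
    show "cfam {0..T} (\<lambda>\<rho> y. h2 \<rho> (h1 \<rho> (g2 \<rho> (g1 \<rho> y))))" "cfam {0..T} (\<lambda>\<rho> y. h1 \<rho> (h2 \<rho> (g1 \<rho> (g2 \<rho> y))))"
      by (rule cfam_compose[OF 2(2) cfam_compose[OF 1(2) cfam_compose[OF 2(1) 1(1)]]]
        cfam_compose[OF 1(2) cfam_compose[OF 2(2) cfam_compose[OF 1(1) 2(1)]]])+
    show "h2 \<rho> (h1 \<rho> (g2 \<rho> (g1 \<rho> (h1 \<rho> (h2 \<rho> (g1 \<rho> (g2 \<rho> y))))))) = y"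
      "h1 \<rho> (h2 \<rho> (g1 \<rho> (g2 \<rho> (h2 \<rho> (h1 \<rho> (g2 \<rho> (g1 \<rho> y))))))) = y" for \<rho> y
      by (simp_all add: 1 2)
    show "leading (k + l) (vf_bracket Z W) (\<rho> ^ (k + l)) (\<lambda>y. h2 \<rho> (h1 \<rho> (g2 \<rho> (g1 \<rho> y))))" for \<rho>
      unfolding power_add
      by (rule leading_commutator[OF 1(5) hZ 2(5) hW 1(6) 2(6) 1(4) 2(4)])
    show "leading (k + l) (vf_bracket Z W) (- (\<rho> ^ (k + l))) (\<lambda>y. h1 \<rho> (h2 \<rho> (g1 \<rho> (g2 \<rho> y))))" for \<rho>
    proof (rule leading_swap[OF _ hZ(1) hW(1)])
      have "leading (l + k) (vf_bracket W Z) (\<rho> ^ l * \<rho> ^ k) (\<lambda>y. h1 \<rho> (h2 \<rho> (g1 \<rho> (g2 \<rho> y))))"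
        by (rule leading_commutator[OF 2(5) hW 1(5) hZ 2(6) 1(6) 2(4) 1(4)])
      then show "leading (k + l) (vf_bracket W Z) (\<rho> ^ (k + l)) (\<lambda>y. h1 \<rho> (h2 \<rho> (g1 \<rho> (g2 \<rho> y))))"
        by (simp add: power_add add.commute mult.commute)
    qed
  qed
qed

text \<open>The parameter is the displacement \<open>s\<close>, so the length of the path is
  \<open>root k s\<close>. Coordinates of weight below \<open>k\<close> stay fixed and layer
  \<open>k\<close> moves exactly by \<open>s v\<close>; heavier coordinates are only required to
  move in a triangular way.\<close>

definition shift_family where
  "shift_family T k v \<kappa> b D \<longleftrightarrow> \<kappa> \<ge> 0 \<and> continuous_on UNIV (\<lambda>(s, y). D s y) \<and> (\<forall>s. triangular (D s)) \<and>
     (\<forall>s\<in>{0..T}. ctrl \<kappa> (root k s) b (D s)) \<and>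
     (\<forall>s\<ge>0. \<forall>y i. (\<sigma> i < k \<longrightarrow> D s y $ i = y $ i) \<and> (\<sigma> i = k \<longrightarrow> D s y $ i = y $ i + s * v $ i))"

lemma shift_familyD:
  assumes "shift_family T k v \<kappa> b D"
  shows "\<kappa> \<ge> 0" "continuous_on UNIV (\<lambda>(s, y). D s y)" "\<And>s. triangular (D s)"
     "\<And>s. s\<in>{0..T} \<Longrightarrow> ctrl \<kappa> (root k s) b (D s)"
     "\<And>s y i. s\<ge>0 \<Longrightarrow> (\<sigma> i < k \<longrightarrow> D s y $ i = y $ i) \<and> (\<sigma> i = k \<longrightarrow> D s y $ i = y $ i + s * v $ i)"
  using assms unfolding shift_family_def by blast+

definition layer_move :: "nat \<Rightarrow> real ^ 'n \<Rightarrow> bool" where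
  "layer_move k v \<longleftrightarrow> (\<forall>T\<ge>0. \<exists>\<kappa> b D. shift_family T k v \<kappa> b D)"

text \<open>Test \<open>leading\<close> on a coordinate: the remainder lies in
  \<open>filt (\<sigma> i - k)\<close> and vanishes for \<open>\<sigma> i \<le> k\<close>. There the
  coefficient of \<open>Z\<close> has degree \<open>\<sigma> i - k\<close>, so it is 0 below layer
  \<open>k\<close> and constant in layer \<open>k\<close>.\<close>

lemma layer_move_leading:
  assumes Z: "hom_vf k Z" "k > 0" and g: "\<And>T. T \<ge> 0 \<Longrightarrow> \<exists>g. cfam {0..T} g \<and> (\<forall>\<rho>. leading k Z (\<epsilon> * \<rho> ^ k) (g \<rho>))"
  shows "layer_move k (\<epsilon> *\<^sub>R Z 0)"
  unfolding layer_move_def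
proof (intro allI impI)
  fix T :: real assume T: "T \<ge> 0"
  obtain g where g: "cfam {0..root k T} g" "\<And>\<rho>. leading k Z (\<epsilon> * \<rho> ^ k) (g \<rho>)"
    using g[of "root k T"] T Z(2) by auto
  then obtain \<kappa> b where k: "\<kappa> \<ge> 0" "\<And>\<rho>. \<rho> \<in> {0..root k T} \<Longrightarrow> ctrl \<kappa> \<rho> b (g \<rho>)" unfolding cfam_def by blast
  define D where "D s = g (root k s)" for s
  have "continuous_on UNIV (\<lambda>p. (\<lambda>(\<rho>, y). g \<rho> y) (root k (fst p), snd p))"
  proof -
    have cg: "continuous_on UNIV (\<lambda>(\<rho>, y). g \<rho> y)" using g by (simp add: cfam_def)
    show ?thesis
      by (rule continuous_on_compose2[OF cg]) (auto intro!: continuous_intros)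
  qed
  moreover have "triangular (D s)" for s using g by (simp add: cfam_def D_def)
  moreover have "ctrl \<kappa> (root k s) b (D s)" if "s \<in> {0..T}" for s
    unfolding D_def by (rule k(2)) (use that Z(2) in auto)
  moreover have "(\<sigma> i < k \<longrightarrow> D s y $ i = y $ i) \<and> (\<sigma> i = k \<longrightarrow> D s y $ i = y $ i + s * (\<epsilon> *\<^sub>R Z 0) $ i)" if "s \<ge> 0" for s y i
  proof -
    have s: "root k s ^ k = s" using that Z(2) by simp
    have "filt (int (\<sigma> i) + 1 - int k - 1) (\<lambda>y. D s y $ i - y $ i - \<epsilon> * s * vf_apply Z (\<lambda>y. y $ i) y)"
      using leadingD[OF g(2)[of "root k s"] hom_fun_filt[OF hom_fun_coord, of i "int (\<sigma> i) + 1"]]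
      by (simp add: D_def s)
    then have e: "D s y $ i - y $ i - \<epsilon> * s * Z y $ i = 0" if "\<sigma> i \<le> k"
      using filt_nonpos that by fastforce
    have h: "hom_fun (int (\<sigma> i) - int k) (\<lambda>y. Z y $ i)" using Z by (simp add: hom_vf_def)
    have "Z y $ i = 0" if "\<sigma> i < k" using hom_fun_neg[OF h] that by simp
    moreover have "Z y $ i = Z 0 $ i" if "\<sigma> i = k" using hom_fun_0_const h that by simp
    ultimately show ?thesis using e by (auto simp: algebra_simps)
  qed
  ultimately have "shift_family T k (\<epsilon> *\<^sub>R Z 0) \<kappa> b D"
    using k(1) unfolding shift_family_def by (simp add: D_def case_prod_beta)
  then show "\<exists>\<kappa> b D. shift_family T k (\<epsilon> *\<^sub>R Z 0) \<kappa> b D" by blast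
qed

lemma ctrl_id: "ctrl 0 r (\<lambda>R. R) (\<lambda>y. y)"
  by (simp add: ctrl_def mpres_id)

lemma layer_move_0: "layer_move k 0"
proof -
  have "shift_family T k 0 0 (\<lambda>R. R) (\<lambda>s y. y)" for T
    by (auto simp: shift_family_def triangular_id ctrl_id case_prod_beta intro: continuous_intros)
  then show ?thesis unfolding layer_move_def by blast
qed

lemma layer_move_add:
  assumes "layer_move k v" "layer_move k w" shows "layer_move k (v + w)"
  unfolding layer_move_def
proof (intro allI impI)
  fix T :: real assume T: "T \<ge> 0"
  obtain \<kappa> b D where "shift_family T k v \<kappa> b D"
    using assms(1) T unfolding layer_move_def by blast
  note 1 = shift_familyD[OF this]
  obtain \<kappa>' b' D' where "shift_family T k w \<kappa>' b' D'"
    using assms(2) T unfolding layer_move_def by blast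
  note 2 = shift_familyD[OF this]
  have "continuous_on UNIV (\<lambda>p. (\<lambda>(s, y). D s y) (fst p, (\<lambda>(s, y). D' s y) p))"
    by (rule continuous_on_compose2[OF 1(2)]) (auto intro!: continuous_on_Pair continuous_intros 2(2))
  moreover have "\<And>s. s\<in>{0..T} \<Longrightarrow> ctrl (2 * \<kappa> + 2 * \<kappa>') (root k s) (\<lambda>R. b (b' R)) (\<lambda>y. D s (D' s y))"
    using 1 2 ctrl_compose by blast
  moreover have "triangular (\<lambda>y. D s (D' s y))" for s by (rule triangular_compose[OF 1(3) 2(3)])
  ultimately have "shift_family T k (v + w) (2 * \<kappa> + 2 * \<kappa>') (\<lambda>R. b (b' R)) (\<lambda>s y. D s (D' s y))"
    using 1(1,5) 2(1,5) unfolding shift_family_def by (simp add: case_prod_beta algebra_simps)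
  then show "\<exists>\<kappa> b D. shift_family T k (v + w) \<kappa> b D" by blast
qed

lemma layer_move_scale:
  assumes "layer_move k v" "c \<ge> 0" "k > 0" shows "layer_move k (c *\<^sub>R v)"
  unfolding layer_move_def
proof (intro allI impI)
  fix T :: real assume T: "T \<ge> 0"
  obtain \<kappa> b D where "shift_family (c * T) k v \<kappa> b D"
    using assms(1) mult_nonneg_nonneg[OF assms(2) T] unfolding layer_move_def by blast
  note 1 = shift_familyD[OF this]
  have "continuous_on UNIV (\<lambda>p. (\<lambda>(s, y). D s y) (c * fst p, snd p))"
    by (rule continuous_on_compose2[OF 1(2)]) (auto intro!: continuous_intros)
  moreover have "ctrl (\<kappa> * (root k c)\<^sup>2) (root k s) b (D (c * s))" if "s\<in>{0..T}" for s
  proof -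
    have "ctrl \<kappa> (root k (c * s)) b (D (c * s))"
      using that assms(2) by (intro 1(4)) (auto intro: mult_left_mono)
    then show ?thesis unfolding ctrl_def by (simp add: real_root_mult power_mult_distrib mult.assoc)
  qed
  ultimately have "shift_family T k (c *\<^sub>R v) (\<kappa> * (root k c)\<^sup>2) b (\<lambda>s. D (c * s))"
    using 1(1,3,5) assms(2) unfolding shift_family_def by (simp add: case_prod_beta algebra_simps)
  then show "\<exists>\<kappa> b D. shift_family T k (c *\<^sub>R v) \<kappa> b D" by blast
qed

text \<open>Reparametrising \<open>s\<close> yields only nonnegative multiples; the inverse families
  from \<open>bracket_moves\<close> supply the negative ones.\<close>

lemma layer_move_span:
  assumes "v \<in> span {Z 0 | Z. brackets k Z}" "k > 0" shows "layer_move k v"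
  using assms(1)
proof (induction rule: span_induct_alt)
  case base
  then show ?case by (rule layer_move_0)
next
  case (step c x y)
  then obtain Z where Z: "x = Z 0" "brackets k Z" by blast
  have hZ: "hom_vf k Z" using Z brackets_hom by blast
  have m: "\<exists>g. cfam {0..T} g \<and> (\<forall>\<rho>. leading k Z (1 * \<rho> ^ k) (g \<rho>))"
    "\<exists>g. cfam {0..T} g \<and> (\<forall>\<rho>. leading k Z (-1 * \<rho> ^ k) (g \<rho>))" for T
    unfolding mult_1 mult_minus1 using bracket_moves[OF Z(2), of T] by blast+
  have "layer_move k (1 *\<^sub>R Z 0)" "layer_move k ((-1) *\<^sub>R Z 0)"
    by (rule layer_move_leading[OF hZ assms(2) m(1)] layer_move_leading[OF hZ assms(2) m(2)])+
  then have "layer_move k x" "layer_move k (- x)" using Z by simp_all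
  then have "layer_move k (c *\<^sub>R x)"
    using layer_move_scale[of k x c] layer_move_scale[of k "-x" "-c"] assms(2) by (cases "c \<ge> 0") auto
  then show ?case using layer_move_add step by blast
qed

text \<open>Since \<open>brackets\<close> allows arbitrary nesting, bilinearity of the bracket shows
  that these combinations exhaust the generated Lie algebra.\<close>

inductive lincomb :: "(real ^ 'n \<Rightarrow> real ^ 'n) \<Rightarrow> bool" where
  lincomb_zero: "lincomb (\<lambda>x. 0)"
| lincomb_step: "brackets k Z \<Longrightarrow> lincomb V \<Longrightarrow> lincomb (\<lambda>x. c *\<^sub>R Z x + V x)"

lemma brackets_differentiable: "brackets k Z \<Longrightarrow> Z differentiable (at x)"
  using brackets_hom hom_vf_def smooth_on_differentiable by blast

lemma lincomb_differentiable: "lincomb V \<Longrightarrow> V differentiable (at x)"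
  by (induction rule: lincomb.induct) (auto intro!: differentiable_add differentiable_scaleR intro: brackets_differentiable)

lemma lincomb_add: "lincomb V \<Longrightarrow> lincomb W \<Longrightarrow> lincomb (\<lambda>x. V x + W x)"
proof (induction rule: lincomb.induct)
  case (lincomb_step k Z V c)
  from lincomb.lincomb_step[OF lincomb_step(1) lincomb_step.IH[OF lincomb_step.prems]]
  show ?case by (simp add: add.assoc)
qed simp

lemma lincomb_scale: "lincomb V \<Longrightarrow> lincomb (\<lambda>x. a *\<^sub>R V x)"
proof (induction rule: lincomb.induct)
  case (lincomb_step k Z V c)
  from lincomb.lincomb_step[OF lincomb_step(1) lincomb_step.IH, of "a * c"]
  show ?case by (simp add: scaleR_add_right)
qed (simp add: lincomb_zero)

lemma vf_bracket_linear_right: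
  assumes "V differentiable (at x)" "Z differentiable (at x)" "W differentiable (at x)"
  shows "vf_bracket V (\<lambda>x. c *\<^sub>R Z x + W x) x = c *\<^sub>R vf_bracket V Z x + vf_bracket V W x"
proof -
  have 1: "frechet_derivative (\<lambda>x. c *\<^sub>R Z x + W x) (at x) v =
      c *\<^sub>R frechet_derivative Z (at x) v + frechet_derivative W (at x) v" for v
    by (rule frechet_derivative_eqI)
       (intro has_derivative_add has_derivative_scaleR_right assms[unfolded frechet_derivative_works])
  interpret linear "frechet_derivative V (at x)" by (rule linear_frechet_derivative[OF assms(1)])
  show ?thesis unfolding vf_bracket_def 1 by (simp add: add scale algebra_simps)
qed

lemma vf_bracket_swap: "vf_bracket V W x = - vf_bracket W V x"
  by (simp add: vf_bracket_def)

lemma lincomb_bracket_left: "lincomb W \<Longrightarrow> brackets k Z \<Longrightarrow> lincomb (vf_bracket Z W)"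
proof (induction rule: lincomb.induct)
  case lincomb_zero
  have "vf_bracket Z (\<lambda>x. 0) = (\<lambda>x. 0)"
    using linear_0[OF linear_frechet_derivative[OF brackets_differentiable[OF lincomb_zero]]]
    by (simp add: vf_bracket_def)
  then show ?case by (simp add: lincomb.lincomb_zero)
next
  case (lincomb_step l Y V c)
  have "vf_bracket Z (\<lambda>x. c *\<^sub>R Y x + V x) = (\<lambda>x. c *\<^sub>R vf_bracket Z Y x + vf_bracket Z V x)"
    by (rule ext, rule vf_bracket_linear_right)
       (rule brackets_differentiable[OF lincomb_step.prems] brackets_differentiable[OF lincomb_step(1)]
         lincomb_differentiable[OF lincomb_step(2)])+
  then show ?case
    using lincomb.lincomb_step[OF brackets_step[OF lincomb_step.prems lincomb_step(1)] lincomb_step.IH[OF lincomb_step.prems], of c] by simp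
qed

lemma lincomb_bracket: "lincomb V \<Longrightarrow> lincomb W \<Longrightarrow> lincomb (vf_bracket V W)"
proof (induction rule: lincomb.induct)
  case lincomb_zero
  have "vf_bracket (\<lambda>x. 0) W = (\<lambda>x. 0)"
    using linear_0[OF linear_frechet_derivative[OF lincomb_differentiable[OF lincomb_zero]]]
    by (simp add: vf_bracket_def)
  then show ?case by (simp add: lincomb.lincomb_zero)
next
  case (lincomb_step l Y V c)
  have "vf_bracket W (\<lambda>x. c *\<^sub>R Y x + V x) x = c *\<^sub>R vf_bracket W Y x + vf_bracket W V x" for x
    using lincomb_step by (intro vf_bracket_linear_right brackets_differentiable lincomb_differentiable)
  then have "vf_bracket (\<lambda>x. c *\<^sub>R Y x + V x) W = (\<lambda>x. c *\<^sub>R vf_bracket Y W x + vf_bracket V W x)"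
    by (intro ext, subst vf_bracket_swap) (simp add: vf_bracket_swap[of W Y] vf_bracket_swap[of W V])
  then show ?case
    using lincomb_add[OF lincomb_scale[OF lincomb_bracket_left[OF lincomb_step.prems lincomb_step(1)]] lincomb_step.IH[OF lincomb_step.prems], of c]
    by simp
qed

lemma lie_generated_lincomb: "V \<in> lie_generated (X ` {1..m}) \<Longrightarrow> lincomb V"
proof (induction rule: lie_generated.induct)
  case (base V)
  then obtain j where j: "j \<in> {1..m}" "V = X j" by auto
  from lincomb_step[OF brackets_base[OF j(1)] lincomb_zero, of 1] show ?case by (simp add: j)
qed (auto intro: lincomb_zero lincomb_add lincomb_scale lincomb_bracket)

end

section \<open>The rank condition at the origin and sweeping out a box\<close>

locale hoermander_flows = flows \<sigma> m X for \<sigma> :: "'n::finite \<Rightarrow> nat" and m and X +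
  assumes rank_0: "span {V 0 | V. V \<in> lie_generated (X ` {1..m})} = UNIV"
begin

text \<open>A coefficient of negative degree vanishes everywhere and one of positive degree vanishes
  at 0. Hence at the origin the length of a bracket matches the weight of the coordinates that it
  moves.\<close>

lemma brackets_at_0:
  assumes "brackets k Z" "\<sigma> i \<noteq> k" shows "Z 0 $ i = 0"
proof -
  have h: "hom_fun (int (\<sigma> i) - int k) (\<lambda>y. Z y $ i)" using brackets_hom[OF assms(1)] by (simp add: hom_vf_def)
  show ?thesis using hom_fun_neg[OF h] hom_fun_pos_0[OF h] assms(2) by (cases "\<sigma> i < k") auto
qed

text \<open>Represent the axis through the rank condition and project onto its layer: the projection
  \<open>P\<close> keeps the values at 0 of brackets of length \<open>\<sigma> i\<close> and kills
  all others.\<close>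

lemma axis_in_layer_span: "axis i 1 \<in> span {Z 0 | Z. brackets (\<sigma> i) Z}"
proof -
  define P where "P v = (\<chi> l. if \<sigma> l = \<sigma> i then v $ l else 0)" for v :: "real ^ 'n"
  have lP: "linear P" by (rule linearI) (auto simp: P_def vec_eq_iff)
  let ?S = "{Z 0 | Z. brackets (\<sigma> i) Z}"
  have lc: "P (V 0) \<in> span ?S" if "lincomb V" for V
    using that
  proof (induction rule: lincomb.induct)
    case lincomb_zero
    then show ?case by (simp add: linear_0[OF lP] span_zero)
  next
    case (lincomb_step k Z V c)
    have "P (Z 0) \<in> span ?S"
    proof (cases "k = \<sigma> i")
      case True
      then have "P (Z 0) = Z 0" using brackets_at_0[OF lincomb_step(1)] by (auto simp: P_def vec_eq_iff)
      then show ?thesis using True lincomb_step(1) by (auto intro: span_base)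
    next
      case False
      then have "P (Z 0) = 0" using brackets_at_0[OF lincomb_step(1)] by (auto simp: P_def vec_eq_iff)
      then show ?thesis by (simp add: span_zero)
    qed
    then show ?case using lincomb_step.IH
      by (simp add: linear_add[OF lP] linear_cmul[OF lP] span_add span_scale)
  qed
  have "P v \<in> span ?S" for v
  proof -
    have "v \<in> span {V 0 | V. V \<in> lie_generated (X ` {1..m})}" using rank_0 by simp
    then show ?thesis
    proof (induction rule: span_induct_alt)
      case base
      then show ?case by (simp add: linear_0[OF lP] span_zero)
    next
      case (step c x y)
      then show ?case using lc lie_generated_lincomb
        by (auto simp: linear_add[OF lP] linear_cmul[OF lP] intro!: span_add span_scale)
    qed
  qed
  then have "P (axis i 1) \<in> span ?S" .
  also have "P (axis i 1) = axis i 1" by (auto simp: P_def vec_eq_iff axis_def)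
  finally show ?thesis .
qed

text \<open>In a coordinate of weight 1 the coefficients of the \<open>X j\<close> have degree 0, so
  they are constant, and by the rank condition some of them is not 0. Its flow leaves any bounded
  set at constant speed.\<close>

lemma exists_transversal_field:
  assumes "\<sigma> i = 1"
  shows "\<exists>j\<in>{1..m}. \<exists>a\<noteq>0. \<forall>t y. flow (X j) t y $ i = y $ i + t * a"
proof -
  have "\<exists>j\<in>{1..m}. X j 0 $ i \<noteq> 0"
  proof (rule ccontr)
    assume *: "\<not> ?thesis"
    have "v $ i = 0" if "v \<in> span {Z 0 | Z. brackets 1 Z}" for v
      using that
      by (induction rule: span_induct_alt) (use * brackets_1 in fastforce)+
    from this[of "axis i 1"] show False using axis_in_layer_span[of i] assms by (simp add: axis_def)
  qed
  then obtain j where j: "j \<in> {1..m}" "X j 0 $ i \<noteq> 0" by blast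
  have "hom_fun 0 (\<lambda>y. X j y $ i)" using hom_X[OF j(1)] assms unfolding hom_vf_def by (metis diff_self of_nat_1)
  then have c: "X j y $ i = X j 0 $ i" for y by (rule hom_fun_0_const)
  have "flow (X j) t y $ i = y $ i + t * X j 0 $ i" for t y
    by (simp add: flow_def assms c[of y])
  then show ?thesis using j by blast
qed

lemma layer_move_axis: "layer_move (\<sigma> i) (axis i 1)"
  by (rule layer_move_span[OF axis_in_layer_span weight_pos])

text \<open>Compose one layer move per coordinate, with parameter \<open>s $ a\<close>; each costs
  at most \<open>\<rho>\<close> because \<open>root (\<sigma> a) (s $ a) \<le> \<rho>\<close>. For
  fixed \<open>y\<close> the end point is triangular as a function of \<open>s\<close>, hence
  preserves measure in \<open>s\<close>.\<close>

theorem box_moves: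
  "\<exists>\<kappa>\<ge>0. \<exists>b \<Psi>. continuous_on UNIV (\<lambda>(s, y). \<Psi> s y) \<and>
     (\<forall>\<rho>\<in>{0..1}. \<forall>s :: real ^ 'n. (\<forall>i. 0 \<le> s $ i \<and> s $ i \<le> \<rho> ^ \<sigma> i) \<longrightarrow> ctrl \<kappa> \<rho> b (\<Psi> s)) \<and>
     (\<forall>y. \<exists>G. mpres G \<and> (\<forall>s. (\<forall>i. 0 \<le> s $ i) \<longrightarrow> G s = \<Psi> s y))"
proof -
  \<comment> \<open>The last clause is triangularity in \<open>s\<close>, restricted to the
    coordinates \<open>A\<close> handled so far: only those contribute their own parameter
    additively.\<close>
  define P where "P A \<kappa> b \<Psi> \<longleftrightarrow> \<kappa> \<ge> 0 \<and> continuous_on UNIV (\<lambda>(s, y). \<Psi> s y) \<and>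
     (\<forall>\<rho>\<in>{0..1}. \<forall>s :: real ^ 'n. (\<forall>i. 0 \<le> s $ i \<and> s $ i \<le> \<rho> ^ \<sigma> i) \<longrightarrow> ctrl \<kappa> \<rho> b (\<Psi> s)) \<and>
     (\<forall>i s s' y. (\<forall>l. 0 \<le> s $ l \<and> 0 \<le> s' $ l) \<longrightarrow> (\<forall>l. \<sigma> l < \<sigma> i \<longrightarrow> s $ l = s' $ l) \<longrightarrow>
        \<Psi> s y $ i - (if i \<in> A then s $ i else 0) = \<Psi> s' y $ i - (if i \<in> A then s' $ i else 0))"
    for A \<kappa> b and \<Psi> :: "real ^ 'n \<Rightarrow> real ^ 'n \<Rightarrow> real ^ 'n"
  have "\<exists>\<kappa> b \<Psi>. P A \<kappa> b \<Psi>" if "finite A" for A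
    using that
  proof (induction A rule: finite_induct)
    case empty
    have "P {} 0 (\<lambda>R. R) (\<lambda>s y. y)"
      by (auto simp: P_def ctrl_id case_prod_beta intro: continuous_intros)
    then show ?case by blast
  next
    case (insert a A)
    then obtain \<kappa> b \<Psi> where P: "P A \<kappa> b \<Psi>" by blast
    obtain \<kappa>' b' D where "shift_family 1 (\<sigma> a) (axis a 1) \<kappa>' b' D"
      using layer_move_axis[of a] zero_le_one unfolding layer_move_def by blast
    note D = shift_familyD[OF this]
    have c\<Psi>: "continuous_on UNIV (\<lambda>(s, y). \<Psi> s y)" using P by (simp add: P_def)
    have "continuous_on UNIV (\<lambda>p. (\<lambda>(s, y). D s y) (fst p $ a, (\<lambda>(s, y). \<Psi> s y) p))"
      by (rule continuous_on_compose2[OF D(2)]) (auto intro!: continuous_on_Pair continuous_intros c\<Psi>)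
    then have 1: "continuous_on UNIV (\<lambda>(s, y). D (s $ a) (\<Psi> s y))" by (simp add: case_prod_beta)
    have 2: "ctrl (2 * \<kappa>' + 2 * \<kappa>) \<rho> (\<lambda>R. b' (b R)) (\<lambda>y. D (s $ a) (\<Psi> s y))"
      if "\<rho> \<in> {0..1}" "\<forall>i. 0 \<le> s $ i \<and> s $ i \<le> \<rho> ^ \<sigma> i" for \<rho> and s :: "real ^ 'n"
    proof -
      have k1: "ctrl \<kappa> \<rho> b (\<Psi> s)" "\<kappa> \<ge> 0" "\<kappa>' \<ge> 0" using P D(1) that by (auto simp: P_def)
      have sa: "0 \<le> s $ a" "s $ a \<le> \<rho> ^ \<sigma> a" using that by auto
      moreover have "\<rho> ^ \<sigma> a \<le> 1" using that by (intro power_le_one) auto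
      ultimately have "ctrl \<kappa>' (root (\<sigma> a) (s $ a)) b' (D (s $ a))" by (intro D(4)) auto
      moreover have "root (\<sigma> a) (s $ a) \<le> \<rho>"
      proof -
        have "root (\<sigma> a) (s $ a) \<le> root (\<sigma> a) (\<rho> ^ \<sigma> a)"
          by (rule real_root_le_mono[OF weight_pos sa(2)])
        also have "\<dots> = \<rho>" using that(1) weight_pos[of a] by (intro real_root_power_cancel) auto
        finally show ?thesis .
      qed
      ultimately have "ctrl \<kappa>' \<rho> b' (D (s $ a))"
        using ctrl_mono D(1) sa weight_pos[of a] by (metis order_refl real_root_pos_pos_le)
      from ctrl_compose[OF this k1(1) k1(3,2)] show ?thesis .
    qed
    have 3: "D (s $ a) (\<Psi> s y) $ i - (if i \<in> insert a A then s $ i else 0) =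
        D (s' $ a) (\<Psi> s' y) $ i - (if i \<in> insert a A then s' $ i else 0)"
      if s: "\<forall>l. 0 \<le> s $ l \<and> 0 \<le> s' $ l" and e: "\<forall>l. \<sigma> l < \<sigma> i \<longrightarrow> s $ l = s' $ l" for i s s' y
    proof -
      have IH: "\<Psi> s y $ k - (if k \<in> A then s $ k else 0) = \<Psi> s' y $ k - (if k \<in> A then s' $ k else 0)"
        if "\<sigma> k \<le> \<sigma> i" for k
      proof -
        have "\<forall>l. \<sigma> l < \<sigma> k \<longrightarrow> s $ l = s' $ l" using e that by simp
        then show ?thesis using P s unfolding P_def by blast
      qed
      \<comment> \<open>The new move fixes coordinates lighter than \<open>a\<close>, and in the
        layer of \<open>a\<close> it adds \<open>s $ a\<close> to coordinate \<open>a\<close> alone.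
        On a heavier coordinate its increment is determined by \<open>s $ a\<close> and lighter
        coordinates of \<open>\<Psi> s y\<close>, all of which coincide for \<open>s\<close> and
        \<open>s'\<close>.\<close>
      consider "\<sigma> i < \<sigma> a" | "\<sigma> i = \<sigma> a" | "\<sigma> a < \<sigma> i" by linarith
      then show ?thesis
      proof cases
        case 1
        then show ?thesis using D(5)[of "s $ a" i "\<Psi> s y"] D(5)[of "s' $ a" i "\<Psi> s' y"] s IH[of i] by auto
      next
        case 2
        then show ?thesis using D(5)[of "s $ a" i "\<Psi> s y"] D(5)[of "s' $ a" i "\<Psi> s' y"] s IH[of i] insert.hyps(2)
          by (auto simp: axis_def)
      next
        case 3
        have "\<forall>l. \<sigma> l < \<sigma> i \<longrightarrow> \<Psi> s y $ l = \<Psi> s' y $ l"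
        proof (intro allI impI)
          fix l assume l: "\<sigma> l < \<sigma> i"
          then have "s $ l = s' $ l" using e by blast
          then show "\<Psi> s y $ l = \<Psi> s' y $ l" using IH[of l] l by (simp split: if_splits)
        qed
        then have "D (s $ a) (\<Psi> s y) $ i - \<Psi> s y $ i = D (s $ a) (\<Psi> s' y) $ i - \<Psi> s' y $ i"
          using D(3) unfolding triangular_def by blast
        moreover have "s $ a = s' $ a" "i \<noteq> a" using 3 e by auto
        ultimately show ?thesis using IH[of i] by auto
      qed
    qed
    have "P (insert a A) (2 * \<kappa>' + 2 * \<kappa>) (\<lambda>R. b' (b R)) (\<lambda>s y. D (s $ a) (\<Psi> s y))"
    proof -
      have "0 \<le> 2 * \<kappa>' + 2 * \<kappa>" using P D(1) by (simp add: P_def)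
      then show ?thesis unfolding P_def using 1 2 3 by blast
    qed
    then show ?case by blast
  qed
  from this[OF finite[of UNIV]] obtain \<kappa> b \<Psi> where P: "P UNIV \<kappa> b \<Psi>" by blast
  have "\<exists>G. mpres G \<and> (\<forall>s. (\<forall>i. 0 \<le> s $ i) \<longrightarrow> G s = \<Psi> s y)" for y
  proof -
    \<comment> \<open>The moves are prescribed only for nonnegative parameters; clipping at 0 and
      adding back \<open>s - p s\<close> extends the map to all of space while keeping it
      triangular.\<close>
    define p where "p s = (\<chi> i. max 0 (s $ i))" for s :: "real ^ 'n"
    define G where "G s = \<Psi> (p s) y - p s + s" for s
    have cp: "continuous_on UNIV p" unfolding p_def by (intro continuous_on_vec_lambda continuous_intros)
    have c\<Psi>: "continuous_on UNIV (\<lambda>(s, y). \<Psi> s y)" using P by (simp add: P_def)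
    have "continuous_on UNIV (\<lambda>s. (\<lambda>(s, y). \<Psi> s y) (p s, y))"
      by (rule continuous_on_compose2[OF c\<Psi> continuous_on_Pair[OF cp continuous_on_const]]) simp
    then have "continuous_on UNIV (\<lambda>s. \<Psi> (p s) y)" by simp
    from continuous_on_add[OF continuous_on_diff[OF this cp] continuous_on_id]
    have "continuous_on UNIV G" unfolding G_def .
    moreover have "triangular G"
      unfolding triangular_def
    proof (intro allI impI)
      fix i and s s' :: "real ^ 'n" assume "\<forall>l. \<sigma> l < \<sigma> i \<longrightarrow> s $ l = s' $ l"
      then have "\<forall>l. \<sigma> l < \<sigma> i \<longrightarrow> p s $ l = p s' $ l" by (simp add: p_def)
      moreover have "\<forall>l. 0 \<le> p s $ l \<and> 0 \<le> p s' $ l" by (simp add: p_def)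
      ultimately have "\<Psi> (p s) y $ i - p s $ i = \<Psi> (p s') y $ i - p s' $ i" using P unfolding P_def by auto
      then show "G s $ i - s $ i = G s' $ i - s' $ i" by (simp add: G_def)
    qed
    ultimately have "mpres G" by (rule triangular_mpres)
    moreover have "G s = \<Psi> s y" if "\<forall>i. 0 \<le> s $ i" for s
    proof -
      have "p s = s" using that by (simp add: p_def vec_eq_iff max_def)
      then show ?thesis by (simp add: G_def)
    qed
    ultimately show ?thesis by blast
  qed
  then show ?thesis using P unfolding P_def by blast
qed

end

section \<open>Harmonicity of the fundamental solution\<close>


lemma mpres_distr:
  fixes G :: "'a::euclidean_space \<Rightarrow> 'a"
  assumes "mpres G" shows "distr lborel borel G = lborel"
proof (rule measure_eqI)
  note [measurable] = mpres_measurable[OF assms]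
  fix A assume "A \<in> sets (distr lborel borel G)"
  then have [measurable]: "A \<in> sets borel" by simp
  have "emeasure (distr lborel borel G) A = (\<integral>\<^sup>+x. indicator A x \<partial>distr lborel borel G)"
    by simp
  also have "\<dots> = (\<integral>\<^sup>+x. indicator A (G x) \<partial>lborel)"
    by (rule nn_integral_distr) auto
  also have "\<dots> = (\<integral>\<^sup>+x. indicator A x \<partial>lborel)"
    by (rule mpres_nn_integral[OF assms]) auto
  finally show "emeasure (distr lborel borel G) A = emeasure lborel A" by simp
qed simp

lemma mpres_integrable:
  fixes f :: "'a::euclidean_space \<Rightarrow> real"
  assumes "mpres G" "integrable lborel f" shows "integrable lborel (\<lambda>x. f (G x))"
    and "(LINT x|lborel. f (G x)) = (LINT x|lborel. f x)"
proof -
  note [measurable] = mpres_measurable[OF assms(1)] borel_measurable_integrable[OF assms(2), simplified]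
  have "integrable (distr lborel borel G) f" using assms by (simp add: mpres_distr)
  then show "integrable lborel (\<lambda>x. f (G x))" by (subst (asm) integrable_distr_eq) auto
  have "(LINT x|distr lborel borel G. f x) = (LINT x|lborel. f (G x))" by (rule integral_distr) auto
  then show "(LINT x|lborel. f (G x)) = (LINT x|lborel. f x)" using assms by (simp add: mpres_distr)
qed

lemma integrable_continuous_bounded_support:
  fixes f :: "'a::euclidean_space \<Rightarrow> real"
  assumes "continuous_on UNIV f" "\<And>y. y \<notin> cball 0 R \<Longrightarrow> f y = 0"
  shows "integrable lborel f"
proof -
  have "integrable lborel (\<lambda>x. indicator (cball 0 R) x *\<^sub>R f x)"
    by (rule borel_integrable_compact) (auto intro: continuous_on_subset[OF assms(1)])
  moreover have "(\<lambda>x. indicator (cball 0 R) x *\<^sub>R f x) = f"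
    using assms(2) by (auto simp: fun_eq_iff indicator_def)
  ultimately show ?thesis by simp
qed

lemma vf_apply_eq_0_locally:
  assumes "open S" "x \<in> S" "\<And>y. y \<in> S \<Longrightarrow> f y = c" shows "vf_apply V f x = 0" "f differentiable (at x)"
proof -
  have "(f has_derivative (\<lambda>v. 0)) (at x)"
    by (rule has_derivative_transform_within_open[OF has_derivative_const[of c] assms(1,2)]) (simp add: assms(3))
  then show "vf_apply V f x = 0" "f differentiable (at x)"
    by (auto simp: vf_apply_def frechet_derivative_eqI differentiable_def)
qed

lemma vf_apply_cong_open:
  assumes "open S" "x \<in> S" "\<And>y. y \<in> S \<Longrightarrow> f y = g y" "f differentiable (at x)"
  shows "vf_apply V g x = vf_apply V f x" "g differentiable (at x)"
proof -
  have "(g has_derivative frechet_derivative f (at x)) (at x)"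
    by (rule has_derivative_transform_within_open[OF assms(4)[unfolded frechet_derivative_works] assms(1,2)]) (simp add: assms(3))
  then show "vf_apply V g x = vf_apply V f x" "g differentiable (at x)"
    by (auto simp: vf_apply_def frechet_derivative_eqI differentiable_def)
qed

lemma vf_apply_chain:
  assumes "g differentiable (at x)" "(h has_real_derivative d) (at (g x))"
  shows "vf_apply V (\<lambda>x. h (g x)) x = d * vf_apply V g x" "(\<lambda>x. h (g x)) differentiable (at x)"
proof -
  have "((\<lambda>x. h (g x)) has_derivative (\<lambda>v. d * frechet_derivative g (at x) v)) (at x)"
    using diff_chain_at[OF assms(1)[unfolded frechet_derivative_works]
        has_field_derivative_imp_has_derivative[OF assms(2)]] by (simp add: o_def)
  then show "vf_apply V (\<lambda>x. h (g x)) x = d * vf_apply V g x" "(\<lambda>x. h (g x)) differentiable (at x)"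
    by (auto simp: vf_apply_def frechet_derivative_eqI differentiable_def)
qed

lemma Ck_on_Un: "Ck_on k S f \<Longrightarrow> Ck_on k T f \<Longrightarrow> open S \<Longrightarrow> open T \<Longrightarrow> Ck_on k (S \<union> T) f"
  by (induction k arbitrary: f) (auto intro: continuous_on_open_Un)

lemma smooth_on_mult_cutoff:
  fixes f g :: "'a::euclidean_space \<Rightarrow> real"
  assumes f: "smooth_on (- {c}) f" and g: "smooth_on UNIV g" and "dist z c > r"
    and z: "\<And>y. dist y z \<ge> r \<Longrightarrow> g y = 0"
  shows "smooth_on UNIV (\<lambda>y. f y * g y)"
proof -
  have "smooth_on (- {c}) (\<lambda>y. f y * g y)"
    by (intro smooth_on_mult f smooth_on_subset[OF g]) auto
  moreover have "smooth_on (- cball z r) (\<lambda>y. f y * g y)"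
    by (rule smooth_on_cong[of _ "\<lambda>y. 0"]) (auto simp: z dist_commute)
  ultimately have "smooth_on (- {c} \<union> - cball z r) (\<lambda>y. f y * g y)"
    unfolding smooth_on_def by (auto intro!: Ck_on_Un)
  moreover have "- {c} \<union> - cball z r = UNIV" using assms(3) by auto
  ultimately show ?thesis by simp
qed

context weights
begin

text \<open>A field of weight 1 has a measure-preserving flow, which serves as the divergence
  theorem: the integral of \<open>F (flow Y 1 y) - F y\<close> is 0, and it is also the time
  integral over [0, 1] of the integrals of the Y-derivative along the flow, all of them
  equal.\<close>

lemma integral_vf_apply_zero:
  assumes Y: "hom_vf 1 Y" and d: "\<And>x. F differentiable (at x)" and c: "continuous_on UNIV (vf_apply Y F)"
    and supp: "\<And>y. y \<notin> cball 0 R \<Longrightarrow> F y = 0"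
  shows "integrable lborel (vf_apply Y F)" "(LINT y|lborel. vf_apply Y F y) = 0"
proof -
  define w where "w = vf_apply Y F"
  have w0: "w y = 0" if "y \<notin> cball 0 R" for y
    unfolding w_def by (rule vf_apply_eq_0_locally[of "- cball 0 R"]) (use that supp in auto)
  have cw: "continuous_on UNIV w" using c by (simp add: w_def)
  have iw: "integrable lborel w" by (rule integrable_continuous_bounded_support[OF cw w0])
  then show "integrable lborel (vf_apply Y F)" by (simp add: w_def)
  have cF: "continuous_on UNIV F"
    using d by (auto intro!: continuous_at_imp_continuous_on differentiable_imp_continuous_within)
  have iF: "integrable lborel F" by (rule integrable_continuous_bounded_support[OF cF supp])
  have cfl: "continuous_on UNIV (\<lambda>p. w ((\<lambda>(t, y). flow Y t y) p))"
    by (rule continuous_on_compose2[OF cw continuous_on_flow[OF Y]]) simp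
  define k where "k s y = w (flow Y s y) * indicator {0..1::real} s" for s y
  have km: "case_prod k \<in> borel_measurable (lborel \<Otimes>\<^sub>M lborel)"
  proof -
    have "(\<lambda>p. w ((\<lambda>(t, y). flow Y t y) p)) \<in> borel_measurable borel"
      by (rule borel_measurable_continuous_onI[OF cfl])
    then have "(\<lambda>p. w ((\<lambda>(t, y). flow Y t y) p)) \<in> borel_measurable (borel \<Otimes>\<^sub>M borel)"
      by (simp add: borel_prod)
    then show ?thesis unfolding k_def case_prod_beta by measurable
  qed
  have i1: "integrable lborel (\<lambda>y. k s y)" "(LINT y|lborel. k s y) = (LINT y|lborel. w y) * indicator {0..1} s" for s
    unfolding k_def using mpres_integrable[OF flow_mpres[OF Y] iw, of s] by auto
  have i2: "(LINT y|lborel. norm (k s y)) = (LINT y|lborel. norm (w y)) * indicator {0..1} s" for s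
  proof -
    have "norm (k s y) = norm (w (flow Y s y)) * indicator {0..1} s" for y
      by (simp add: k_def indicator_def)
    then show ?thesis
      using mpres_integrable(2)[OF flow_mpres[OF Y] integrable_norm[OF iw], of s] by simp
  qed
  have "integrable (lborel \<Otimes>\<^sub>M lborel) (case_prod k)"
  proof (rule lborel_pair.Fubini_integrable[OF km])
    show "integrable lborel (\<lambda>s. LINT y|lborel. norm (case_prod k (s, y)))"
      using i2 by simp
  qed (simp add: i1)
  from lborel_pair.Fubini_integral[OF this]
  have sw: "(LINT y|lborel. (LINT s|lborel. k s y)) = (LINT s|lborel. (LINT y|lborel. k s y))" .
  have "(LINT s|lborel. k s y) = F (flow Y 1 y) - F y" for y
  proof -
    have "has_bochner_integral lborel (\<lambda>s. w (flow Y s y) * indicator {0..1} s) (F (flow Y 1 y) - F (flow Y 0 y))"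
    proof (rule has_bochner_integral_FTC_Icc_real)
      fix s
      show "((\<lambda>s. F (flow Y s y)) has_real_derivative w (flow Y s y)) (at s)"
        unfolding w_def by (rule flow_compose_DERIV[OF Y d])
      have "continuous_on UNIV (\<lambda>s. w ((\<lambda>(t, y). flow Y t y) (s, y)))"
        by (rule continuous_on_compose2[OF cfl]) (auto intro!: continuous_intros)
      then show "isCont (\<lambda>s. w (flow Y s y)) s" by (simp add: continuous_on_eq_continuous_at)
    qed simp
    then show ?thesis by (simp add: has_bochner_integral_integral_eq k_def)
  qed
  then have "(LINT y|lborel. F (flow Y 1 y) - F y) = (LINT y|lborel. w y)"
    using sw by (simp add: i1)
  moreover have "(LINT y|lborel. F (flow Y 1 y) - F y) = 0"
    using mpres_integrable[OF flow_mpres[OF Y] iF, of 1] iF by simp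
  ultimately show "(LINT y|lborel. vf_apply Y F y) = 0" by (simp add: w_def)
qed

end

section \<open>The fundamental solution away from its pole\<close>

locale fundamental = hoermander_flows \<sigma> m X for \<sigma> :: "'n::finite \<Rightarrow> nat" and m and X +
  fixes \<Gamma> :: "real ^ 'n \<Rightarrow> real ^ 'n \<Rightarrow> real"
  assumes fundamental: "fundamental_solution \<sigma> m X \<Gamma>"
begin

lemma \<Gamma>_pos: "x \<noteq> y \<Longrightarrow> \<Gamma> x y > 0"
  and \<Gamma>_smooth2: "smooth_on {(x, y). x \<noteq> y} (\<lambda>(x, y). \<Gamma> x y)"
  and \<Gamma>_test: "test_function \<phi> \<Longrightarrow> (LINT y|lborel. \<Gamma> x y * sum_of_squares_op m X \<phi> y) = - \<phi> x"
  and \<Gamma>_pole: "filterlim (\<Gamma> x) at_top (at x)"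
  and \<Gamma>_infinity: "(\<Gamma> x \<longlongrightarrow> 0) at_infinity"
  and \<Gamma>_dil: "x \<noteq> y \<Longrightarrow> l > 0 \<Longrightarrow> \<Gamma> (dil \<sigma> l x) (dil \<sigma> l y) = l powr (2 - real (\<Sum>i\<in>UNIV. \<sigma> i)) * \<Gamma> x y"
  using fundamental unfolding fundamental_solution_def by blast+

lemma open_offdiag: "open {(x, y). (x :: real ^ 'n) \<noteq> y}"
proof -
  have "open {p :: (real ^ 'n) \<times> (real ^ 'n). fst p \<noteq> snd p}" by (intro open_Collect_neq continuous_intros)
  moreover have "{p :: (real ^ 'n) \<times> (real ^ 'n). fst p \<noteq> snd p} = {(x, y). x \<noteq> y}" by auto
  ultimately show ?thesis by simp
qed

lemma X_smooth: "j \<in> {1..m} \<Longrightarrow> smooth_on UNIV (X j)"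
  using hom_X by (simp add: hom_vf_def)

lemma \<Gamma>_smooth: "smooth_on (- {c}) (\<Gamma> c)"
  unfolding smooth_on_def
proof
  fix k
  have "Ck_on k (- {c}) (\<lambda>y. (\<lambda>(x, y). \<Gamma> x y) (c, y))"
    by (rule Ck_on_section[OF smooth_onD[OF \<Gamma>_smooth2] open_offdiag]) auto
  then show "Ck_on k (- {c}) (\<Gamma> c)" by simp
qed

lemma \<Gamma>_continuous2: "continuous_on {(x, y). x \<noteq> y} (\<lambda>(x, y). \<Gamma> x y)"
  using \<Gamma>_smooth2 by (rule smooth_on_continuous)

text \<open>Continuity jointly in the pole and the point is what later gives bounds uniform over
  compact sets of poles.\<close>

lemma X\<Gamma>_continuous2:
  assumes "j \<in> {1..m}"
  shows "continuous_on {(x, y). x \<noteq> y} (\<lambda>(x, y). vf_apply (X j) (\<Gamma> x) y)"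
proof -
  let ?F = "\<lambda>(x, y). \<Gamma> x y"
  have d: "vf_apply (X j) (\<Gamma> x) y = (\<Sum>i\<in>UNIV. X j y $ i * frechet_derivative ?F (at (x, y)) (0, axis i 1))"
    if "x \<noteq> y" for x y
  proof -
    have "((\<lambda>y. (x, y)) has_derivative (\<lambda>v. (0, v))) (at y)" by (auto intro!: derivative_eq_intros)
    from diff_chain_at[OF this smooth_on_has_derivative[OF \<Gamma>_smooth2]] that
    have "(\<Gamma> x has_derivative (\<lambda>v. frechet_derivative ?F (at (x, y)) (0, v))) (at y)" by (simp add: o_def)
    then have p: "frechet_derivative (\<Gamma> x) (at y) v = frechet_derivative ?F (at (x, y)) (0, v)" for v
      by (rule frechet_derivative_eqI)
    have "\<Gamma> x differentiable (at y)" using smooth_on_differentiable[OF \<Gamma>_smooth] that by auto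
    then show ?thesis by (simp add: vf_apply_sum_partial partial_def p)
  qed
  have "continuous_on {(x, y). x \<noteq> y} (\<lambda>p. \<Sum>i\<in>UNIV. X j (snd p) $ i * frechet_derivative ?F (at p) (0, axis i 1))"
  proof (intro continuous_on_sum continuous_on_mult)
    fix i
    show "continuous_on {(x, y). x \<noteq> y} (\<lambda>p. frechet_derivative ?F (at p) (0, axis i 1))"
      by (rule smooth_on_continuous[OF smooth_on_frechet[OF \<Gamma>_smooth2]])
    have "continuous_on UNIV (X j)" by (rule smooth_on_continuous[OF X_smooth[OF assms]])
    then have "continuous_on {(x, y). x \<noteq> y} (\<lambda>p. X j (snd p))"
      by (rule continuous_on_compose2) (auto intro: continuous_intros)
    then show "continuous_on {(x, y). x \<noteq> y} (\<lambda>p. X j (snd p) $ i)" by (intro continuous_intros)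
  qed
  then show ?thesis by (rule continuous_on_eq) (auto simp: d)
qed

lemma X\<Gamma>_smooth: "j \<in> {1..m} \<Longrightarrow> smooth_on (- {c}) (vf_apply (X j) (\<Gamma> c))"
  by (rule smooth_on_vf_apply) (auto intro: \<Gamma>_smooth smooth_on_subset[OF X_smooth])

lemma XX\<Gamma>_smooth: "j \<in> {1..m} \<Longrightarrow> smooth_on (- {c}) (vf_apply (X j) (vf_apply (X j) (\<Gamma> c)))"
  by (rule smooth_on_vf_apply) (auto intro: X\<Gamma>_smooth smooth_on_subset[OF X_smooth])

text \<open>Green's formula: \<open>\<Gamma> L b - (L \<Gamma>) b\<close> is a sum of X-derivatives
  of compactly supported functions and integrates to 0, while the integral of
  \<open>\<Gamma> L b\<close> is \<open>- b c = 0\<close>.\<close>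

lemma \<Gamma>_weakly_harmonic:
  assumes r: "r > 0" and zc: "dist z c > r"
  shows "integrable lborel (\<lambda>y. sum_of_squares_op m X (\<Gamma> c) y * bump z r y)"
    and "(LINT y|lborel. sum_of_squares_op m X (\<Gamma> c) y * bump z r y) = 0"
proof -
  define b where "b = bump z r"
  \<comment> \<open>The bump vanishes on the open set off \<open>cball z r\<close>, and so do its
    derivatives; a slightly larger radius covers this set up to and including the boundary sphere
    and still avoids the pole.\<close>
  define r' where "r' = (r + dist z c) / 2"
  have r': "r < r'" "r' < dist z c" using zc by (auto simp: r'_def)
  define G where "G = \<Gamma> c"
  define L where "L f = sum_of_squares_op m X f" for f
  let ?S = "- cball z r"
  have S: "open ?S" "c \<in> ?S" using zc by auto
  have far: "y \<in> ?S" if "dist y z \<ge> r'" for y using that r' by (auto simp: dist_commute)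
  have b0: "b y = 0" if "y \<in> ?S" for y
    unfolding b_def using that by (intro bump_eq_0[OF r]) (auto simp: dist_commute)
  have Xb0: "vf_apply V b y = 0" if "y \<in> ?S" for V y
    by (rule vf_apply_eq_0_locally[OF S(1) that b0])
  have XXb0: "vf_apply V (vf_apply V b) y = 0" if "y \<in> ?S" for V y
    by (rule vf_apply_eq_0_locally[OF S(1) that Xb0])
  have Lb0: "L b y = 0" if "y \<in> ?S" for y using XXb0[OF that] by (simp add: L_def sum_of_squares_op_def)
  have sb: "smooth_on UNIV b" unfolding b_def by (rule smooth_bump)
  have sXb: "smooth_on UNIV (vf_apply (X j) b)" if "j \<in> {1..m}" for j
    by (rule smooth_on_vf_apply[OF open_UNIV X_smooth[OF that] sb])
  have sXXb: "smooth_on UNIV (vf_apply (X j) (vf_apply (X j) b))" if "j \<in> {1..m}" for j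
    by (rule smooth_on_vf_apply[OF open_UNIV X_smooth[OF that] sXb[OF that]])
  have sLb: "smooth_on UNIV (L b)"
    unfolding L_def sum_of_squares_op_def[abs_def] by (intro smooth_on_sum sXXb) auto
  have sG: "smooth_on (- {c}) G" unfolding G_def by (rule \<Gamma>_smooth)
  have sXG: "smooth_on (- {c}) (vf_apply (X j) G)" if "j \<in> {1..m}" for j
    unfolding G_def by (rule X\<Gamma>_smooth[OF that])
  have sXXG: "smooth_on (- {c}) (vf_apply (X j) (vf_apply (X j) G))" if "j \<in> {1..m}" for j
    unfolding G_def by (rule XX\<Gamma>_smooth[OF that])
  have sLG: "smooth_on (- {c}) (L G)"
    unfolding L_def sum_of_squares_op_def[abs_def] by (intro smooth_on_sum sXXG) auto
  define R where "R = norm z + r'"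
  have R: "dist y z \<ge> r'" if "y \<notin> cball 0 R" for y
    using that norm_triangle_sub[of y z] by (simp add: R_def dist_norm)
  have int: "integrable lborel (\<lambda>y. f y * g y)"
    if "smooth_on (- {c}) f" "smooth_on UNIV g" "\<And>y. y \<in> ?S \<Longrightarrow> g y = 0" for f g :: "real ^ 'n \<Rightarrow> real"
    by (rule integrable_continuous_bounded_support[where R=R])
       (use that far R in \<open>auto intro!: smooth_on_continuous smooth_on_mult_cutoff[OF that(1,2) r'(2)]\<close>)
  have i1: "integrable lborel (\<lambda>y. L G y * b y)" by (rule int[OF sLG sb b0])
  then show "integrable lborel (\<lambda>y. sum_of_squares_op m X (\<Gamma> c) y * bump z r y)"
    by (simp add: L_def G_def b_def)
  have i2: "integrable lborel (\<lambda>y. G y * L b y)" by (rule int[OF sG sLb Lb0])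
  define F1 where "F1 j y = G y * vf_apply (X j) b y" for j y
  define F2 where "F2 j y = vf_apply (X j) G y * b y" for j y
  have sF: "smooth_on UNIV (F1 j)" "smooth_on UNIV (F2 j)" if "j \<in> {1..m}" for j
    unfolding F1_def F2_def
    by (rule smooth_on_mult_cutoff[OF sG sXb[OF that] r'(2)] smooth_on_mult_cutoff[OF sXG[OF that] sb r'(2)];
        use far Xb0 b0 in blast)+
  have F0: "F1 j y = 0" "F2 j y = 0" if "y \<in> ?S" for j y using that by (simp_all add: F1_def F2_def b0 Xb0)
  have XF: "integrable lborel (vf_apply (X j) F)" "(LINT y|lborel. vf_apply (X j) F y) = 0"
    if j: "j \<in> {1..m}" and F: "F = F1 j \<or> F = F2 j" for j F
  proof -
    have s: "smooth_on UNIV F" using sF[OF j] F by auto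
    have d: "F differentiable (at x)" for x using s smooth_on_differentiable by blast
    have "continuous_on UNIV (vf_apply (X j) F)"
      by (rule smooth_on_continuous[OF smooth_on_vf_apply[OF open_UNIV X_smooth[OF j] s]])
    moreover have "F y = 0" if "y \<notin> cball 0 R" for y using F F0[OF far[OF R[OF that]]] by auto
    ultimately show "integrable lborel (vf_apply (X j) F)" "(LINT y|lborel. vf_apply (X j) F y) = 0"
      using integral_vf_apply_zero[OF hom_X[OF j] d] by blast+
  qed
  have eq: "G y * L b y - L G y * b y = (\<Sum>j=1..m. vf_apply (X j) (F1 j) y - vf_apply (X j) (F2 j) y)" for y
  proof (cases "y = c")
    case True
    have "vf_apply V (F1 j) c = 0" "vf_apply V (F2 j) c = 0" for V j
      using vf_apply_eq_0_locally[OF S F0(1)] vf_apply_eq_0_locally[OF S F0(2)] by auto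
    then show ?thesis using True b0[OF S(2)] Lb0[OF S(2)] by simp
  next
    case False
    then have y: "y \<in> - {c}" by simp
    have "vf_apply (X j) (F1 j) y - vf_apply (X j) (F2 j) y =
        G y * vf_apply (X j) (vf_apply (X j) b) y - vf_apply (X j) (vf_apply (X j) G) y * b y" if j: "j \<in> {1..m}" for j
      unfolding F1_def[abs_def] F2_def[abs_def]
      by (simp add: vf_apply_mult smooth_on_differentiable[OF sG y] smooth_on_differentiable[OF sb]
          smooth_on_differentiable[OF sXb[OF j]] smooth_on_differentiable[OF sXG[OF j] y])
    then show ?thesis by (simp add: L_def sum_of_squares_op_def sum_distrib_left sum_distrib_right sum_subtractf)
  qed
  have "(LINT y|lborel. G y * L b y - L G y * b y) = 0"
    unfolding eq by (simp add: XF)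
  moreover have "(LINT y|lborel. G y * L b y) = - b c"
    using \<Gamma>_test[OF bump_test_function[OF r], where x=c] by (simp add: G_def L_def b_def)
  moreover have "b c = 0" by (rule b0[OF S(2)])
  ultimately show "(LINT y|lborel. sum_of_squares_op m X (\<Gamma> c) y * bump z r y) = 0"
    using i1 i2 by (simp add: G_def L_def b_def)
qed

text \<open>If the continuous function \<open>L \<Gamma>\<close> were nonzero at \<open>y\<close>,
  it would keep its sign on a ball, and its integral against a bump there could not vanish.\<close>

lemma \<Gamma>_harmonic:
  assumes "y \<noteq> c" shows "sum_of_squares_op m X (\<Gamma> c) y = 0"
proof (rule ccontr)
  let ?L = "sum_of_squares_op m X (\<Gamma> c)"
  assume "?L y \<noteq> 0"
  define \<epsilon> where "\<epsilon> = sgn (?L y)"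
  have pos: "\<epsilon> * ?L y > 0" using \<open>?L y \<noteq> 0\<close> by (simp add: \<epsilon>_def sgn_if)
  have "continuous_on (- {c}) ?L"
    unfolding sum_of_squares_op_def[abs_def]
    by (intro continuous_on_sum smooth_on_continuous[OF XX\<Gamma>_smooth])
  then have "continuous_on (- {c}) (\<lambda>y. \<epsilon> * ?L y)" by (intro continuous_intros)
  then have "open ((\<lambda>y. \<epsilon> * ?L y) -` {0<..} \<inter> - {c})"
    by (subst Int_commute, intro continuous_open_preimage) auto
  moreover have "y \<in> (\<lambda>y. \<epsilon> * ?L y) -` {0<..} \<inter> - {c}" using pos assms by auto
  ultimately obtain e where e: "e > 0" "ball y e \<subseteq> (\<lambda>y. \<epsilon> * ?L y) -` {0<..} \<inter> - {c}"
    using open_contains_ball by blast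
  define r where "r = e / 2"
  have r: "r > 0" "r < e" using e by (auto simp: r_def)
  have "\<not> dist c y < e" using e(2) by (metis ComplD IntD2 dist_commute insertI1 mem_ball subsetD)
  then have zc: "dist y c > r" using r by (simp add: dist_commute)
  let ?f = "\<lambda>x. \<epsilon> * (?L x * bump y r x)"
  have i: "integrable lborel ?f" using \<Gamma>_weakly_harmonic(1)[OF r(1) zc] by simp
  have p: "?f x > 0" if "x \<in> ball y r" for x
  proof -
    have "x \<in> ball y e" using that r by simp
    with e(2) have "x \<in> (\<lambda>y. \<epsilon> * ?L y) -` {0<..}" by blast
    then have "\<epsilon> * ?L x > 0" by simp
    moreover have "bump y r x > 0" using that bump_pos_iff[OF r(1), of y x] by (simp add: dist_commute[of x y])
    ultimately show ?thesis by (simp add: mult.assoc[symmetric])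
  qed
  have n: "?f x \<ge> 0" for x
  proof (cases "x \<in> ball y r")
    case False
    then have "bump y r x = 0" by (intro bump_eq_0[OF r(1)]) (auto simp: dist_commute)
    then show ?thesis by simp
  qed (use p less_imp_le in blast)
  have "(LINT x|lborel. ?f x) = 0" using \<Gamma>_weakly_harmonic[OF r(1) zc] by simp
  then have "AE x in lborel. ?f x = 0" using integral_nonneg_eq_0_iff_AE[OF i] n by simp
  then have "AE x in lborel. x \<notin> ball y r"
  proof eventually_elim
    case (elim x)
    then show ?case using p[of x] by auto
  qed
  then have "emeasure lborel (ball y r) = 0"
    using AE_iff_measurable[of "ball y r" lborel "\<lambda>x. x \<notin> ball y r"] by (simp add: ball_def)
  moreover have "unit_ball_vol (real CARD('n)) * r ^ CARD('n) > 0" using r(1) by simp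
  ultimately show False using r(1) by (simp add: emeasure_ball ennreal_eq_0_iff)
qed

end

section \<open>Energy of truncations\<close>


lemma DERIV_pos_part_power:
  "((\<lambda>x::real. (max 0 x) ^ Suc (Suc n)) has_real_derivative real (n + 2) * (max 0 x) ^ Suc n) (at x)"
proof -
  consider "x > 0" | "x < 0" | "x = 0" by linarith
  then show ?thesis
  proof cases
    case 1
    have "((\<lambda>x::real. x ^ Suc (Suc n)) has_real_derivative real (n + 2) * (max 0 x) ^ Suc n) (at x)"
      using 1 DERIV_pow[of "Suc (Suc n)" x] by (simp add: max_def)
    then show ?thesis
      by (rule has_field_derivative_transform_within_open[where S="{0<..}"]) (use 1 in auto)
  next
    case 2
    have "((\<lambda>x::real. 0) has_real_derivative real (n + 2) * (max 0 x) ^ Suc n) (at x)"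
      using 2 by (auto intro!: derivative_eq_intros)
    then show ?thesis
      by (rule has_field_derivative_transform_within_open[where S="{..<0}"]) (use 2 in auto)
  next
    case 3
    have "((\<lambda>h::real. (max 0 h) ^ Suc n) \<longlongrightarrow> (max 0 0) ^ Suc n) (at 0)"
      by (intro tendsto_intros)
    then have "((\<lambda>h::real. ((max 0 (0 + h)) ^ Suc (Suc n) - (max 0 0) ^ Suc (Suc n)) / h) \<longlongrightarrow> 0) (at 0)"
      by (rule_tac Lim_transform_eventually) (auto simp: eventually_at_filter max_def)
    then show ?thesis using 3 by (simp add: DERIV_def)
  qed
qed

lemma continuous_on_glue:
  assumes "\<delta> > 0" "\<And>y. y \<in> ball c \<delta> \<Longrightarrow> f y = k" "continuous_on (- {c}) f"
  shows "continuous_on UNIV f"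
proof -
  have "continuous_on (ball c \<delta>) f" by (rule continuous_on_eq[of _ "\<lambda>y. k"]) (auto simp: assms(2))
  then have "continuous_on (ball c \<delta> \<union> - {c}) f" by (intro continuous_on_open_Un assms(3)) auto
  moreover have "ball c \<delta> \<union> - {c} = UNIV" using assms(1) by auto
  ultimately show ?thesis by simp
qed

lemma vf_apply_glue:
  assumes "\<delta> > 0" "\<And>y. y \<in> ball c \<delta> \<Longrightarrow> f y = k" "\<And>y. y \<noteq> c \<Longrightarrow> f differentiable (at y)"
  shows "f differentiable (at y)" "vf_apply V f c = 0"
    "continuous_on (- {c}) (vf_apply V f) \<Longrightarrow> continuous_on UNIV (vf_apply V f)"
proof -
  have 0: "vf_apply V f y = 0" "f differentiable (at y)" if "y \<in> ball c \<delta>" for y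
    by (rule vf_apply_eq_0_locally[OF open_ball that], rule assms(2), assumption)+
  then show "f differentiable (at y)" "vf_apply V f c = 0"
    using assms(1,3) by (cases "y = c"; auto)+
  assume "continuous_on (- {c}) (vf_apply V f)"
  then show "continuous_on UNIV (vf_apply V f)"
    by (rule continuous_on_glue[OF assms(1), rotated]) (rule 0(1))
qed

section \<open>Cutoffs, truncations and the energy bound\<close>

context fundamental
begin

text \<open>An explicit C1 cutoff, 1 on the ball of radius \<open>R\<close> and 0 beyond
  \<open>R + 1\<close>, because there \<open>y \<bullet> y - R\<^sup>2\<close> is at least
  \<open>2 * R + 1\<close>. Squares of positive parts keep it C1.\<close>

definition cutoff :: "real \<Rightarrow> real ^ 'n \<Rightarrow> real" where
  "cutoff R y = (max 0 (1 - (max 0 (y \<bullet> y - R\<^sup>2))\<^sup>2))\<^sup>2"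

definition cutoff_grad :: "real \<Rightarrow> nat \<Rightarrow> real ^ 'n \<Rightarrow> real" where
  "cutoff_grad R j y = - 4 * max 0 (1 - (max 0 (y \<bullet> y - R\<^sup>2))\<^sup>2) * max 0 (y \<bullet> y - R\<^sup>2) * vf_apply (X j) (\<lambda>y. y \<bullet> y - R\<^sup>2) y"

lemma smooth_norm_square: "smooth_on UNIV (\<lambda>y::real ^ 'n. y \<bullet> y - R\<^sup>2)"
proof -
  have "(\<lambda>y::real ^ 'n. y \<bullet> y - R\<^sup>2) = (\<lambda>y. (\<Sum>i\<in>UNIV. y $ i * y $ i) + - R\<^sup>2)"
    by (simp add: inner_vec_def)
  moreover have "smooth_on UNIV \<dots>"
    by (intro smooth_on_add smooth_on_sum smooth_on_mult smooth_on_coord smooth_on_const) auto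
  ultimately show ?thesis by simp
qed

lemma cutoff_derivative:
  "cutoff R differentiable (at y)" "vf_apply (X j) (cutoff R) y = cutoff_grad R j y"
proof -
  let ?q = "\<lambda>y::real ^ 'n. y \<bullet> y - R\<^sup>2"
  have q: "?q differentiable (at y)" by (rule smooth_on_differentiable[OF smooth_norm_square UNIV_I])
  have D2: "((\<lambda>x::real. (max 0 x)\<^sup>2) has_real_derivative 2 * max 0 x) (at x)" for x
    using DERIV_pos_part_power[of 0 x] by (simp add: numeral_2_eq_2)
  have p: "(\<lambda>y. (max 0 (?q y))\<^sup>2) differentiable (at y)"
    "vf_apply V (\<lambda>y. (max 0 (?q y))\<^sup>2) y = 2 * max 0 (?q y) * vf_apply V ?q y" for V
    using vf_apply_chain[OF q D2] by auto
  have D3: "((\<lambda>x::real. (max 0 (1 - x))\<^sup>2) has_real_derivative - 2 * max 0 (1 - x)) (at x)" for x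
  proof -
    have "((\<lambda>x::real. 1 - x) has_real_derivative -1) (at x)" by (auto intro!: derivative_eq_intros)
    from DERIV_chain2[OF D2 this] show ?thesis by simp
  qed
  show "cutoff R differentiable (at y)" "vf_apply (X j) (cutoff R) y = cutoff_grad R j y"
    unfolding cutoff_def[abs_def] cutoff_grad_def
    using vf_apply_chain[OF p(1) D3] by (auto simp: p(2))
qed

lemma continuous_cutoff: "continuous_on UNIV (cutoff R)"
  unfolding cutoff_def[abs_def] by (intro continuous_intros)

lemma continuous_cutoff_grad: "j \<in> {1..m} \<Longrightarrow> continuous_on UNIV (cutoff_grad R j)"
  unfolding cutoff_grad_def[abs_def]
  by (intro continuous_intros smooth_on_continuous smooth_on_vf_apply X_smooth smooth_norm_square) auto

lemma cutoff_nonneg: "cutoff R y \<ge> 0"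
  by (simp add: cutoff_def)

lemma cutoff_values:
  assumes "R \<ge> 0"
  shows "norm y \<le> R \<Longrightarrow> cutoff R y = 1" "norm y \<ge> R + 1 \<Longrightarrow> cutoff R y = 0"
    "norm y \<le> R \<or> norm y \<ge> R + 1 \<Longrightarrow> cutoff_grad R j y = 0"
proof -
  have 1: "max 0 (y \<bullet> y - R\<^sup>2) = 0" if "norm y \<le> R"
    using power_mono[OF that, of 2] by (simp add: dot_square_norm)
  have 2: "max 0 (1 - (max 0 (y \<bullet> y - R\<^sup>2))\<^sup>2) = 0" if "norm y \<ge> R + 1"
  proof -
    have "(R + 1)\<^sup>2 \<le> (norm y)\<^sup>2" using that assms by (intro power_mono) auto
    then have "1 \<le> y \<bullet> y - R\<^sup>2" using assms by (simp add: dot_square_norm power2_sum)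
    then have "1 \<le> (max 0 (y \<bullet> y - R\<^sup>2))\<^sup>2" by (intro one_le_power) simp
    then show ?thesis by simp
  qed
  show "norm y \<le> R \<Longrightarrow> cutoff R y = 1" by (simp add: cutoff_def 1)
  show "norm y \<ge> R + 1 \<Longrightarrow> cutoff R y = 0" by (simp add: cutoff_def 2)
  show "norm y \<le> R \<or> norm y \<ge> R + 1 \<Longrightarrow> cutoff_grad R j y = 0"
    using 1 2 by (auto simp: cutoff_grad_def)
qed

text \<open>A C1 substitute for the minimum of \<Gamma> and \<open>t\<close>: the function of
  \<Gamma> that vanishes at 0 and has derivative \<open>max 0 (1 - s / t)\<close>. It has the
  constant value \<open>t / 2\<close> where \<Gamma> exceeds \<open>t\<close>, so it extends
  smoothly over the pole.\<close>

definition trunc :: "real ^ 'n \<Rightarrow> real \<Rightarrow> real ^ 'n \<Rightarrow> real" where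
  "trunc c t y = (if y = c then t / 2 else t / 2 * (1 - (max 0 (1 - \<Gamma> c y / t))\<^sup>2))"

lemma near_pole: "\<exists>\<delta>>0. \<forall>y\<in>ball c \<delta>. y \<noteq> c \<longrightarrow> \<Gamma> c y > t"
proof -
  have "\<forall>\<^sub>F y in at c. \<Gamma> c y > t" using \<Gamma>_pole[of c] by (simp add: filterlim_at_top_dense)
  then obtain \<delta> where "\<delta> > 0" "\<forall>y\<in>ball c \<delta>. y \<noteq> c \<longrightarrow> \<Gamma> c y > t"
    by (auto simp: eventually_at dist_commute)
  then show ?thesis by blast
qed

lemma \<Gamma>_differentiable: "y \<noteq> c \<Longrightarrow> \<Gamma> c differentiable (at y)"
  using smooth_on_differentiable[OF \<Gamma>_smooth] by simp

lemma trunc_derivative: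
  assumes "t > 0" "y \<noteq> c"
  shows "trunc c t differentiable (at y)"
    "vf_apply (X j) (trunc c t) y = max 0 (1 - \<Gamma> c y / t) * vf_apply (X j) (\<Gamma> c) y"
proof -
  have D: "((\<lambda>s::real. t / 2 * (1 - (max 0 (1 - s / t))\<^sup>2)) has_real_derivative max 0 (1 - s / t)) (at s)" for s
  proof -
    have 1: "((\<lambda>x::real. (max 0 x)\<^sup>2) has_real_derivative 2 * max 0 x) (at x)" for x
      using DERIV_pos_part_power[of 0 x] by (simp add: numeral_2_eq_2)
    have "((\<lambda>s::real. 1 - s / t) has_real_derivative - (1 / t)) (at s)"
      using assms(1) by (auto intro!: derivative_eq_intros)
    from DERIV_chain2[OF 1 this]
    have "((\<lambda>s::real. (max 0 (1 - s / t))\<^sup>2) has_real_derivative 2 * max 0 (1 - s / t) * - (1 / t)) (at s)" .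
    from DERIV_cmult[OF DERIV_diff[OF DERIV_const this], of "t / 2" 1]
    show ?thesis using assms(1) by (simp add: field_simps)
  qed
  note ch = vf_apply_chain[OF \<Gamma>_differentiable[OF assms(2)] D]
  show "trunc c t differentiable (at y)"
    by (rule vf_apply_cong_open(2)[OF _ _ _ ch(2), of "- {c}"]) (use assms in \<open>auto simp: trunc_def\<close>)
  show "vf_apply (X j) (trunc c t) y = max 0 (1 - \<Gamma> c y / t) * vf_apply (X j) (\<Gamma> c) y"
    unfolding ch(1)[symmetric]
    by (rule vf_apply_cong_open(1)[OF _ _ _ ch(2), of "- {c}"]) (use assms in \<open>auto simp: trunc_def\<close>)
qed

lemma trunc_near_pole:
  assumes "t > 0" shows "\<exists>\<delta>>0. \<forall>y\<in>ball c \<delta>. trunc c t y = t / 2 \<and> (y \<noteq> c \<longrightarrow> max 0 (1 - \<Gamma> c y / t) = 0)"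
proof -
  obtain \<delta> where d: "\<delta> > 0" "\<forall>y\<in>ball c \<delta>. y \<noteq> c \<longrightarrow> \<Gamma> c y > t" using near_pole by blast
  have "max 0 (1 - \<Gamma> c y / t) = 0" if "y \<in> ball c \<delta>" "y \<noteq> c" for y
  proof -
    have "\<Gamma> c y / t > 1" using d that assms by simp
    then show ?thesis by simp
  qed
  then show ?thesis using d(1) by (intro exI[of _ \<delta>]) (auto simp: trunc_def)
qed

lemma trunc_C1:
  assumes "t > 0"
  shows "horizontally_C1 (trunc c t)" "vf_apply (X j) (trunc c t) c = 0"
proof -
  obtain \<delta> where d: "\<delta> > 0" "\<And>y. y \<in> ball c \<delta> \<Longrightarrow> trunc c t y = t / 2" using trunc_near_pole[OF assms] by blast
  note g = vf_apply_glue[OF d trunc_derivative(1)[OF assms]]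
  show "vf_apply (X j) (trunc c t) c = 0" by (rule g(2))
  have "continuous_on UNIV (vf_apply (X j) (trunc c t))" if j: "j \<in> {1..m}" for j
  proof (rule g(3))
    have "continuous_on (- {c}) (\<lambda>y. max 0 (1 - \<Gamma> c y / t) * vf_apply (X j) (\<Gamma> c) y)"
      using assms by (intro continuous_intros smooth_on_continuous[OF \<Gamma>_smooth] smooth_on_continuous[OF X\<Gamma>_smooth[OF j]]) auto
    then show "continuous_on (- {c}) (vf_apply (X j) (trunc c t))"
      by (rule continuous_on_eq) (auto simp: trunc_derivative(2)[OF assms])
  qed
  then show "horizontally_C1 (trunc c t)" using g(1) by (simp add: horizontally_C1_def)
qed

text \<open>The gradient of the cutoff lives on the shell between \<open>R\<close> and
  \<open>R + 1\<close>, which stays away from all poles in \<open>cball 0 R0\<close>; compactness of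
  the set of pairs gives one bound.\<close>

lemma cutoff_gradient_bound:
  assumes "0 \<le> R0" "R0 < R"
  shows "\<exists>B\<ge>0. \<forall>c\<in>cball 0 R0. \<forall>y. y \<noteq> c \<longrightarrow>
     (\<Sum>j=1..m. \<bar>cutoff_grad R j y * vf_apply (X j) (\<Gamma> c) y\<bar>) \<le> B * indicator (cball 0 (R + 1)) y"
proof -
  define A where "A = cball 0 (R + 1) - ball (0 :: real ^ 'n) R"
  have "compact A" unfolding A_def by (intro compact_diff) auto
  then have cK: "compact (cball (0 :: real ^ 'n) R0 \<times> A)" by (intro compact_Times) auto
  have sub: "cball 0 R0 \<times> A \<subseteq> {(x, y). x \<noteq> y}" using assms by (auto simp: A_def)
  let ?k = "\<lambda>p. \<Sum>j=1..m. \<bar>cutoff_grad R j (snd p) * (\<lambda>(c, y). vf_apply (X j) (\<Gamma> c) y) p\<bar>"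
  have "continuous_on (cball 0 R0 \<times> A) ?k"
  proof (intro continuous_on_sum continuous_on_rabs continuous_on_mult)
    fix j assume j: "j \<in> {1..m}"
    show "continuous_on (cball 0 R0 \<times> A) (\<lambda>p. cutoff_grad R j (snd p))"
      by (rule continuous_on_compose2[OF continuous_cutoff_grad[OF j]]) (auto intro!: continuous_intros)
    show "continuous_on (cball 0 R0 \<times> A) (\<lambda>(c, y). vf_apply (X j) (\<Gamma> c) y)"
      by (rule continuous_on_subset[OF X\<Gamma>_continuous2[OF j] sub])
  qed
  from compact_imp_bounded[OF compact_continuous_image[OF this cK]]
  obtain B0 where B0: "\<And>z. z \<in> ?k ` (cball 0 R0 \<times> A) \<Longrightarrow> norm z \<le> B0" unfolding bounded_iff by blast
  have "(\<Sum>j=1..m. \<bar>cutoff_grad R j y * vf_apply (X j) (\<Gamma> c) y\<bar>) \<le> max B0 0 * indicator (cball 0 (R + 1)) y"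
    if c: "c \<in> cball 0 R0" for c y
  proof (cases "y \<in> A")
    case True
    then have "norm (?k (c, y)) \<le> B0" using c by (intro B0 imageI) auto
    moreover have "?k (c, y) \<le> norm (?k (c, y))" unfolding real_norm_def by (rule abs_ge_self)
    ultimately have "?k (c, y) \<le> B0" by linarith
    then show ?thesis using True by (auto simp: A_def)
  next
    case False
    then have "norm y \<le> R \<or> norm y \<ge> R + 1" by (auto simp: A_def)
    then have "cutoff_grad R j y = 0" for j using cutoff_values(3) assms by simp
    then show ?thesis by (simp add: indicator_def)
  qed
  then show ?thesis by (intro exI[of _ "max B0 0"]) auto
qed

text \<open>
  Testing \<open>L \<Gamma> = 0\<close> against \<open>cutoff * h(\<Gamma>)\<close> with \<open>h' = - (f')\<^sup>2\<close> turns the energy of the truncation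
  \<open>f(\<Gamma>)\<close> into a boundary term away from the pole.
\<close>

theorem truncation_energy:
  assumes "0 \<le> R0" "R0 < R"
  shows "\<exists>C\<ge>0. \<forall>c\<in>cball 0 R0. \<forall>t>0. energy_le (trunc c t) R (ennreal (C * t))"
proof -
  obtain B where B: "B \<ge> 0" "\<And>c y. c \<in> cball 0 R0 \<Longrightarrow> y \<noteq> c \<Longrightarrow>
     (\<Sum>j=1..m. \<bar>cutoff_grad R j y * vf_apply (X j) (\<Gamma> c) y\<bar>) \<le> B * indicator (cball 0 (R + 1)) y"
    using cutoff_gradient_bound[OF assms] by blast
  define vol where "vol = measure lborel (cball (0 :: real ^ 'n) (R + 1))"
  have R: "R \<ge> 0" using assms by simp
  have "energy_le (trunc c t) R (ennreal (B * vol / 3 * t))" if c: "c \<in> cball 0 R0" and t: "t > 0" for c t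
  proof -
    define a where "a y = max 0 (1 - \<Gamma> c y / t)" for y
    define g where "g j = vf_apply (X j) (\<Gamma> c)" for j
    \<comment> \<open>\<open>a\<close> is the derivative of the truncation as a function of
      \<Gamma>, and \<open>t / 3 * a ^ 3\<close> is the function \<open>h\<close> of \<Gamma> with
      derivative \<open>- a^2\<close>. \<open>F\<close> is the resulting field, \<open>e\<close> the
      cut-off energy density, and \<open>k\<close> the term where the cutoff is
      differentiated.\<close>
    define F where "F j y = (if y = c then 0 else cutoff R y * (t / 3 * a y ^ 3) * g j y)" for j y
    define k where "k y = (if y = c then 0 else \<Sum>j=1..m. cutoff_grad R j y * (t / 3 * a y ^ 3) * g j y)" for y
    define e where "e y = (if y = c then 0 else \<Sum>j=1..m. cutoff R y * (a y)\<^sup>2 * (g j y)\<^sup>2)" for y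
    obtain \<delta> where d: "\<delta> > 0" "\<And>y. y \<in> ball c \<delta> \<Longrightarrow> y \<noteq> c \<Longrightarrow> a y = 0"
      using trunc_near_pole[OF t, of c] unfolding a_def by blast
    have F0: "F j y = 0" if "y \<in> ball c \<delta>" for j y using d(2)[OF that] by (simp add: F_def)
    have k0: "k y = 0" if "y \<in> ball c \<delta>" for y using d(2)[OF that] by (simp add: k_def)
    have ca: "continuous_on (- {c}) a"
      unfolding a_def[abs_def] using t by (intro continuous_intros smooth_on_continuous[OF \<Gamma>_smooth]) auto
    have gs: "smooth_on (- {c}) (g j)" if "j \<in> {1..m}" for j unfolding g_def by (rule X\<Gamma>_smooth[OF that])
    have Xgs: "smooth_on (- {c}) (vf_apply (X j) (g j))" if "j \<in> {1..m}" for j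
      unfolding g_def by (rule XX\<Gamma>_smooth[OF that])
    have Da: "vf_apply (X j) (\<lambda>y. t / 3 * a y ^ 3) y = - (a y)\<^sup>2 * g j y" "(\<lambda>y. t / 3 * a y ^ 3) differentiable (at y)"
      if "y \<noteq> c" for j y
    proof -
      have D: "((\<lambda>s::real. t / 3 * (max 0 (1 - s / t)) ^ 3) has_real_derivative - (max 0 (1 - s / t))\<^sup>2) (at s)" for s
      proof -
        have 1: "((\<lambda>x::real. (max 0 x) ^ 3) has_real_derivative 3 * (max 0 x)\<^sup>2) (at x)" for x
          using DERIV_pos_part_power[of 1 x] by (simp add: numeral_3_eq_3 numeral_2_eq_2)
        have "((\<lambda>s::real. 1 - s / t) has_real_derivative - (1 / t)) (at s)"
          using t by (auto intro!: derivative_eq_intros)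
        from DERIV_cmult[OF DERIV_chain2[OF 1 this], of "t / 3"]
        show ?thesis using t by (simp add: field_simps)
      qed
      show "vf_apply (X j) (\<lambda>y. t / 3 * a y ^ 3) y = - (a y)\<^sup>2 * g j y" "(\<lambda>y. t / 3 * a y ^ 3) differentiable (at y)"
        unfolding a_def g_def using vf_apply_chain[OF \<Gamma>_differentiable[OF that] D] by auto
    qed
    have XF: "vf_apply (X j) (F j) y = cutoff_grad R j y * (t / 3 * a y ^ 3) * g j y
        - cutoff R y * (a y)\<^sup>2 * (g j y)\<^sup>2 + cutoff R y * (t / 3 * a y ^ 3) * vf_apply (X j) (g j) y"
      "F j differentiable (at y)"
      if j: "j \<in> {1..m}" and y: "y \<noteq> c" for j y
    proof -
      let ?F = "\<lambda>y. cutoff R y * (t / 3 * a y ^ 3) * g j y"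
      have gd: "g j differentiable (at y)" using smooth_on_differentiable[OF gs[OF j]] y by simp
      have cd: "(\<lambda>y. cutoff R y * (t / 3 * a y ^ 3)) differentiable (at y)"
        by (intro differentiable_mult cutoff_derivative Da(2) y)
      have Fd: "?F differentiable (at y)" by (intro differentiable_mult cd gd)
      have "vf_apply (X j) ?F y = cutoff_grad R j y * (t / 3 * a y ^ 3) * g j y
        - cutoff R y * (a y)\<^sup>2 * (g j y)\<^sup>2 + cutoff R y * (t / 3 * a y ^ 3) * vf_apply (X j) (g j) y"
        by (simp only: vf_apply_mult[OF cd gd] vf_apply_mult[OF cutoff_derivative(1) Da(2)[OF y]] Da(1)[OF y]
              cutoff_derivative(2)) (simp add: power2_eq_square algebra_simps)
      then show "vf_apply (X j) (F j) y = cutoff_grad R j y * (t / 3 * a y ^ 3) * g j y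
        - cutoff R y * (a y)\<^sup>2 * (g j y)\<^sup>2 + cutoff R y * (t / 3 * a y ^ 3) * vf_apply (X j) (g j) y"
        using vf_apply_cong_open(1)[OF _ _ _ Fd, of "- {c}" "F j" "X j"] y by (simp add: F_def open_Compl)
      show "F j differentiable (at y)"
        using vf_apply_cong_open(2)[OF _ _ _ Fd, of "- {c}" "F j"] y by (simp add: F_def open_Compl)
    qed
    have intXF: "integrable lborel (vf_apply (X j) (F j))" "(LINT y|lborel. vf_apply (X j) (F j) y) = 0"
      "vf_apply (X j) (F j) c = 0" if j: "j \<in> {1..m}" for j
    proof -
      note glue = vf_apply_glue[OF d(1) F0 XF(2)[OF j]]
      show "vf_apply (X j) (F j) c = 0" by (rule glue(2))
      have "continuous_on (- {c}) (\<lambda>y. cutoff_grad R j y * (t / 3 * a y ^ 3) * g j y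
        - cutoff R y * (a y)\<^sup>2 * (g j y)\<^sup>2 + cutoff R y * (t / 3 * a y ^ 3) * vf_apply (X j) (g j) y)"
        by (intro continuous_intros ca smooth_on_continuous[OF gs[OF j]] smooth_on_continuous[OF Xgs[OF j]]
            continuous_on_subset[OF continuous_cutoff] continuous_on_subset[OF continuous_cutoff_grad[OF j]]) auto
      then have "continuous_on (- {c}) (vf_apply (X j) (F j))"
        by (rule continuous_on_eq) (use XF(1)[OF j] in auto)
      note cont' = this
      have cont: "continuous_on UNIV (vf_apply (X j) (F j))"
      proof (rule glue(3))
        show "continuous_on (- {c}) (vf_apply (X j) (F j))" by (rule cont')
      qed
      have supp: "F j y = 0" if "y \<notin> cball 0 (R + 1)" for y using that cutoff_values(2)[OF R, of y] by (simp add: F_def)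
      have diff: "F j differentiable (at y)" for y
        by (rule vf_apply_glue(1)[OF d(1)], rule F0, assumption, rule XF(2)[OF j], assumption)
      show "integrable lborel (vf_apply (X j) (F j))" "(LINT y|lborel. vf_apply (X j) (F j) y) = 0"
        by (rule integral_vf_apply_zero[OF hom_X[OF j]], rule diff, rule cont, rule supp, assumption)+
    qed
    have "continuous_on (- {c}) (\<lambda>y. \<Sum>j=1..m. cutoff_grad R j y * (t / 3 * a y ^ 3) * g j y)"
      by (intro continuous_intros ca smooth_on_continuous[OF gs] continuous_on_subset[OF continuous_cutoff_grad]) auto
    then have "continuous_on (- {c}) k" by (rule continuous_on_eq) (auto simp: k_def)
    then have ck: "continuous_on UNIV k" by (rule continuous_on_glue[OF d(1), rotated]) (rule k0)
    have ik: "integrable lborel k"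
      by (rule integrable_continuous_bounded_support[OF ck, where R="R + 1"])
         (use cutoff_values(3)[OF R] in \<open>auto simp: k_def\<close>)
    \<comment> \<open>The product rule gives \<open>k - e\<close> plus
      \<open>cutoff * h(\<Gamma>) * L \<Gamma>\<close>, and the last term vanishes by harmonicity.
      The divergence integrates to 0, so the energy equals the integral of \<open>k\<close>; since
      \<open>h \<le> t / 3\<close>, this is linear in \<open>t\<close>.\<close>
    have ek: "e y = k y - (\<Sum>j=1..m. vf_apply (X j) (F j) y)" for y
    proof (cases "y = c")
      case True
      then show ?thesis by (simp add: e_def k_def intXF(3))
    next
      case False
      have "(\<Sum>j=1..m. cutoff R y * (t / 3 * a y ^ 3) * vf_apply (X j) (g j) y) =
        cutoff R y * (t / 3 * a y ^ 3) * sum_of_squares_op m X (\<Gamma> c) y"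
        by (simp add: sum_of_squares_op_def g_def sum_distrib_left)
      also have "\<dots> = 0" using \<Gamma>_harmonic[OF False] by simp
      finally show ?thesis using False XF(1)[OF _ False]
        by (simp add: e_def k_def sum.distrib sum_subtractf)
    qed
    have ie: "integrable lborel e" unfolding ek[abs_def] by (intro Bochner_Integration.integrable_diff ik Bochner_Integration.integrable_sum intXF(1))
    have "(LINT y|lborel. e y) = (LINT y|lborel. k y)"
      unfolding ek using intXF ik by (subst Bochner_Integration.integral_diff) (auto intro!: Bochner_Integration.integrable_sum simp: Bochner_Integration.integral_sum)
    also have "\<dots> \<le> (LINT y|lborel. t / 3 * B * indicator (cball (0 :: real ^ 'n) (R + 1)) y)"
    proof (rule Bochner_Integration.integral_mono[OF ik])
      show "integrable lborel (\<lambda>y. t / 3 * B * indicator (cball (0 :: real ^ 'n) (R + 1)) y)"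
        by (intro integrable_mult_right integrable_real_indicator) (use emeasure_lborel_cball_finite in auto)
      fix y
      show "k y \<le> t / 3 * B * indicator (cball 0 (R + 1)) y"
      proof (cases "y = c")
        case True
        then show ?thesis using B(1) t by (simp add: k_def)
      next
        case False
        have a: "0 \<le> a y" "a y \<le> 1" using \<Gamma>_pos[of c y] False t by (auto simp: a_def)
        then have a3: "0 \<le> a y ^ 3" "a y ^ 3 \<le> 1" by (auto intro: power_le_one)
        have "cutoff_grad R j y * (t / 3 * a y ^ 3) * g j y \<le> t / 3 * \<bar>cutoff_grad R j y * g j y\<bar>" for j
        proof -
          have "cutoff_grad R j y * (t / 3 * a y ^ 3) * g j y = (t / 3 * a y ^ 3) * (cutoff_grad R j y * g j y)" by simp
          also have "\<dots> \<le> (t / 3 * a y ^ 3) * \<bar>cutoff_grad R j y * g j y\<bar>" using t a3 by (intro mult_left_mono) auto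
          also have "\<dots> \<le> (t / 3) * \<bar>cutoff_grad R j y * g j y\<bar>" using t a3 by (intro mult_right_mono) auto
          finally show ?thesis .
        qed
        then have "k y \<le> t / 3 * (\<Sum>j=1..m. \<bar>cutoff_grad R j y * g j y\<bar>)"
          using False by (simp add: k_def sum_distrib_left sum_mono)
        also have "\<dots> \<le> t / 3 * (B * indicator (cball 0 (R + 1)) y)"
          using B(2)[OF c False] t by (intro mult_left_mono) (auto simp: g_def)
        finally show ?thesis by simp
      qed
    qed
    also have "\<dots> = B * vol / 3 * t" by (simp add: vol_def)
    finally have le: "(LINT y|lborel. e y) \<le> B * vol / 3 * t" .
    have e0: "e y \<ge> 0" for y by (auto simp: e_def intro!: sum_nonneg mult_nonneg_nonneg cutoff_nonneg)
    show ?thesis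
      unfolding energy_le_def
    proof
      fix j assume j: "j \<in> {1..m}"
      have "(\<integral>\<^sup>+y. ennreal ((vf_apply (X j) (trunc c t) y)\<^sup>2) * indicator (cball 0 R) y \<partial>lborel) \<le> (\<integral>\<^sup>+y. ennreal (e y) \<partial>lborel)"
      proof (rule nn_integral_mono)
        fix y
        show "ennreal ((vf_apply (X j) (trunc c t) y)\<^sup>2) * indicator (cball 0 R) y \<le> ennreal (e y)"
        proof (cases "y = c \<or> y \<notin> cball 0 R")
          case True
          then show ?thesis using trunc_C1(2)[OF t] by auto
        next
          case False
          have "(vf_apply (X j) (trunc c t) y)\<^sup>2 = cutoff R y * (a y)\<^sup>2 * (g j y)\<^sup>2"
            using False trunc_derivative(2)[OF t, of y c j] cutoff_values(1)[OF R, of y]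
            by (simp add: a_def g_def power_mult_distrib)
          also have "\<dots> \<le> (\<Sum>j=1..m. cutoff R y * (a y)\<^sup>2 * (g j y)\<^sup>2)"
            using j by (intro member_le_sum mult_nonneg_nonneg cutoff_nonneg) auto
          finally show ?thesis using False by (simp add: e_def ennreal_leI)
        qed
      qed
      also have "\<dots> = ennreal (LINT y|lborel. e y)" by (rule nn_integral_eq_integral[OF ie]) (simp add: e0)
      also have "\<dots> \<le> ennreal (B * vol / 3 * t)" by (rule ennreal_leI[OF le])
      finally show "(\<integral>\<^sup>+y. ennreal ((vf_apply (X j) (trunc c t) y)\<^sup>2) * indicator (cball 0 R) y \<partial>lborel) \<le> ennreal (B * vol / 3 * t)" .
    qed
  qed
  moreover have "B * vol / 3 \<ge> 0" using B(1) by (simp add: vol_def)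
  ultimately show ?thesis by blast
qed

end

section \<open>Weak integrability of the fundamental solution\<close>


context fundamental
begin

text \<open>The pole is added because \<open>\<Gamma> c c\<close> is arbitrary; with it,
  \<Gamma>-balls of radius \<open>r\<close> are exactly the superlevel sets at
  \<open>1 / r\<close>.\<close>

definition superlevel :: "real ^ 'n \<Rightarrow> real \<Rightarrow> (real ^ 'n) set" where
  "superlevel c t = {y. y = c \<or> \<Gamma> c y > t}"

lemma superlevel_borel [measurable]: "superlevel c t \<in> sets borel"
proof -
  have "continuous_on (- {c}) (\<Gamma> c)" by (rule smooth_on_continuous[OF \<Gamma>_smooth])
  then have "open (- {c} \<inter> \<Gamma> c -` {t<..})" by (intro continuous_open_preimage) (auto simp: open_Compl)
  from sets.Un[OF borel_open[OF this] borel_singleton[of "{}" c]]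
  have "(- {c} \<inter> \<Gamma> c -` {t<..}) \<union> {c} \<in> sets borel" by simp
  moreover have "superlevel c t = (- {c} \<inter> \<Gamma> c -` {t<..}) \<union> {c}" by (auto simp: superlevel_def)
  ultimately show ?thesis by simp
qed

lemma \<Gamma>_bounded_on_compact:
  assumes "compact K" "K \<subseteq> {(x, y). x \<noteq> y}"
  shows "\<exists>B>0. \<forall>(x, y)\<in>K. \<Gamma> x y \<le> B"
proof -
  have "continuous_on K (\<lambda>(x, y). \<Gamma> x y)" by (rule continuous_on_subset[OF \<Gamma>_continuous2 assms(2)])
  from compact_imp_bounded[OF compact_continuous_image[OF this assms(1)]]
  obtain B where B: "\<And>z. z \<in> (\<lambda>(x, y). \<Gamma> x y) ` K \<Longrightarrow> norm z \<le> B" unfolding bounded_iff by blast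
  have "\<Gamma> x y \<le> max B 1" if "(x, y) \<in> K" for x y
  proof -
    have "norm (\<Gamma> x y) \<le> B" using B[of "\<Gamma> x y"] that by force
    then show ?thesis by simp
  qed
  then show ?thesis by (intro exI[of _ "max B 1"]) auto
qed

lemma trunc_high: "t > 0 \<Longrightarrow> y \<in> superlevel c t \<Longrightarrow> trunc c t y = t / 2"
  by (auto simp: superlevel_def trunc_def max_def field_simps)

lemma trunc_low:
  assumes "t > 0" "y \<notin> superlevel c (t / 8)" shows "trunc c t y \<le> t / 8"
proof -
  define x where "x = \<Gamma> c y / t"
  have "y \<noteq> c" "\<Gamma> c y \<le> t / 8" using assms(2) by (auto simp: superlevel_def)
  then have x: "0 < x" "x \<le> 1 / 8" using assms(1) \<Gamma>_pos[of c y] by (auto simp: x_def field_simps)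
  have "max 0 (1 - x) = 1 - x" using x by simp
  then have "trunc c t y = t / 2 * (1 - (1 - x)\<^sup>2)" using \<open>y \<noteq> c\<close> by (simp add: trunc_def x_def)
  also have "\<dots> = t / 2 * (2 * x - x\<^sup>2)" by (simp add: power2_eq_square algebra_simps)
  also have "\<dots> \<le> t / 2 * (1 / 4)" using assms(1) x zero_le_power2[of x] by (intro mult_left_mono) linarith+
  finally show ?thesis by simp
qed

lemma escape_borel:
  assumes "g \<in> borel_measurable borel"
  shows "{y \<in> cball 0 R \<inter> superlevel c t. g y \<notin> superlevel c t'} \<in> sets borel"
proof -
  have "g -` (- superlevel c t') \<in> sets borel"
    using measurable_sets[OF assms, of "- superlevel c t'"] by (simp add: borel_comp)
  then have "cball 0 R \<inter> superlevel c t \<inter> g -` (- superlevel c t') \<in> sets borel" by measurable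
  moreover have "{y \<in> cball 0 R \<inter> superlevel c t. g y \<notin> superlevel c t'} =
      cball 0 R \<inter> superlevel c t \<inter> g -` (- superlevel c t')" by auto
  ultimately show ?thesis by simp
qed

text \<open>Chebyshev's inequality: on the escape set the truncation falls from \<open>t / 2\<close>
  to at most \<open>t / 8\<close>, hence by at least \<open>t / 4\<close>, and the square of this
  drop is integrated against the displacement bound.\<close>

lemma escape_measure:
  assumes g: "ctrl \<kappa> r b g" and "\<kappa> \<ge> 0" "C \<ge> 0" and t: "t > 0" and e: "energy_le (trunc c t) (b R) (ennreal (C * t))"
  shows "emeasure lborel {y \<in> cball 0 R \<inter> superlevel c t. g y \<notin> superlevel c (t / 8)} \<le> ennreal (16 * \<kappa> * C * r\<^sup>2 / t)"
proof -
  let ?u = "trunc c t"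
  define A where "A = {y \<in> cball 0 R \<inter> superlevel c t. g y \<notin> superlevel c (t / 8)}"
  have "g \<in> borel_measurable borel" using g by (simp add: ctrl_def mpres_measurable)
  then have A[measurable]: "A \<in> sets borel" unfolding A_def by (rule escape_borel)
  have "ennreal (t\<^sup>2 / 16) * emeasure lborel A = (\<integral>\<^sup>+y. ennreal (t\<^sup>2 / 16) * indicator A y \<partial>lborel)"
    by (simp add: nn_integral_cmult_indicator)
  also have "\<dots> \<le> (\<integral>\<^sup>+y. ennreal ((?u (g y) - ?u y)\<^sup>2) * indicator (cball 0 R) y \<partial>lborel)"
  proof (rule nn_integral_mono)
    fix y
    show "ennreal (t\<^sup>2 / 16) * indicator A y \<le> ennreal ((?u (g y) - ?u y)\<^sup>2) * indicator (cball 0 R) y"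
    proof (cases "y \<in> A")
      case True
      then have "?u y = t / 2" "?u (g y) \<le> t / 8" using trunc_high[OF t] trunc_low[OF t] by (auto simp: A_def)
      then have "t / 4 \<le> \<bar>?u (g y) - ?u y\<bar>" using t by linarith
      then have "(t / 4)\<^sup>2 \<le> \<bar>?u (g y) - ?u y\<bar>\<^sup>2" using t by (intro power_mono) auto
      then have "t\<^sup>2 / 16 \<le> (?u (g y) - ?u y)\<^sup>2" by (simp add: power_divide)
      then show ?thesis using True by (simp add: A_def ennreal_leI)
    qed simp
  qed
  also have "\<dots> \<le> ennreal (\<kappa> * r\<^sup>2) * ennreal (C * t)"
    using g trunc_C1(1)[OF t] e unfolding ctrl_def by blast
  also have "\<dots> = ennreal (\<kappa> * r\<^sup>2 * (C * t))"
    using assms by (subst ennreal_mult) auto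
  finally have le: "ennreal (t\<^sup>2 / 16) * emeasure lborel A \<le> ennreal (\<kappa> * r\<^sup>2 * (C * t))" .
  have "emeasure lborel A \<le> emeasure lborel (cball (0 :: real ^ 'n) R)" by (rule emeasure_mono) (auto simp: A_def)
  also have "\<dots> < \<infinity>" by (rule emeasure_lborel_cball_finite)
  finally have fin: "emeasure lborel A = ennreal (measure lborel A)"
    by (intro emeasure_eq_ennreal_measure) auto
  from le have "ennreal (t\<^sup>2 / 16 * measure lborel A) \<le> ennreal (\<kappa> * r\<^sup>2 * (C * t))"
    by (simp add: fin ennreal_mult[symmetric])
  then have "t\<^sup>2 / 16 * measure lborel A \<le> \<kappa> * r\<^sup>2 * (C * t)"
    using assms by (subst (asm) ennreal_le_iff) auto
  then have "measure lborel A \<le> 16 * \<kappa> * C * r\<^sup>2 / t"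
    using t by (simp add: field_simps power2_eq_square)
  then show ?thesis unfolding A_def[symmetric] fin by (rule ennreal_leI)
qed

lemma energy_uniform:
  assumes "0 \<le> R0"
  shows "\<exists>C\<ge>0. \<forall>c\<in>cball 0 R0. \<forall>t>0. energy_le (trunc c t) R (ennreal (C * t))"
proof -
  obtain C where "C \<ge> 0" "\<forall>c\<in>cball 0 R0. \<forall>t>0. energy_le (trunc c t) (max R (R0 + 1)) (ennreal (C * t))"
    using truncation_energy[OF assms, of "max R (R0 + 1)"] by (meson less_add_one less_max_iff_disj)
  then show ?thesis using energy_le_mono[of _ "max R (R0 + 1)" _ R] by (meson max.cobounded1)
qed

text \<open>One flow of fixed duration carries the whole ball to distance at least 1 from every
  admissible pole, where \<Gamma> is bounded by \<open>B\<close>. For \<open>t \<ge> 8 * B\<close>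
  every point of the superlevel set therefore escapes.\<close>

lemma weak_L1_estimate:
  assumes "0 \<le> R0" "0 \<le> R" and i: "\<sigma> i = 1"
  shows "\<exists>C>0. \<exists>t0>0. \<forall>c\<in>cball 0 R0. \<forall>t\<ge>t0. emeasure lborel (cball 0 R \<inter> superlevel c t) \<le> ennreal (C / t)"
proof -
  obtain j a where j: "j \<in> {1..m}" "a \<noteq> 0" "\<And>t y. flow (X j) t y $ i = y $ i + t * a"
    using exists_transversal_field[OF i] by blast
  \<comment> \<open>Coordinate \<open>i\<close> starts in \<open>[-R, R]\<close>, so a shift by
    \<open>2 * R + R0 + 2\<close> brings it beyond \<open>R0 + 1\<close>.\<close>
  define s where "s = (2 * R + R0 + 2) / a"
  obtain b where b: "ctrl 1 \<bar>s\<bar> b (flow (X j) s)"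
    using ctrl_flow[OF j(1), of "\<bar>s\<bar>"] by auto
  obtain C where C: "C \<ge> 0" "\<And>c t. c\<in>cball 0 R0 \<Longrightarrow> t > 0 \<Longrightarrow> energy_le (trunc c t) (b R) (ennreal (C * t))"
    using energy_uniform[OF assms(1), of "b R"] by blast
  have "compact (cball (0 :: real ^ 'n) R0 \<times> (cball (0 :: real ^ 'n) (b R) - ball 0 (R0 + 1)))"
    by (intro compact_Times compact_diff) auto
  moreover have "cball (0 :: real ^ 'n) R0 \<times> (cball (0 :: real ^ 'n) (b R) - ball 0 (R0 + 1)) \<subseteq> {(x, y). x \<noteq> y}" by auto
  ultimately obtain B where B: "B > 0" "\<forall>(x, y)\<in>cball (0 :: real ^ 'n) R0 \<times> (cball (0 :: real ^ 'n) (b R) - ball 0 (R0 + 1)). \<Gamma> x y \<le> B"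
    using \<Gamma>_bounded_on_compact by blast
  have "emeasure lborel (cball 0 R \<inter> superlevel c t) \<le> ennreal ((16 * 1 * C * \<bar>s\<bar>\<^sup>2 + 1) / t)"
    if c: "c \<in> cball 0 R0" and t: "t \<ge> 8 * B" for c t
  proof -
    have t0: "t > 0" using t B(1) by simp
    have "flow (X j) s y \<notin> superlevel c (t / 8)" if "y \<in> cball 0 R" for y
    proof -
      let ?z = "flow (X j) s y"
      have "?z $ i = y $ i + (2 * R + R0 + 2)" using j(2,3) by (simp add: s_def)
      moreover have "\<bar>y $ i\<bar> \<le> R" using that component_le_norm_cart[of y i] by simp
      ultimately have "\<bar>?z $ i\<bar> \<ge> R0 + 1" using assms by linarith
      then have 1: "norm ?z \<ge> R0 + 1" using component_le_norm_cart[of ?z i] by linarith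
      have "?z \<in> cball 0 (b R)" using b that unfolding ctrl_def by blast
      with 1 have "\<Gamma> c ?z \<le> B" using B(2) c by auto
      moreover have "?z \<noteq> c" using 1 c by auto
      ultimately show ?thesis using t by (simp add: superlevel_def)
    qed
    then have "cball 0 R \<inter> superlevel c t = {y \<in> cball 0 R \<inter> superlevel c t. flow (X j) s y \<notin> superlevel c (t / 8)}"
      by auto
    then have "emeasure lborel (cball 0 R \<inter> superlevel c t) \<le> ennreal (16 * 1 * C * \<bar>s\<bar>\<^sup>2 / t)"
      using escape_measure[OF b _ C(1) t0 C(2)[OF c t0]] by simp
    also have "\<dots> \<le> ennreal ((16 * 1 * C * \<bar>s\<bar>\<^sup>2 + 1) / t)"
      using t0 by (intro ennreal_leI divide_right_mono) auto
    finally show ?thesis .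
  qed
  moreover have "16 * 1 * C * \<bar>s\<bar>\<^sup>2 + 1 > 0" using C(1) by (intro add_nonneg_pos) auto
  ultimately show ?thesis using B(1)
    by (intro exI[of _ "16 * 1 * C * \<bar>s\<bar>\<^sup>2 + 1"] conjI exI[of _ "8 * B"]) auto
qed

definition Q :: nat where "Q = (\<Sum>i\<in>UNIV. \<sigma> i)"

lemma box_measure:
  assumes "\<rho> \<ge> 0"
  shows "emeasure lborel (cbox 0 (\<chi> i. \<rho> ^ \<sigma> i)) = ennreal (\<rho> ^ Q)"
proof -
  have "cbox (0 :: real ^ 'n) (\<chi> i. \<rho> ^ \<sigma> i) \<noteq> {}"
    using assms by (simp add: interval_ne_empty_cart)
  then have "measure lborel (cbox (0 :: real ^ 'n) (\<chi> i. \<rho> ^ \<sigma> i)) = \<rho> ^ Q"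
    by (subst content_cbox_cart) (auto simp: power_sum Q_def)
  then show ?thesis
    by (metis emeasure_eq_ennreal_measure emeasure_lborel_cbox_finite less_irrefl infinity_ennreal_def)
qed

text \<open>The escape estimate holds for each displacement \<open>s\<close> separately; averaging
  it over the box and exchanging the order of integration uses that, for fixed \<open>y\<close>, the
  displacements keeping \<open>y\<close> in \<open>E'\<close> are few. The constant is determined by
  the \<open>1 / t\<close> bound at level \<open>t / 8\<close>.\<close>

theorem weak_estimate:
  assumes R0: "0 \<le> R0" and R: "0 \<le> R" and i: "\<sigma> i = 1"
  shows "\<exists>C>0. \<exists>t0>0. \<forall>c\<in>cball 0 R0. \<forall>t\<ge>t0.
     emeasure lborel (cball 0 R \<inter> superlevel c t) \<le> ennreal (C * t powr (- (1 + 2 / real Q)))"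
proof -
  obtain \<kappa> b \<Psi> where k: "\<kappa> \<ge> 0" and c\<Psi>: "continuous_on UNIV (\<lambda>(s, y). \<Psi> s y)"
    and \<Psi>: "\<And>\<rho> s. \<rho> \<in> {0..1} \<Longrightarrow> (\<forall>i. 0 \<le> s $ i \<and> s $ i \<le> \<rho> ^ \<sigma> i) \<Longrightarrow> ctrl \<kappa> \<rho> b (\<Psi> s)"
    and G: "\<And>y. \<exists>G. mpres G \<and> (\<forall>s. (\<forall>i. 0 \<le> s $ i) \<longrightarrow> G s = \<Psi> s y)"
    using box_moves by metis
  have "ctrl \<kappa> 1 b (\<Psi> 0)" by (rule \<Psi>) auto
  then have bR: "R \<le> b R" by (simp add: ctrl_def)
  obtain C1 t1 where C1: "C1 > 0" "t1 > 0"
    "\<And>c t. c\<in>cball 0 R0 \<Longrightarrow> t \<ge> t1 \<Longrightarrow> emeasure lborel (cball 0 (b R) \<inter> superlevel c t) \<le> ennreal (C1 / t)"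
    using weak_L1_estimate[OF R0 order_trans[OF R bR] i] by blast
  obtain C where C: "C \<ge> 0" "\<And>c t. c\<in>cball 0 R0 \<Longrightarrow> t > 0 \<Longrightarrow> energy_le (trunc c t) (b R) (ennreal (C * t))"
    using energy_uniform[OF R0, of "b R"] by blast
  define C2 where "C2 = 16 * \<kappa> * C"
  have C2: "C2 \<ge> 0" using k C by (simp add: C2_def)
  have Q: "Q > 0" using weight_pos[of i] by (simp add: sum_pos weight_pos Q_def)
  \<comment> \<open>The first entry allows the \<open>1 / t\<close> bound at level
    \<open>t / 8\<close>; the second makes \<open>\<rho> \<le> 1\<close>, the range of
    \<open>box_moves\<close>.\<close>
  define t0 where "t0 = max (8 * t1) (16 * C1)"
  have main: "emeasure lborel (cball 0 R \<inter> superlevel c t) \<le> ennreal ((2 * C2 * (16 * C1) powr (2 / Q) + 1) * t powr (- (1 + 2 / real Q)))"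
    if c: "c \<in> cball 0 R0" and t: "t \<ge> t0" for c t
  proof -
    have tp: "t > 0" "t / 8 \<ge> t1" "t \<ge> 16 * C1" using t C1 by (auto simp: t0_def)
    \<comment> \<open>Chosen so that the volume \<open>\<rho> ^ Q\<close> of the box is twice
      \<open>8 * C1 / t\<close>, the bound for the measure of \<open>E'\<close>.\<close>
    define \<rho> where "\<rho> = (16 * C1 / t) powr (1 / Q)"
    have r01: "0 < 16 * C1 / t" "16 * C1 / t \<le> 1" using tp C1 by (auto simp: field_simps)
    have \<rho>: "\<rho> \<ge> 0" "\<rho> \<le> 1" unfolding \<rho>_def using r01 powr_mono2[of "1 / real Q" "16 * C1 / t" 1] by auto
    have "\<rho> > 0" using C1 tp by (simp add: \<rho>_def)
    have \<rho>Q: "\<rho> ^ Q = 16 * C1 / t"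
      using C1(1) tp(1) Q \<open>\<rho> > 0\<close> by (simp add: powr_realpow[symmetric] \<rho>_def powr_powr)
    define Box where "Box = cbox (0 :: real ^ 'n) (\<chi> i. \<rho> ^ \<sigma> i)"
    have Box: "s \<in> Box \<longleftrightarrow> (\<forall>i. 0 \<le> s $ i \<and> s $ i \<le> \<rho> ^ \<sigma> i)" for s by (auto simp: Box_def mem_box_cart)
    have [measurable]: "Box \<in> sets borel" by (simp add: Box_def)
    define E where "E = cball 0 R \<inter> superlevel c t"
    define E' where "E' = cball 0 (b R) \<inter> superlevel c (t / 8)"
    have [measurable]: "E \<in> sets borel" "E' \<in> sets borel" unfolding E_def E'_def by auto
    have m\<Psi>: "(\<lambda>p. (\<lambda>(s, y). \<Psi> s y) p) \<in> borel_measurable (borel \<Otimes>\<^sub>M borel)"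
      using borel_measurable_continuous_onI[OF c\<Psi>] by (simp add: borel_prod)
    have [measurable (raw)]: "(\<lambda>x. \<Psi> (p x) (q x)) \<in> borel_measurable N"
      if "p \<in> borel_measurable N" "q \<in> borel_measurable N" for N :: "'z measure" and p q
      using measurable_compose[OF measurable_Pair[OF that] m\<Psi>] by simp
    define K where "K = C2 * \<rho>\<^sup>2 / t"
    have K: "K \<ge> 0" using C2 tp by (simp add: K_def)
    \<comment> \<open>A point of \<open>E\<close> either lands in \<open>E'\<close> or escapes below
      \<open>t / 8\<close>, and \<open>K\<close> bounds the measure of the latter.\<close>
    have esc: "emeasure lborel E \<le> (\<integral>\<^sup>+y. indicator E y * indicator E' (\<Psi> s y) \<partial>lborel) + ennreal K" if s: "s \<in> Box" for s
    proof -
      have cs: "ctrl \<kappa> \<rho> b (\<Psi> s)" using \<Psi>[of \<rho> s] \<rho> s Box by auto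
      let ?A = "{y \<in> cball 0 R \<inter> superlevel c t. \<Psi> s y \<notin> superlevel c (t / 8)}"
      have A: "emeasure lborel ?A \<le> ennreal K"
        using escape_measure[OF cs k C(1) tp(1) C(2)[OF c tp(1)]] by (simp add: K_def C2_def)
      have cyl: "\<Psi> s y \<in> cball 0 (b R)" if "y \<in> cball 0 R" for y using cs that unfolding ctrl_def by blast
      have [measurable]: "?A \<in> sets borel" by (rule escape_borel) measurable
      have "emeasure lborel E = (\<integral>\<^sup>+y. indicator E y \<partial>lborel)" by simp
      also have "\<dots> \<le> (\<integral>\<^sup>+y. indicator E y * indicator E' (\<Psi> s y) + indicator ?A y \<partial>lborel)"
        using cyl by (intro nn_integral_mono) (auto simp: indicator_def E_def E'_def)
      also have "\<dots> = (\<integral>\<^sup>+y. indicator E y * indicator E' (\<Psi> s y) \<partial>lborel) + emeasure lborel ?A"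
        by (subst nn_integral_add) auto
      finally show ?thesis using A by (meson add_left_mono order_trans)
    qed
    have vb: "emeasure lborel Box = ennreal (\<rho> ^ Q)" unfolding Box_def by (rule box_measure[OF \<rho>(1)])
    have "emeasure lborel Box * emeasure lborel E = (\<integral>\<^sup>+s. indicator Box s * emeasure lborel E \<partial>lborel)"
      by (simp add: nn_integral_multc)
    also have "\<dots> \<le> (\<integral>\<^sup>+s. indicator Box s * (\<integral>\<^sup>+y. indicator E y * indicator E' (\<Psi> s y) \<partial>lborel) + indicator Box s * ennreal K \<partial>lborel)"
      using esc by (intro nn_integral_mono) (auto simp: indicator_def)
    also have "\<dots> = (\<integral>\<^sup>+s. indicator Box s * (\<integral>\<^sup>+y. indicator E y * indicator E' (\<Psi> s y) \<partial>lborel) \<partial>lborel) + emeasure lborel Box * ennreal K"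
      by (subst nn_integral_add) (auto simp: nn_integral_multc)
    also have "(\<integral>\<^sup>+s. indicator Box s * (\<integral>\<^sup>+y. indicator E y * indicator E' (\<Psi> s y) \<partial>lborel) \<partial>lborel) =
      (\<integral>\<^sup>+s. (\<integral>\<^sup>+y. indicator Box s * (indicator E y * indicator E' (\<Psi> s y)) \<partial>lborel) \<partial>lborel)"
      by (intro nn_integral_cong nn_integral_cmult[symmetric]) measurable
    also have "\<dots> = (\<integral>\<^sup>+y. (\<integral>\<^sup>+s. indicator Box s * (indicator E y * indicator E' (\<Psi> s y)) \<partial>lborel) \<partial>lborel)"
      by (rule lborel_pair.Fubini'[symmetric]) measurable
    also have "\<dots> \<le> (\<integral>\<^sup>+y. indicator E y * emeasure lborel E' \<partial>lborel)"
    proof (rule nn_integral_mono)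
      fix y
      \<comment> \<open>For fixed \<open>y\<close> the displacement agrees on the box with a
        measure-preserving map of \<open>s\<close>, so the parameters leading into \<open>E'\<close>
        have measure at most that of \<open>E'\<close>.\<close>
      obtain H where H: "mpres H" "\<And>s. (\<forall>i. 0 \<le> s $ i) \<Longrightarrow> H s = \<Psi> s y" using G by blast
      have "(\<integral>\<^sup>+s. indicator Box s * (indicator E y * indicator E' (\<Psi> s y)) \<partial>lborel)
        \<le> (\<integral>\<^sup>+s. indicator E y * indicator E' (H s) \<partial>lborel)"
        using H(2) Box by (intro nn_integral_mono) (auto simp: indicator_def)
      also have "\<dots> = indicator E y * (\<integral>\<^sup>+s. indicator E' (H s) \<partial>lborel)"
        using mpres_measurable[OF H(1)] by (intro nn_integral_cmult) measurable
      also have "(\<integral>\<^sup>+s. indicator E' (H s) \<partial>lborel) = (\<integral>\<^sup>+s. indicator E' s \<partial>lborel)"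
        by (rule mpres_nn_integral[OF H(1)]) measurable
      finally show "(\<integral>\<^sup>+s. indicator Box s * (indicator E y * indicator E' (\<Psi> s y)) \<partial>lborel) \<le> indicator E y * emeasure lborel E'"
        by simp
    qed
    also have "\<dots> = emeasure lborel E * emeasure lborel E'" by (simp add: nn_integral_multc)
    also have "\<dots> \<le> emeasure lborel E * ennreal (8 * C1 / t)"
      using C1(3)[OF c tp(2)] by (intro mult_left_mono) (auto simp: E'_def mult.commute)
    finally have le: "emeasure lborel Box * emeasure lborel E \<le> emeasure lborel E * ennreal (8 * C1 / t) + emeasure lborel Box * ennreal K"
      by (simp add: add_right_mono)
    have "emeasure lborel E \<le> emeasure lborel (cball (0 :: real ^ 'n) R)" by (rule emeasure_mono) (auto simp: E_def)
    also have "\<dots> < \<infinity>" by (rule emeasure_lborel_cball_finite)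
    finally have fin: "emeasure lborel E = ennreal (measure lborel E)"
      by (intro emeasure_eq_ennreal_measure) auto
    define e where "e = measure lborel E"
    have e0: "e \<ge> 0" by (simp add: e_def)
    have "ennreal (\<rho> ^ Q * e) \<le> ennreal (e * (8 * C1 / t) + \<rho> ^ Q * K)"
      using le K e0 \<rho> C1 tp unfolding fin vb e_def[symmetric]
      by (simp add: ennreal_mult[symmetric] ennreal_plus[symmetric] del: ennreal_plus)
    then have "\<rho> ^ Q * e \<le> e * (8 * C1 / t) + \<rho> ^ Q * K"
      using K e0 \<rho> C1 tp by (subst (asm) ennreal_le_iff) auto
    \<comment> \<open>The first term on the right is half of the left-hand side and is absorbed;
      \<open>K\<close> is of order \<open>\<rho>\<^sup>2 / t\<close>, which is where the gain
      \<open>2 / Q\<close> in the exponent comes from.\<close>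
    then have "16 * C1 / t * e \<le> 8 * C1 / t * e + 16 * C1 / t * K" by (simp add: \<rho>Q mult.commute)
    then have "e \<le> 2 * K" using C1 tp by (simp add: field_simps)
    also have "2 * K = 2 * C2 * (\<rho>\<^sup>2 / t)" by (simp add: K_def)
    also have "\<rho>\<^sup>2 / t = (16 * C1) powr (2 / Q) * t powr (- (1 + 2 / real Q))"
    proof -
      have "\<rho>\<^sup>2 = (16 * C1 / t) powr (2 / Q)"
        using \<open>\<rho> > 0\<close> by (simp add: powr_realpow[symmetric] \<rho>_def powr_powr)
      also have "\<dots> = (16 * C1) powr (2 / Q) / t powr (2 / Q)" using C1 tp by (intro powr_divide)
      finally have *: "\<rho>\<^sup>2 = (16 * C1) powr (2 / Q) / t powr (2 / Q)" .
      have "A / t powr z / t = A * t powr (- (1 + z))" for A z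
      proof -
        have "t powr (1 + z) = t * t powr z" using tp(1) by (simp add: powr_add)
        then show ?thesis by (simp only: powr_minus) (simp add: divide_simps)
      qed
      then show ?thesis unfolding * by blast
    qed
    also have "2 * C2 * ((16 * C1) powr (2 / Q) * t powr (- (1 + 2 / real Q)))
       \<le> (2 * C2 * (16 * C1) powr (2 / Q) + 1) * t powr (- (1 + 2 / real Q))"
      by (simp add: algebra_simps)
    finally show ?thesis unfolding E_def[symmetric] fin e_def by (rule ennreal_leI)
  qed
  have "t0 > 0" using C1 by (simp add: t0_def)
  moreover have "2 * C2 * (16 * C1) powr (2 / Q) + 1 > 0" using C2 by (intro add_nonneg_pos) auto
  ultimately show ?thesis using main by blast
qed

end

section \<open>Covering cones\<close>


context weights
begin

lemma dil_dil: "dil \<sigma> a (dil \<sigma> b x) = dil \<sigma> (a * b) x"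
  by (simp add: dil_def vec_eq_iff power_mult_distrib mult.assoc)

lemma dil_1 [simp]: "dil \<sigma> 1 x = x"
  by (simp add: dil_def vec_eq_iff)

lemma dil_0 [simp]: "dil \<sigma> l 0 = 0"
  by (simp add: dil_def vec_eq_iff)

lemma dil_inverse: "l \<noteq> 0 \<Longrightarrow> dil \<sigma> (1 / l) (dil \<sigma> l x) = x" "l \<noteq> 0 \<Longrightarrow> dil \<sigma> l (dil \<sigma> (1 / l) x) = x"
  by (simp_all add: dil_dil)

lemma norm_dil_shrink:
  assumes "0 \<le> l" "l \<le> 1" shows "norm (dil \<sigma> l x) \<le> l * norm x"
proof -
  have "norm (dil \<sigma> l x) \<le> norm (l *\<^sub>R x)"
  proof (rule norm_le_componentwise_cart)
    fix i
    have "l ^ \<sigma> i \<le> l ^ 1" using assms weight_pos[of i] by (intro power_decreasing) auto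
    then show "norm (dil \<sigma> l x $ i) \<le> norm ((l *\<^sub>R x) $ i)"
      using assms by (simp add: dil_def abs_mult mult_right_mono)
  qed
  then show ?thesis using assms by simp
qed

lemma norm_dil_expand:
  assumes "1 \<le> l" shows "l * norm x \<le> norm (dil \<sigma> l x)"
proof -
  have "norm (dil \<sigma> (1 / l) (dil \<sigma> l x)) \<le> 1 / l * norm (dil \<sigma> l x)"
    using assms by (intro norm_dil_shrink) auto
  then show ?thesis using assms by (simp add: dil_inverse field_simps)
qed

lemma norm_dil_le_power:
  assumes "0 \<le> l" "l \<le> L" "1 \<le> L" shows "norm (dil \<sigma> l x) \<le> L ^ (\<Sum>i\<in>UNIV. \<sigma> i) * norm x"
proof -
  let ?P = "L ^ (\<Sum>i\<in>UNIV. \<sigma> i)"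
  have "norm (dil \<sigma> l x) \<le> norm (?P *\<^sub>R x)"
  proof (rule norm_le_componentwise_cart)
    fix i
    have "l ^ \<sigma> i \<le> L ^ \<sigma> i" using assms by (intro power_mono) auto
    also have "\<dots> \<le> ?P" using assms by (intro power_increasing member_le_sum) auto
    finally show "norm (dil \<sigma> l x $ i) \<le> norm ((?P *\<^sub>R x) $ i)"
      using assms by (simp add: dil_def abs_mult mult_right_mono)
  qed
  then show ?thesis using assms by simp
qed

lemma exists_unit_dil:
  assumes "x \<noteq> 0" shows "\<exists>l>0. norm (dil \<sigma> l x) = 1"
proof -
  define L where "L = max 1 (1 / norm x)"
  have "1 \<le> L * norm x" using assms by (simp add: L_def max_def field_simps)
  also have "\<dots> \<le> norm (dil \<sigma> L x)" by (rule norm_dil_expand) (simp add: L_def)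
  finally have 1: "1 \<le> norm (dil \<sigma> L x)" .
  have z: "dil \<sigma> 0 x = 0" using weight_pos by (simp add: dil_def vec_eq_iff)
  have "continuous_on {0..L} (\<lambda>l. norm (dil \<sigma> l x))"
    unfolding dil_def by (intro continuous_on_norm continuous_on_vec_lambda continuous_intros)
  moreover have "0 \<le> L" by (simp add: L_def)
  ultimately obtain l where l: "0 \<le> l" "norm (dil \<sigma> l x) = 1"
    using IVT'[of "\<lambda>l. norm (dil \<sigma> l x)" 0 1 L] 1 z by auto
  then have "l \<noteq> 0" using z by auto
  then show ?thesis using l by (intro exI[of _ l]) auto
qed

end

section \<open>\<Gamma>-balls under dilations and the covering argument\<close>

context fundamental
begin

lemma open_superlevel: "open (superlevel c t)"
proof -
  obtain \<delta> where d: "\<delta> > 0" "\<forall>y\<in>ball c \<delta>. y \<noteq> c \<longrightarrow> \<Gamma> c y > t" using near_pole by blast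
  have "continuous_on (- {c}) (\<Gamma> c)" by (rule smooth_on_continuous[OF \<Gamma>_smooth])
  then have "open (- {c} \<inter> \<Gamma> c -` {t<..})" by (intro continuous_open_preimage) (auto simp: open_Compl)
  moreover have "superlevel c t = (- {c} \<inter> \<Gamma> c -` {t<..}) \<union> ball c \<delta>"
    using d by (auto simp: superlevel_def)
  ultimately show ?thesis by (simp add: open_Un)
qed

lemma bounded_superlevel:
  assumes "t > 0" shows "bounded (superlevel c t)"
proof -
  have "\<forall>\<^sub>F y in at_infinity. \<Gamma> c y < t" using \<Gamma>_infinity[of c] assms by (rule order_tendstoD)
  then obtain b where b: "\<And>y. norm y \<ge> b \<Longrightarrow> \<Gamma> c y < t" by (auto simp: eventually_at_infinity)
  have "superlevel c t \<subseteq> insert c (cball 0 b)"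
    using b by (force simp: superlevel_def not_le dest: less_asym intro: less_imp_le)
  then show ?thesis using bounded_subset bounded_insert bounded_cball by metis
qed

lemma gamma_ball_superlevel: "r > 0 \<Longrightarrow> gamma_ball \<Gamma> c r = superlevel c (1 / r)"
  using \<Gamma>_pos[of c] by (auto simp: gamma_ball_def gamma_recip_def superlevel_def field_simps)

lemma \<Gamma>_0_lower_bound:
  assumes "compact K" "0 \<notin> K" shows "\<exists>b>0. \<forall>x\<in>K. b \<le> \<Gamma> 0 x"
proof (cases "K = {}")
  case False
  have "continuous_on K (\<Gamma> 0)"
    by (rule continuous_on_subset[OF smooth_on_continuous[OF \<Gamma>_smooth]]) (use assms(2) in auto)
  from continuous_attains_inf[OF assms(1) False this] obtain x where x: "x \<in> K" "\<forall>y\<in>K. \<Gamma> 0 x \<le> \<Gamma> 0 y" by blast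
  moreover have "\<Gamma> 0 x > 0" using x(1) assms(2) by (intro \<Gamma>_pos) auto
  ultimately show ?thesis by blast
qed (auto intro: exI[of _ "1::real"])

text \<open>This shows that a \<Gamma>-ball centred off \<open>U\<close> must have a ratio
  \<open>r * \<Gamma> 0 c\<close> bounded below in order to meet \<open>B\<close>. Bounded centres
  are treated by compactness together with the pole at 0; a distant centre is dilated to the unit
  sphere, which brings \<open>B\<close> into the ball of radius 1/2, and compactness applies again,
  both sides scaling alike.\<close>

lemma far_centre_ratio:
  assumes B: "compact B" and U: "open U" "B \<subseteq> U"
  shows "\<exists>M>0. \<forall>c. c \<noteq> 0 \<longrightarrow> c \<notin> U \<longrightarrow> (\<forall>y\<in>B. \<Gamma> c y \<le> M * \<Gamma> 0 c)"
proof -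
  obtain \<beta> where \<beta>: "\<beta> > 0" "\<And>y. y \<in> B \<Longrightarrow> norm y \<le> \<beta>"
    using compact_imp_bounded[OF B] bounded_pos by blast
  \<comment> \<open>If the dilation factor exceeds \<open>L \<ge> 2 * \<beta>\<close>, then
    \<open>B\<close> shrinks into the ball of radius 1/2; centres with a factor at most
    \<open>L\<close> have norm at most \<open>\<Lambda>\<close>.\<close>
  define L where "L = max 1 (2 * \<beta>)"
  define \<Lambda> where "\<Lambda> = L ^ (\<Sum>i\<in>UNIV. \<sigma> i)"
  have L: "L \<ge> 1" by (simp add: L_def)
  have K1: "compact ((cball 0 \<Lambda> - U) \<times> B)" using B U by (intro compact_Times compact_diff) auto
  have "(cball 0 \<Lambda> - U) \<times> B \<subseteq> {(x, y). x \<noteq> y}" using U by auto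
  then obtain B1 where B1: "B1 > 0" "\<forall>(x, y)\<in>(cball 0 \<Lambda> - U) \<times> B. \<Gamma> x y \<le> B1"
    using \<Gamma>_bounded_on_compact[OF K1] by blast
  obtain \<delta> where \<delta>: "\<delta> > 0" "\<forall>y\<in>ball 0 \<delta>. y \<noteq> 0 \<longrightarrow> \<Gamma> 0 y > 1" using near_pole by blast
  have "compact (cball 0 \<Lambda> - ball (0 :: real ^ 'n) \<delta>)" "0 \<notin> cball 0 \<Lambda> - ball (0 :: real ^ 'n) \<delta>"
    using \<delta>(1) by (auto intro: compact_diff)
  then obtain b where b: "b > 0" "\<forall>x\<in>cball 0 \<Lambda> - ball 0 \<delta>. b \<le> \<Gamma> 0 x"
    using \<Gamma>_0_lower_bound by blast
  have K2: "compact (sphere (0 :: real ^ 'n) 1 \<times> cball (0 :: real ^ 'n) (1 / 2))" by (intro compact_Times) auto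
  have "sphere (0 :: real ^ 'n) 1 \<times> cball (0 :: real ^ 'n) (1 / 2) \<subseteq> {(x, y). x \<noteq> y}" by auto
  then obtain B2 where B2: "B2 > 0" "\<forall>(x, y)\<in>sphere (0 :: real ^ 'n) 1 \<times> cball 0 (1 / 2). \<Gamma> x y \<le> B2"
    using \<Gamma>_bounded_on_compact[OF K2] by blast
  obtain b' where b': "b' > 0" "\<forall>x\<in>sphere 0 1. b' \<le> \<Gamma> 0 x"
    using \<Gamma>_0_lower_bound[of "sphere 0 1"] by auto
  define M where "M = max (B1 / min 1 b) (B2 / b')"
  have M: "M > 0" "B1 \<le> M * min 1 b" "B2 \<le> M * b'"
    using B1(1) B2(1) b(1) b'(1) by (auto simp: M_def less_max_iff_disj field_simps le_max_iff_disj)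
      (auto simp: max_def field_simps)
  have "\<Gamma> c y \<le> M * \<Gamma> 0 c" if c: "c \<noteq> 0" "c \<notin> U" and y: "y \<in> B" for c y
  proof (cases "norm c \<le> \<Lambda>")
    case True
    have "\<Gamma> c y \<le> B1" using B1(2) True c y by auto
    also have "\<dots> \<le> M * min 1 b" by (rule M)
    also have "min 1 b \<le> \<Gamma> 0 c"
    proof (cases "c \<in> ball 0 \<delta>")
      case True
      then have "\<Gamma> 0 c > 1" using \<delta> c by blast
      then show ?thesis by simp
    next
      case False
      then have "b \<le> \<Gamma> 0 c" using b(2) True by auto
      then show ?thesis by simp
    qed
    then have "M * min 1 b \<le> M * \<Gamma> 0 c" using M(1) by (intro mult_left_mono) auto
    finally show ?thesis .
  next
    case False
    obtain \<mu> where \<mu>: "\<mu> > 0" "norm (dil \<sigma> \<mu> c) = 1" using exists_unit_dil[OF c(1)] by blast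
    define l where "l = 1 / \<mu>"
    have l: "l > 0" "\<mu> = 1 / l" using \<mu> by (auto simp: l_def)
    define c1 where "c1 = dil \<sigma> \<mu> c"
    define y1 where "y1 = dil \<sigma> \<mu> y"
    have cl: "c = dil \<sigma> l c1" "y = dil \<sigma> l y1" using l by (simp_all add: c1_def y1_def dil_inverse)
    have "l > L"
    proof (rule ccontr)
      assume "\<not> l > L"
      then have "norm c \<le> L ^ (\<Sum>i\<in>UNIV. \<sigma> i) * norm c1"
        unfolding cl(1) using l L by (intro norm_dil_le_power) auto
      then show False using False \<mu> by (simp add: c1_def \<Lambda>_def)
    qed
    then have "1 \<le> l" "2 * \<beta> \<le> l" by (simp_all add: L_def)
    then have "\<mu> \<le> 1" "\<mu> * \<beta> \<le> 1 / 2" unfolding l(2) using l(1) by (simp_all add: divide_simps)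
    have "norm y1 \<le> \<mu> * norm y" unfolding y1_def using \<mu>(1) \<open>\<mu> \<le> 1\<close> by (intro norm_dil_shrink) auto
    also have "\<dots> \<le> \<mu> * \<beta>" using \<mu>(1) \<beta>(2)[OF y] by simp
    finally have y1: "norm y1 \<le> 1 / 2" using \<open>\<mu> * \<beta> \<le> 1 / 2\<close> by simp
    have c1: "norm c1 = 1" using \<mu> by (simp add: c1_def)
    have ne: "c1 \<noteq> y1" "0 \<noteq> c1" using c1 y1 by auto
    define w where "w = l powr (2 - real (\<Sum>i\<in>UNIV. \<sigma> i))"
    have w: "w > 0" using l by (simp add: w_def)
    have "\<Gamma> c y = w * \<Gamma> c1 y1" unfolding cl w_def by (rule \<Gamma>_dil[OF ne(1) l(1)])
    also have "\<Gamma> c1 y1 \<le> B2" using B2(2) c1 y1 by auto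
    then have "w * \<Gamma> c1 y1 \<le> w * (M * b')"
      using M(3) w by (intro mult_left_mono) auto
    also have "\<dots> \<le> w * (M * \<Gamma> 0 c1)"
      using b'(2) c1 M(1) w by (intro mult_left_mono) auto
    also have "\<dots> = M * \<Gamma> 0 c"
      using \<Gamma>_dil[OF ne(2) l(1)] by (simp add: cl w_def)
    finally show ?thesis .
  qed
  then show ?thesis using M(1) by blast
qed

text \<open>A ball of small ratio that meets \<open>cball v \<epsilon>\<close> has its centre near
  \<open>v\<close>, by \<open>far_centre_ratio\<close>. There \<open>\<Gamma> 0 c\<close> is bounded
  below, so \<open>r\<close> is at most a multiple of the ratio and \<open>weak_estimate\<close> at
  level \<open>1 / r\<close> applies.\<close>

lemma ball_measure_estimate:
  assumes i: "\<sigma> i = 1" and \<epsilon>: "\<epsilon> > 0" "2 * \<epsilon> < norm v"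
  shows "\<exists>C>0. \<exists>\<epsilon>1>0. \<forall>c r. c \<noteq> 0 \<longrightarrow> r > 0 \<longrightarrow> r * \<Gamma> 0 c \<le> \<epsilon>1 \<longrightarrow>
    emeasure lborel (cball v \<epsilon> \<inter> superlevel c (1 / r)) \<le> ennreal (C * (r * \<Gamma> 0 c) powr (1 + 2 / real Q))"
proof -
  define R where "R = norm v + 2 * \<epsilon>"
  let ?p = "1 + 2 / real Q"
  have R: "R \<ge> 0" using \<epsilon> by (simp add: R_def)
  obtain C t0 where C: "C > 0" "t0 > 0" "\<And>c t. c\<in>cball 0 R \<Longrightarrow> t \<ge> t0 \<Longrightarrow>
     emeasure lborel (cball 0 R \<inter> superlevel c t) \<le> ennreal (C * t powr (- ?p))"
    using weak_estimate[OF R R i] by blast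
  have "cball v \<epsilon> \<subseteq> ball v (2 * \<epsilon>)" using \<epsilon> by auto
  then obtain M where M: "M > 0" "\<And>c y. c \<noteq> 0 \<Longrightarrow> c \<notin> ball v (2 * \<epsilon>) \<Longrightarrow> y \<in> cball v \<epsilon> \<Longrightarrow> \<Gamma> c y \<le> M * \<Gamma> 0 c"
    using far_centre_ratio[of "cball v \<epsilon>" "ball v (2 * \<epsilon>)"] by auto
  have "0 \<notin> cball v (2 * \<epsilon>)" using \<epsilon> by (simp add: dist_norm)
  then obtain b where b: "b > 0" "\<And>c. c \<in> cball v (2 * \<epsilon>) \<Longrightarrow> b \<le> \<Gamma> 0 c"
    using \<Gamma>_0_lower_bound[of "cball v (2 * \<epsilon>)"] by auto
  have inR: "cball v (2 * \<epsilon>) \<subseteq> cball 0 R"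
  proof
    fix x assume "x \<in> cball v (2 * \<epsilon>)"
    then show "x \<in> cball 0 R" using norm_triangle_sub[of x v] by (simp add: R_def dist_norm norm_minus_commute)
  qed
  \<comment> \<open>The first entry forces the centre into \<open>cball v (2 * \<epsilon>)\<close>,
    the second makes \<open>1 / r \<ge> t0\<close>.\<close>
  define \<epsilon>1 where "\<epsilon>1 = min (1 / M) (b / t0)"
  have "emeasure lborel (cball v \<epsilon> \<inter> superlevel c (1 / r)) \<le> ennreal (C * b powr (- ?p) * (r * \<Gamma> 0 c) powr ?p)"
    if c: "c \<noteq> 0" and r: "r > 0" and a: "r * \<Gamma> 0 c \<le> \<epsilon>1" for c r
  proof (cases "cball v \<epsilon> \<inter> superlevel c (1 / r) = {}")
    case True
    then show ?thesis by simp
  next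
    case False
    then obtain y where "y \<in> cball v \<epsilon> \<inter> superlevel c (1 / r)" by blast
    then have y: "y \<in> cball v \<epsilon>" "y = c \<or> \<Gamma> c y > 1 / r" by (simp_all add: superlevel_def)
    have "c \<in> cball v (2 * \<epsilon>)"
    proof (rule ccontr)
      assume n: "c \<notin> cball v (2 * \<epsilon>)"
      then have "y \<noteq> c" using y \<epsilon> by auto
      then have "1 / r < \<Gamma> c y" using y by auto
      also have "\<dots> \<le> M * \<Gamma> 0 c" using M(2)[OF c _ y(1)] n by auto
      finally have "1 / M < r * \<Gamma> 0 c" using r M(1) by (simp add: field_simps)
      then show False using a by (simp add: \<epsilon>1_def)
    qed
    then have bc: "b \<le> \<Gamma> 0 c" and cR: "c \<in> cball 0 R" using b inR by auto
    have "r * b \<le> r * \<Gamma> 0 c" using bc r by (intro mult_left_mono) auto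
    also have "\<dots> \<le> b / t0" using a by (simp add: \<epsilon>1_def)
    finally have rt: "1 / r \<ge> t0" using r b(1) C(2) by (simp add: field_simps)
    have "emeasure lborel (cball v \<epsilon> \<inter> superlevel c (1 / r)) \<le> emeasure lborel (cball 0 R \<inter> superlevel c (1 / r))"
      using inR \<epsilon>(1) by (intro emeasure_mono) auto
    also have "\<dots> \<le> ennreal (C * (1 / r) powr (- ?p))" by (rule C(3)[OF cR rt])
    also have "(1 / r) powr (- ?p) = r powr ?p"
    proof -
      have "(1 / r) powr (- z) = r powr z" for z using r by (simp add: powr_minus powr_divide)
      then show ?thesis by blast
    qed
    also have "r powr ?p \<le> (r * \<Gamma> 0 c / b) powr ?p"
      using r bc b(1) by (intro powr_mono2) (auto simp: field_simps)
    also have "\<dots> = b powr (- ?p) * (r * \<Gamma> 0 c) powr ?p"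
    proof -
      have "(A / b) powr z = b powr (- z) * A powr z" if "A \<ge> 0" for A z
        using that b(1) by (simp add: powr_divide powr_minus divide_simps)
      moreover have "r * \<Gamma> 0 c \<ge> 0" using r bc b(1) by simp
      ultimately show ?thesis by blast
    qed
    finally show ?thesis using C(1) by (simp add: ennreal_leI mult.assoc mult_left_mono)
  qed
  moreover have "C * b powr (- ?p) > 0" using C(1) b(1) by simp
  moreover have "\<epsilon>1 > 0" using M(1) b(1) C(2) by (simp add: \<epsilon>1_def)
  ultimately show ?thesis by blast
qed

lemma superlevel_dil:
  assumes l: "l > 0" and "dil \<sigma> l y \<in> superlevel c t"
  shows "y \<in> superlevel (dil \<sigma> (1 / l) c) ((1 / l) powr (2 - real (\<Sum>i\<in>UNIV. \<sigma> i)) * t)"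
proof (cases "dil \<sigma> l y = c")
  case True
  then have "y = dil \<sigma> (1 / l) c" using l by (metis dil_inverse(1) less_irrefl)
  then show ?thesis by (simp add: superlevel_def)
next
  case False
  then have "\<Gamma> c (dil \<sigma> l y) > t" using assms(2) by (simp add: superlevel_def)
  then have "(1 / l) powr (2 - real (\<Sum>i\<in>UNIV. \<sigma> i)) * t <
     (1 / l) powr (2 - real (\<Sum>i\<in>UNIV. \<sigma> i)) * \<Gamma> c (dil \<sigma> l y)" using l by simp
  also have "\<dots> = \<Gamma> (dil \<sigma> (1 / l) c) (dil \<sigma> (1 / l) (dil \<sigma> l y))"
    using \<Gamma>_dil[of c "dil \<sigma> l y" "1 / l"] False l by simp
  also have "dil \<sigma> (1 / l) (dil \<sigma> l y) = y" using l by (simp add: dil_inverse)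
  finally show ?thesis by (simp add: superlevel_def)
qed

text \<open>Dilations fix 0, so \<open>\<Gamma> 0 c\<close> scales inversely to the radius and the
  terms of the series survive the rescaling. A tail of the series then bounds the measure of a fixed
  ball.\<close>

theorem cone_not_p_bounded:
  assumes i: "\<sigma> i = 1" and CF: "C \<subseteq> F" and C: "nondegenerate_cone \<sigma> C"
  shows "\<not> p_bounded \<Gamma> (1 + 2 / real Q) F"
proof
  let ?p = "1 + 2 / real Q"
  assume "p_bounded \<Gamma> ?p F"
  then obtain J :: "nat set" and c r where J: "\<And>n. n \<in> J \<Longrightarrow> r n > 0 \<and> c n \<noteq> 0"
    and cover: "F \<subseteq> (\<Union>n\<in>J. gamma_ball \<Gamma> (c n) (r n))"
    and summ: "(\<lambda>n. (r n / gamma_recip \<Gamma> 0 (c n)) powr ?p) summable_on J"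
    unfolding p_bounded_def by blast
  define a where "a n = r n * \<Gamma> 0 (c n)" for n
  have "(\<lambda>n. a n powr ?p) summable_on J"
    by (rule summable_on_cong[THEN iffD1, OF _ summ]) (use J in \<open>auto simp: a_def gamma_recip_def\<close>)
  then obtain S where S: "((\<lambda>n. a n powr ?p) has_sum S) J" by (auto simp: summable_on_def)
  obtain l0 where l0: "l0 > 0" "\<And>l. l \<ge> l0 \<Longrightarrow> dil \<sigma> l ` C \<subseteq> C" and "interior C \<noteq> {}"
    using C unfolding nondegenerate_cone_def by blast
  \<comment> \<open>The centre \<open>v\<close> has to be nonzero for dilations to carry it to
    infinity.\<close>
  have "interior C \<noteq> {0}"
  proof
    assume "interior C = {0}"
    then have "open {0 :: real ^ 'n}" using open_interior[of C] by simp
    then show False by (simp add: not_open_singleton)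
  qed
  then obtain v where v: "v \<in> interior C" "v \<noteq> 0" using \<open>interior C \<noteq> {}\<close> by blast
  obtain e where e: "e > 0" "cball v e \<subseteq> C" using v(1) by (auto simp: mem_interior_cball)
  \<comment> \<open>The bound \<open>norm v / 3\<close> keeps the ball at distance more than
    \<open>\<epsilon>\<close> from the origin.\<close>
  define \<epsilon> where "\<epsilon> = min e (norm v / 3)"
  have \<epsilon>: "\<epsilon> > 0" "2 * \<epsilon> < norm v" "cball v \<epsilon> \<subseteq> C" using e v(2) by (auto simp: \<epsilon>_def min_def)
  define B where "B = cball v \<epsilon>"
  obtain K \<epsilon>1 where K: "K > 0" "\<epsilon>1 > 0" "\<And>c r. c \<noteq> 0 \<Longrightarrow> r > 0 \<Longrightarrow> r * \<Gamma> 0 c \<le> \<epsilon>1 \<Longrightarrow>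
    emeasure lborel (B \<inter> superlevel c (1 / r)) \<le> ennreal (K * (r * \<Gamma> 0 c) powr ?p)"
    using ball_measure_estimate[OF i \<epsilon>(1,2)] unfolding B_def by blast
  define vol where "vol = unit_ball_vol (real CARD('n)) * \<epsilon> ^ CARD('n)"
  have vol: "vol > 0" "emeasure lborel B = ennreal vol"
    using \<epsilon>(1) by (simp_all add: vol_def B_def emeasure_cball)
  \<comment> \<open>The first entry makes the total measure of the tail smaller than that of
    \<open>B\<close>; the second makes each ratio in the tail small enough for
    \<open>ball_measure_estimate\<close>.\<close>
  define \<eta> where "\<eta> = min (vol / K) (\<epsilon>1 powr ?p)"
  have \<eta>: "\<eta> > 0" using vol K by (simp add: \<eta>_def)
  have "\<forall>\<^sub>F G in finite_subsets_at_top J. dist (\<Sum>n\<in>G. a n powr ?p) S < \<eta> / 2"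
    using S \<eta> unfolding has_sum_def by (intro tendstoD) auto
  then obtain J0 where "finite J0 \<and> J0 \<subseteq> J \<and>
    (\<forall>G. finite G \<and> J0 \<subseteq> G \<and> G \<subseteq> J \<longrightarrow> dist (\<Sum>n\<in>G. a n powr ?p) S < \<eta> / 2)"
    unfolding eventually_finite_subsets_at_top ..
  then have J0: "finite J0" "J0 \<subseteq> J"
    "\<And>G. finite G \<Longrightarrow> J0 \<subseteq> G \<Longrightarrow> G \<subseteq> J \<Longrightarrow> dist (\<Sum>n\<in>G. a n powr ?p) S < \<eta> / 2"
    by simp_all
  have tail: "(\<Sum>n\<in>G. a n powr ?p) < \<eta>" if "finite G" "G \<subseteq> J - J0" for G
  proof -
    have "dist (\<Sum>n\<in>J0 \<union> G. a n powr ?p) S < \<eta> / 2" "dist (\<Sum>n\<in>J0. a n powr ?p) S < \<eta> / 2"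
      using that J0 by (intro J0(3); auto)+
    moreover have "(\<Sum>n\<in>J0 \<union> G. a n powr ?p) = (\<Sum>n\<in>J0. a n powr ?p) + (\<Sum>n\<in>G. a n powr ?p)"
      using that J0(1) by (intro sum.union_disjoint) auto
    ultimately show ?thesis unfolding dist_real_def by linarith
  qed
  have small: "a n \<le> \<epsilon>1" if n: "n \<in> J - J0" for n
  proof (rule ccontr)
    assume "\<not> a n \<le> \<epsilon>1"
    then have "\<epsilon>1 powr ?p \<le> a n powr ?p" using K(2) by (intro powr_mono2) auto
    moreover have "a n powr ?p < \<eta>" using tail[of "{n}"] n by simp
    ultimately show False by (simp add: \<eta>_def)
  qed
  have "bounded (\<Union>n\<in>J0. gamma_ball \<Gamma> (c n) (r n))"
  proof (rule bounded_UN)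
    show "\<forall>n\<in>J0. bounded (gamma_ball \<Gamma> (c n) (r n))"
    proof
      fix n assume "n \<in> J0"
      then have "r n > 0" using J J0 by blast
      then show "bounded (gamma_ball \<Gamma> (c n) (r n))" by (simp add: gamma_ball_superlevel bounded_superlevel)
    qed
  qed (rule J0(1))
  then obtain \<rho> where \<rho>: "\<rho> > 0" "\<And>y. y \<in> (\<Union>n\<in>J0. gamma_ball \<Gamma> (c n) (r n)) \<Longrightarrow> norm y \<le> \<rho>"
    unfolding bounded_pos by blast
  \<comment> \<open>\<open>l \<ge> l0\<close> keeps the dilated ball in the cone,
    \<open>l \<ge> 1\<close> makes dilation expand norms by at least \<open>l\<close>, and
    \<open>l * \<epsilon> > \<rho>\<close> moves it off the finitely many balls indexed by
    \<open>J0\<close>.\<close>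
  define l where "l = max (max l0 1) (2 * \<rho> / \<epsilon>)"
  have l: "l \<ge> l0" "l \<ge> 1" "l > 0" "l * \<epsilon> > \<rho>"
  proof -
    have "2 * \<rho> / \<epsilon> \<le> l" by (simp add: l_def)
    then have "2 * \<rho> \<le> l * \<epsilon>" using \<epsilon>(1) by (simp add: field_simps)
    then show "l * \<epsilon> > \<rho>" using \<rho>(1) by linarith
  qed (auto simp: l_def)
  define w where "w = (1 / l) powr (2 - real (\<Sum>i\<in>UNIV. \<sigma> i))"
  have w: "w > 0" using l by (simp add: w_def)
  define c' where "c' n = dil \<sigma> (1 / l) (c n)" for n
  define r' where "r' n = r n / w" for n
  have c'0: "c' n \<noteq> 0" "r' n > 0" if "n \<in> J" for n
  proof -
    have "dil \<sigma> l (c' n) = c n" using l(3) by (simp add: c'_def dil_inverse)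
    then show "c' n \<noteq> 0" using J[OF that] by auto
    show "r' n > 0" using J[OF that] w by (simp add: r'_def)
  qed
  \<comment> \<open>The factor \<open>w\<close> gained by \<Gamma> is lost by the radius.\<close>
  have a': "r' n * \<Gamma> 0 (c' n) = a n" if "n \<in> J" for n
  proof -
    have "\<Gamma> 0 (c' n) = w * \<Gamma> 0 (c n)"
      using \<Gamma>_dil[of 0 "c n" "1 / l"] J[OF that] l(3) by (simp add: c'_def w_def)
    then show ?thesis using w by (simp add: r'_def a_def)
  qed
  have covB: "B \<subseteq> (\<Union>n\<in>J - J0. superlevel (c' n) (1 / r' n))"
  proof
    fix y assume y: "y \<in> B"
    then have "y \<in> C" using \<epsilon>(3) by (auto simp: B_def)
    then have "dil \<sigma> l y \<in> C" using l0(2)[OF l(1)] by blast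
    then obtain n where n: "n \<in> J" "dil \<sigma> l y \<in> gamma_ball \<Gamma> (c n) (r n)" using cover CF by blast
    have "norm v \<le> norm y + \<epsilon>"
      using y norm_triangle_sub[of v y] by (simp add: B_def dist_norm)
    then have "norm y \<ge> \<epsilon>" using \<epsilon>(2) by linarith
    then have "\<rho> < l * norm y" using l(3,4) by (smt (verit) mult_left_mono)
    also have "\<dots> \<le> norm (dil \<sigma> l y)" by (rule norm_dil_expand[OF l(2)])
    finally have "n \<notin> J0" using \<rho>(2)[of "dil \<sigma> l y"] n(2) by force
    moreover have "y \<in> superlevel (c' n) (w * (1 / r n))"
      unfolding c'_def w_def
      by (rule superlevel_dil[OF l(3)]) (use n J in \<open>simp add: gamma_ball_superlevel\<close>)
    then have "y \<in> superlevel (c' n) (1 / r' n)" by (simp add: r'_def)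
    ultimately show "y \<in> (\<Union>n\<in>J - J0. superlevel (c' n) (1 / r' n))" using n(1) by blast
  qed
  have "compact B" by (simp add: B_def)
  then obtain G where G: "G \<subseteq> J - J0" "finite G" "B \<subseteq> (\<Union>n\<in>G. superlevel (c' n) (1 / r' n))"
    using compactE_image[OF _ _ covB] open_superlevel by metis
  have "ennreal vol = emeasure lborel B" by (simp add: vol)
  also have "\<dots> \<le> emeasure lborel (\<Union>n\<in>G. B \<inter> superlevel (c' n) (1 / r' n))"
    using G(3) by (intro emeasure_mono) (auto simp: G(2) B_def intro!: sets.finite_UN)
  also have "\<dots> \<le> (\<Sum>n\<in>G. emeasure lborel (B \<inter> superlevel (c' n) (1 / r' n)))"
    by (rule emeasure_subadditive_finite[OF G(2)]) (auto simp: B_def)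
  also have "\<dots> \<le> (\<Sum>n\<in>G. ennreal (K * a n powr ?p))"
  proof (rule sum_mono)
    fix n assume "n \<in> G"
    then have n: "n \<in> J - J0" "n \<in> J" using G(1) by auto
    show "emeasure lborel (B \<inter> superlevel (c' n) (1 / r' n)) \<le> ennreal (K * a n powr ?p)"
      using K(3)[OF c'0[OF n(2)]] small[OF n(1)] a'[OF n(2)] by simp
  qed
  also have "\<dots> = ennreal (K * (\<Sum>n\<in>G. a n powr ?p))"
    using K(1) by (simp add: sum_ennreal sum_distrib_left)
  finally have "vol \<le> K * (\<Sum>n\<in>G. a n powr ?p)"
    using K(1) by (subst (asm) ennreal_le_iff) (auto intro!: mult_nonneg_nonneg sum_nonneg)
  also have "\<dots> < K * \<eta>" using tail[OF G(2,1)] K(1) by simp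
  also have "\<dots> \<le> vol" using K(1) by (simp add: \<eta>_def min_def field_simps)
  finally show False by simp
qed

end

theorem proposition1p12:
  fixes \<sigma> :: "'n::{finite,linorder} \<Rightarrow> nat"
    and m :: nat
    and X :: "nat \<Rightarrow> real ^ 'n::{finite,linorder} \<Rightarrow> real ^ 'n::{finite,linorder}"
    and \<Gamma> :: "real ^ 'n::{finite,linorder} \<Rightarrow> real ^ 'n::{finite,linorder} \<Rightarrow> real"
    and F :: "(real ^ 'n::{finite,linorder}) set"
  assumes "CARD('n) \<ge> 3"
    and "homogeneous_hoermander \<sigma> m X"
    and "fundamental_solution \<sigma> m X \<Gamma>"
    and "\<exists>C. C \<subseteq> F \<and> nondegenerate_cone \<sigma> C"
  shows "\<exists>p>1. \<not> p_bounded \<Gamma> p F"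
proof -
  have mono: "mono \<sigma>" and min: "\<sigma> (Min UNIV) = 1"
    and X: "\<And>j. j \<in> {1..m} \<Longrightarrow> smooth_on UNIV (X j) \<and> homogeneous_degree_1 \<sigma> (X j)"
    and rank: "dim {V 0 | V. V \<in> lie_generated (X ` {1..m})} = CARD('n)"
    using assms(2) unfolding homogeneous_hoermander_def by blast+
  have pos: "\<sigma> i > 0" for i
  proof -
    have "\<sigma> (Min UNIV) \<le> \<sigma> i" using mono by (simp add: monoD)
    then show ?thesis using min by simp
  qed
  interpret weights \<sigma> by unfold_locales (rule pos)
  interpret fundamental \<sigma> m X \<Gamma>
  proof unfold_locales
    show "hom_vf 1 (X j)" if "j \<in> {1..m}" for j
      using hom_vf_of_homogeneous_degree_1 X[OF that] by blast
    show "span {V 0 | V. V \<in> lie_generated (X ` {1..m})} = UNIV"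
      using rank by (simp add: dim_eq_full[symmetric])
  qed (rule assms(3))
  have "Q > 0" using weight_pos by (simp add: Q_def sum_pos)
  then have "1 + 2 / real Q > 1" by simp
  \<comment> \<open>The first coordinate has weight 1 and serves for the initial
    displacement.\<close>
  then show ?thesis using cone_not_p_bounded[OF min] assms(4) by blast
qed

end
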